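(* Assume $n\ge2k$. The collection of all nonzero spaces $eM_{\lambda,\mu}$, for $\lambda,\mu$ partitions of $r$ and $r=0,1,\dots,k$, is a complete set of pairwise nonisomorphic irreducible modules for the algebra $\mathcal C=\mathrm{End}_{\mathfrak g}(eM)\cong e\,\mathrm{End}_{\mathfrak g}(M)\,e|_{eM}\cong\mathrm{End}_{\mathfrak{sl}_n}(\mathfrak{sl}_n^{\otimes k})$.
   Context: $\mathfrak g=\mathfrak{gl}_n(\mathbb{C})$; $V=\mathbb{C}^n$ (basis $v_1,\dots,v_n$), $V^*$ (dual basis $v_1^*,\dots,v_n^*$), $\mathfrak g$ acting on $V$ by left multiplication and on $V^*$ by $w^*\mapsto-w^*x$; $M=V^{\otimes k}\otimes(V^* )^{\otimes k}$ with the tensor product action. For $1\le i,j\le k$ the contraction $c_{i,j}:M\to M$ is $c_{i,j}(u_1\otimes\cdots\otimes u_k\otimes w_1^*\otimes\cdots\otimes w_k^* )=(w_j^*u_i)\sum_{\ell=1}^n(\text{same tensor with }u_i\text{ replaced by }v_\ell\text{ and }w_j^*\text{ by }v_\ell^* )$; $p_i=\frac1nc_{i,i}$; $e=(\mathrm{id}-p_1)\cdots(\mathrm{id}-p_k)$, and $eM\cong\mathfrak{sl}_n^{\otimes k}$ (adjoint action on each factor). For $0\le r\le k$, $\underline s=(s_1<\cdots<s_{k-r})\subseteq\{1,\dots,k\}$ and $\underline t=(t_1,\dots,t_{k-r})$ distinct elements of $\{1,\dots,k\}$, $c_{\underline s,\underline t}=c_{s_1,t_1}\cdots c_{s_{k-r},t_{k-r}}$.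 For a standard tableau $T$ (rows, columns increasing) with entries in a subset of $\{1,\dots,k\}$, $y_T=(\sum_{\rho\in R_T}\rho)(\sum_{\gamma\in C_T}\mathrm{sgn}(\gamma)\gamma)$ where $R_T$, $C_T$ are the permutations of $\{1,\dots,k\}$ fixing non-entries and preserving each row, resp. column, of $T$; $y_T$ acts by place permutations on $V^{\otimes k}$, $y_{T^*}$ on $(V^* )^{\otimes k}$. $x'_{T,T^*,\underline s,\underline t}=u'_1\otimes\cdots\otimes u'_k\otimes(w_1^* )'\otimes\cdots\otimes(w_k^* )'$ with $u'_p=v_{r+i}$ if $p=s_i$, $u'_p=v_j$ if $p\notin\underline s$ is in row $j$ of $T$, $(w_p^* )'=v_{r+i}^*$ if $p=t_i$, $(w_p^* )'=v_{n-j+1}^*$ if $p\notin\underline t$ is in row $j$ of $T^*$. For partitions $\lambda,\mu$ of $r$, $M_{\lambda,\mu}$ is the span of all $y_Ty_{T^*}c_{\underline s,\underline t}x'_{T,T^*,\underline s,\underline t}$ over all such $\underline s,\underline t$ and standard tableaux $T$ of shape $\lambda$ with entries in $\{1,\dots,k\}\setminus\underline s$ and $T^*$ of shape $\mu$ with entries in $\{1,\dots,k\}\setminus\underline t$; $M_{\lambda,\mu}$ is an $\mathrm{End}_{\mathfrak g}(M)$-module, and $eM_{\lambda,\mu}$ is a module for $e\,\mathrm{End}_{\mathfrak g}(M)\,e$, hence (by restriction to $eM$) for $\mathcal C$. *)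

theory Defs
  imports Complex_Main "HOL-Library.Function_Algebras" "HOL-Combinatorics.Permutations"
begin

text \<open>A basis tensor v_{a 1} (x) ... (x) v_{a k} (x) v^*_{b 1} (x) ... (x) v^*_{b k}
  is indexed by a pair (a,b) of extensional maps {1..k} -> {1..n}.
  Elements of M are complex-valued coefficient functions on such index pairs,
  vanishing outside the valid index set.\<close>

type_synonym idx = "(nat \<Rightarrow> nat) \<times> (nat \<Rightarrow> nat)"
type_synonym tens = "idx \<Rightarrow> complex"

definition smul :: "complex \<Rightarrow> ('b \<Rightarrow> complex) \<Rightarrow> ('b \<Rightarrow> complex)" where
  "smul c u = (\<lambda>z. c * u z)"

definition Idx :: "nat \<Rightarrow> nat \<Rightarrow> idx set" where
  "Idx n k = (PiE {1..k} (\<lambda>_. {1..n})) \<times> (PiE {1..k} (\<lambda>_. {1..n}))"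

definition Mset :: "nat \<Rightarrow> nat \<Rightarrow> tens set" where
  "Mset n k = {u. \<forall>z. z \<notin> Idx n k \<longrightarrow> u z = 0}"

definition bt :: "(nat \<Rightarrow> nat) \<Rightarrow> (nat \<Rightarrow> nat) \<Rightarrow> tens" where
  "bt a b = (\<lambda>z. if z = (a, b) then 1 else 0)"

text \<open>Action of x in gl_n (matrix entries x i j, 1 <= i,j <= n) on M:
  x v_j = sum_i x_{ij} v_i, and x . v_j^* = - v_j^* x = - sum_i x_{ji} v_i^*,
  extended to tensors as a derivation.  Written in coordinates.\<close>

definition gl_act :: "nat \<Rightarrow> nat \<Rightarrow> (nat \<Rightarrow> nat \<Rightarrow> complex) \<Rightarrow> tens \<Rightarrow> tens" where
  "gl_act n k x u = (\<lambda>(a, b). if (a, b) \<in> Idx n k then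
      (\<Sum>p\<in>{1..k}. \<Sum>j\<in>{1..n}. x (a p) j * u (a(p := j), b))
    - (\<Sum>p\<in>{1..k}. \<Sum>j\<in>{1..n}. x j (b p) * u (a, b(p := j)))
    else 0)"

definition contr :: "nat \<Rightarrow> nat \<Rightarrow> nat \<Rightarrow> nat \<Rightarrow> tens \<Rightarrow> tens" where
  "contr n k i j u = (\<lambda>(a, b). if (a, b) \<in> Idx n k \<and> a i = b j
      then (\<Sum>m\<in>{1..n}. u (a(i := m), b(j := m))) else 0)"

definition proj :: "nat \<Rightarrow> nat \<Rightarrow> nat \<Rightarrow> tens \<Rightarrow> tens" where
  "proj n k i u = smul (1 / of_nat n) (contr n k i i u)"

definition eop :: "nat \<Rightarrow> nat \<Rightarrow> tens \<Rightarrow> tens" where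
  "eop n k = foldr (\<lambda>i f. (\<lambda>v. v - proj n k i v) \<circ> f) [1..<k+1] id"

definition eM :: "nat \<Rightarrow> nat \<Rightarrow> tens set" where
  "eM n k = eop n k ` Mset n k"

text \<open>Endomorphisms of eM are represented as maps on tens which are extensional
  (zero outside eM), so that equality of elements of C is meaningful.\<close>

definition EndC :: "nat \<Rightarrow> nat \<Rightarrow> (tens \<Rightarrow> tens) set" where
  "EndC n k = {f. (\<forall>u\<in>eM n k. f u \<in> eM n k)
      \<and> (\<forall>u\<in>eM n k. \<forall>v\<in>eM n k. f (u + v) = f u + f v)
      \<and> (\<forall>c. \<forall>u\<in>eM n k. f (smul c u) = smul c (f u))
      \<and> (\<forall>x. \<forall>u\<in>eM n k. f (gl_act n k x u) = gl_act n k x (f u))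
      \<and> (\<forall>u. u \<notin> eM n k \<longrightarrow> f u = 0)}"

definition unitC :: "nat \<Rightarrow> nat \<Rightarrow> tens \<Rightarrow> tens" where
  "unitC n k = (\<lambda>u. if u \<in> eM n k then u else 0)"

definition is_subspace :: "('b \<Rightarrow> complex) set \<Rightarrow> bool" where
  "is_subspace N \<longleftrightarrow> 0 \<in> N \<and> (\<forall>u\<in>N. \<forall>v\<in>N. u + v \<in> N) \<and> (\<forall>c. \<forall>u\<in>N. smul c u \<in> N)"

text \<open>A (unital) C-module: a complex vector space N (realised as a subspace of
  some function space 'b => complex; every complex vector space arises so)
  with an algebra representation rho of C.\<close>

definition is_Cmod :: "nat \<Rightarrow> nat \<Rightarrow> ('b \<Rightarrow> complex) set
    \<Rightarrow> ((tens \<Rightarrow> tens) \<Rightarrow> ('b \<Rightarrow> complex) \<Rightarrow> ('b \<Rightarrow> complex)) \<Rightarrow> bool" where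
  "is_Cmod n k N \<rho> \<longleftrightarrow> is_subspace N
    \<and> (\<forall>f\<in>EndC n k. \<forall>u\<in>N. \<rho> f u \<in> N)
    \<and> (\<forall>f\<in>EndC n k. \<forall>u\<in>N. \<forall>v\<in>N. \<rho> f (u + v) = \<rho> f u + \<rho> f v)
    \<and> (\<forall>f\<in>EndC n k. \<forall>c. \<forall>u\<in>N. \<rho> f (smul c u) = smul c (\<rho> f u))
    \<and> (\<forall>f\<in>EndC n k. \<forall>g\<in>EndC n k. \<forall>u\<in>N. \<rho> (f + g) u = \<rho> f u + \<rho> g u)
    \<and> (\<forall>f\<in>EndC n k. \<forall>c. \<forall>u\<in>N. \<rho> (\<lambda>v. smul c (f v)) u = smul c (\<rho> f u))
    \<and> (\<forall>f\<in>EndC n k. \<forall>g\<in>EndC n k. \<forall>u\<in>N. \<rho> (f \<circ> g) u = \<rho> f (\<rho> g u))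
    \<and> (\<forall>u\<in>N. \<rho> (unitC n k) u = u)"

definition is_Csubmod :: "nat \<Rightarrow> nat \<Rightarrow> ('b \<Rightarrow> complex) set
    \<Rightarrow> ((tens \<Rightarrow> tens) \<Rightarrow> ('b \<Rightarrow> complex) \<Rightarrow> ('b \<Rightarrow> complex)) \<Rightarrow> ('b \<Rightarrow> complex) set \<Rightarrow> bool" where
  "is_Csubmod n k N \<rho> W \<longleftrightarrow> W \<subseteq> N \<and> is_subspace W \<and> (\<forall>f\<in>EndC n k. \<forall>u\<in>W. \<rho> f u \<in> W)"

definition irreducible_Cmod :: "nat \<Rightarrow> nat \<Rightarrow> ('b \<Rightarrow> complex) set
    \<Rightarrow> ((tens \<Rightarrow> tens) \<Rightarrow> ('b \<Rightarrow> complex) \<Rightarrow> ('b \<Rightarrow> complex)) \<Rightarrow> bool" where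
  "irreducible_Cmod n k N \<rho> \<longleftrightarrow> is_Cmod n k N \<rho> \<and> N \<noteq> {0}
    \<and> (\<forall>W. is_Csubmod n k N \<rho> W \<longrightarrow> W = {0} \<or> W = N)"

definition Cmod_iso :: "nat \<Rightarrow> nat
    \<Rightarrow> ('b \<Rightarrow> complex) set \<Rightarrow> ((tens \<Rightarrow> tens) \<Rightarrow> ('b \<Rightarrow> complex) \<Rightarrow> ('b \<Rightarrow> complex))
    \<Rightarrow> ('c \<Rightarrow> complex) set \<Rightarrow> ((tens \<Rightarrow> tens) \<Rightarrow> ('c \<Rightarrow> complex) \<Rightarrow> ('c \<Rightarrow> complex)) \<Rightarrow> bool" where
  "Cmod_iso n k N \<rho> N' \<rho>' \<longleftrightarrow> (\<exists>\<phi>. bij_betw \<phi> N N'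
     \<and> (\<forall>u\<in>N. \<forall>v\<in>N. \<phi> (u + v) = \<phi> u + \<phi> v)
     \<and> (\<forall>c. \<forall>u\<in>N. \<phi> (smul c u) = smul c (\<phi> u))
     \<and> (\<forall>f\<in>EndC n k. \<forall>u\<in>N. \<phi> (\<rho> f u) = \<rho>' f (\<phi> u)))"

definition is_partition :: "nat \<Rightarrow> nat list \<Rightarrow> bool" where
  "is_partition r lam \<longleftrightarrow> sorted_wrt (\<ge>) lam \<and> 0 \<notin> set lam \<and> sum_list lam = r"

definition cells :: "nat list \<Rightarrow> (nat \<times> nat) set" where
  "cells lam = {(i, j). 1 \<le> i \<and> i \<le> length lam \<and> 1 \<le> j \<and> j \<le> lam ! (i - 1)}"

definition std_tableau :: "nat list \<Rightarrow> nat set \<Rightarrow> (nat \<times> nat \<Rightarrow> nat) \<Rightarrow> bool" where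
  "std_tableau lam S T \<longleftrightarrow> bij_betw T (cells lam) S
    \<and> (\<forall>i j j'. (i, j) \<in> cells lam \<and> (i, j') \<in> cells lam \<and> j < j' \<longrightarrow> T (i, j) < T (i, j'))
    \<and> (\<forall>i i' j. (i, j) \<in> cells lam \<and> (i', j) \<in> cells lam \<and> i < i' \<longrightarrow> T (i, j) < T (i', j))"

definition row_of :: "nat list \<Rightarrow> (nat \<times> nat \<Rightarrow> nat) \<Rightarrow> nat \<Rightarrow> nat" where
  "row_of lam T p = fst (THE c. c \<in> cells lam \<and> T c = p)"

definition col_of :: "nat list \<Rightarrow> (nat \<times> nat \<Rightarrow> nat) \<Rightarrow> nat \<Rightarrow> nat" where
  "col_of lam T p = snd (THE c. c \<in> cells lam \<and> T c = p)"

definition row_perms :: "nat list \<Rightarrow> (nat \<times> nat \<Rightarrow> nat) \<Rightarrow> (nat \<Rightarrow> nat) set" where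
  "row_perms lam T = {\<sigma>. \<sigma> permutes (T ` cells lam)
     \<and> (\<forall>p\<in>T ` cells lam. row_of lam T (\<sigma> p) = row_of lam T p)}"

definition col_perms :: "nat list \<Rightarrow> (nat \<times> nat \<Rightarrow> nat) \<Rightarrow> (nat \<Rightarrow> nat) set" where
  "col_perms lam T = {\<sigma>. \<sigma> permutes (T ` cells lam)
     \<and> (\<forall>p\<in>T ` cells lam. col_of lam T (\<sigma> p) = col_of lam T p)}"

text \<open>Place permutations (left action: sigma sends the factor in position p to
  position sigma p), on V^{(x)k} resp. (V^* )^{(x)k}, in coordinates.\<close>

definition placeV :: "(nat \<Rightarrow> nat) \<Rightarrow> tens \<Rightarrow> tens" where
  "placeV \<sigma> u = (\<lambda>(a, b). u (a \<circ> \<sigma>, b))"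

definition placeW :: "(nat \<Rightarrow> nat) \<Rightarrow> tens \<Rightarrow> tens" where
  "placeW \<sigma> u = (\<lambda>(a, b). u (a, b \<circ> \<sigma>))"

definition yV :: "nat list \<Rightarrow> (nat \<times> nat \<Rightarrow> nat) \<Rightarrow> tens \<Rightarrow> tens" where
  "yV lam T u = (\<Sum>\<rho>\<in>row_perms lam T. placeV \<rho>
      (\<Sum>\<gamma>\<in>col_perms lam T. smul (of_int (sign \<gamma>)) (placeV \<gamma> u)))"

definition yW :: "nat list \<Rightarrow> (nat \<times> nat \<Rightarrow> nat) \<Rightarrow> tens \<Rightarrow> tens" where
  "yW lam T u = (\<Sum>\<rho>\<in>row_perms lam T. placeW \<rho>
      (\<Sum>\<gamma>\<in>col_perms lam T. smul (of_int (sign \<gamma>)) (placeW \<gamma> u)))"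

definition cst :: "nat \<Rightarrow> nat \<Rightarrow> nat list \<Rightarrow> nat list \<Rightarrow> tens \<Rightarrow> tens" where
  "cst n k s t = foldr (\<lambda>(i, j) f. contr n k i j \<circ> f) (zip s t) id"

definition pos :: "nat list \<Rightarrow> nat \<Rightarrow> nat" where
  "pos s p = Suc (THE q. q < length s \<and> s ! q = p)"

definition xprime :: "nat \<Rightarrow> nat \<Rightarrow> nat list \<Rightarrow> (nat \<times> nat \<Rightarrow> nat)
    \<Rightarrow> nat list \<Rightarrow> (nat \<times> nat \<Rightarrow> nat) \<Rightarrow> nat list \<Rightarrow> nat list \<Rightarrow> tens" where
  "xprime n k lam T mu Ts s t =
     (let r = sum_list lam in
      bt (\<lambda>p. if p \<in> {1..k} then (if p \<in> set s then r + pos s p else row_of lam T p) else undefined)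
         (\<lambda>p. if p \<in> {1..k} then (if p \<in> set t then r + pos t p else n + 1 - row_of mu Ts p)
              else undefined))"

definition cspan :: "('b \<Rightarrow> complex) set \<Rightarrow> ('b \<Rightarrow> complex) set" where
  "cspan A = {u. \<exists>F c. finite F \<and> F \<subseteq> A \<and> u = (\<Sum>v\<in>F. smul (c v) v)}"

definition Mlm :: "nat \<Rightarrow> nat \<Rightarrow> nat list \<Rightarrow> nat list \<Rightarrow> tens set" where
  "Mlm n k lam mu = (let r = sum_list lam in cspan
     {yV lam T (yW mu Ts (cst n k s t (xprime n k lam T mu Ts s t))) | s t T Ts.
        sorted_wrt (<) s \<and> set s \<subseteq> {1..k} \<and> length s = k - r
      \<and> distinct t \<and> set t \<subseteq> {1..k} \<and> length t = k - r
      \<and> std_tableau lam ({1..k} - set s) T \<and> std_tableau mu ({1..k} - set t) Ts})"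

definition eMlm :: "nat \<Rightarrow> nat \<Rightarrow> nat list \<Rightarrow> nat list \<Rightarrow> tens set" where
  "eMlm n k lam mu = eop n k ` Mlm n k lam mu"

definition nonzero_labels :: "nat \<Rightarrow> nat \<Rightarrow> (nat list \<times> nat list) set" where
  "nonzero_labels n k = {(lam, mu). \<exists>r\<le>k. is_partition r lam \<and> is_partition r mu
      \<and> eMlm n k lam mu \<noteq> {0}}"

end

theory Submission
  imports Defs
begin

text \<open>The unitary form on the tensor space makes the operators of \<open>gl\<^sub>n\<close> contravariant, so a vector killed by
all raising operators and of fixed weight generates a simple module, and two such vectors of equal
weight are exchanged by an intertwiner. Hence for every weight the space of maximal vectors in
\<open>e M\<close> is zero or a simple module of the commutant, different weights give nonisomorphic modules,
and every simple module of the commutant occurs.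

It remains to see that \<open>M\<^bsub>\<lambda>,\<mu>\<^esub>\<close> is the space of all maximal vectors of weight \<open>(\<lambda>; -\<mu>)\<close>. The generators
are maximal vectors of this weight. A maximal vector of this weight that is orthogonal to them has
all its \<open>(k - r)\<close>-fold contractions orthogonal to the standard Young symmetrized words, so these
contractions vanish. If it were nonzero, an intertwiner would send it to a nonzero maximal vector in the
mixed tensor space of order \<open>r\<close>; but by the first fundamental theorem (which for \<open>n \<ge> 2 k\<close> follows by
comparing kernels on words with distinct letters) every such intertwiner factors through
\<open>(k - r)\<close>-fold contractions.\<close>

section \<open>Contravariant forms and maximal vectors\<close>

text \<open>Complete reducibility, characters and dimension counts are all replaced by the Hermitian
  form. Complements are orthogonal complements, and the graph generated by a pair of maximal vectors
  is a function because it rescales the form. That the generators span has to be shown without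
  counting them. Orthogonality turns spanning into a vanishing statement, and vanishing is tested on
  the values of a coefficient function at the row words of standard tableaux. Tensor powers of the
  natural module are therefore treated as functions on words, and dual factors are brought to the
  same shape by reversing the alphabet. The bound on \<open>n\<close> enters twice. First, 2 r \<le>
  n keeps the letters 1..r of the vector factors apart from the letters n - r + 1..n of the dual
  ones, so a weight determines both contents and both partitions. Second, flipping the dual factors
  of an intertwiner from order k to order r gives words of length k + r, and k + r \<le> n provides
  a word with distinct letters at which an invariant kernel can be read off.\<close>

declare plus_fun_apply [simp del] zero_fun_apply [simp del] minus_apply [simp del] uminus_apply [simp del]

text \<open>Vectors are functions to the complex numbers, and elements of the commutant are
  functions on vectors. Pointwise evaluation is switched off in the simplifier so that sums,
  differences and \<open>0\<close> stay operations on whole vectors; \<open>fun_simps\<close> opens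
  them on demand.\<close>

lemmas fun_simps = plus_fun_apply zero_fun_apply minus_apply uminus_apply

lemma sum_fun_apply: "(\<Sum>x\<in>A. f x) z = (\<Sum>x\<in>A. f x z)"
  by (induction A rule: infinite_finite_induct) (auto simp: fun_simps)

section \<open>The Hermitian form and orthogonal projection\<close>

definition ip :: "'z set \<Rightarrow> ('z \<Rightarrow> complex) \<Rightarrow> ('z \<Rightarrow> complex) \<Rightarrow> complex" where
  "ip Z u v = (\<Sum>z\<in>Z. u z * cnj (v z))"

definition fsupp :: "'z set \<Rightarrow> ('z \<Rightarrow> complex) set" where
  "fsupp Z = {u. \<forall>z. z \<notin> Z \<longrightarrow> u z = 0}"

lemma smul_simps [simp]:
  "smul 0 u = 0" "smul 1 u = u" "smul c 0 = 0" "smul c (smul d u) = smul (c * d) u"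
  by (auto simp: fun_simps smul_def fun_eq_iff algebra_simps)

lemma smul_apply: "smul c u z = c * u z"
  by (simp add: smul_def)

lemma smul_add: "smul c (u + v) = smul c u + smul c v"
  by (auto simp: fun_simps smul_def fun_eq_iff algebra_simps)

lemma add_smul: "smul (c + d) u = smul c u + smul d u"
  by (auto simp: fun_simps smul_def fun_eq_iff algebra_simps)

lemma diff_eq_add_smul: "u - v = u + smul (-1) v"
  by (auto simp: fun_simps smul_def fun_eq_iff)

lemma ip_add_left: "ip Z (u + v) w = ip Z u w + ip Z v w"
  by (simp add: fun_simps ip_def algebra_simps sum.distrib)

lemma ip_add_right: "ip Z w (u + v) = ip Z w u + ip Z w v"
  by (simp add: fun_simps ip_def algebra_simps sum.distrib)

lemma ip_diff_left: "ip Z (u - v) w = ip Z u w - ip Z v w"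
  by (simp add: fun_simps ip_def algebra_simps sum_subtractf)

lemma ip_smul_left: "ip Z (smul c u) w = c * ip Z u w"
  by (simp add: ip_def smul_def algebra_simps sum_distrib_left)

lemma ip_smul_right: "ip Z w (smul c u) = cnj c * ip Z w u"
  by (simp add: ip_def smul_def algebra_simps sum_distrib_left)

lemma ip_zero [simp]: "ip Z 0 w = 0" "ip Z w 0 = 0"
  by (simp_all add: fun_simps ip_def)

lemma ip_cnj: "cnj (ip Z u v) = ip Z v u"
  by (simp add: ip_def mult.commute)

lemma ip_self_real: "ip Z u u = complex_of_real (\<Sum>z\<in>Z. (cmod (u z))\<^sup>2)"
  by (simp only: ip_def of_real_sum complex_norm_square)

lemma ip_eq_0_sym: "ip Z u v = 0 \<Longrightarrow> ip Z v u = 0"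
  by (metis ip_cnj complex_cnj_zero)

lemma ip_self_eq_0:
  assumes "finite Z" "u \<in> fsupp Z" "ip Z u u = 0"
  shows "u = 0"
proof -
  have "(\<Sum>z\<in>Z. (cmod (u z))\<^sup>2) = 0"
    using assms(3) unfolding ip_self_real by (simp only: of_real_eq_0_iff)
  then have "\<forall>z\<in>Z. u z = 0"
    using assms(1) by (subst (asm) sum_nonneg_eq_0_iff) auto
  then show ?thesis using assms(2) by (auto simp: fun_simps fsupp_def fun_eq_iff)
qed

lemma is_subspaceD:
  assumes "is_subspace W"
  shows "0 \<in> W" "u \<in> W \<Longrightarrow> v \<in> W \<Longrightarrow> u + v \<in> W" "u \<in> W \<Longrightarrow> smul c u \<in> W"
    "u \<in> W \<Longrightarrow> v \<in> W \<Longrightarrow> u - v \<in> W"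
proof -
  show "0 \<in> W" "u \<in> W \<Longrightarrow> v \<in> W \<Longrightarrow> u + v \<in> W" "u \<in> W \<Longrightarrow> smul c u \<in> W" for u v c
    using assms unfolding is_subspace_def by blast+
  then show "u \<in> W \<Longrightarrow> v \<in> W \<Longrightarrow> u - v \<in> W"
    unfolding diff_eq_add_smul by blast
qed

lemma subspace_sum:
  assumes "is_subspace W" "\<And>x. x \<in> A \<Longrightarrow> f x \<in> W"
  shows "sum f A \<in> W"
  using assms(2)
  by (induction A rule: infinite_finite_induct) (simp_all add: is_subspaceD(1,2)[OF assms(1)])

lemma fsupp_subspace: "is_subspace (fsupp Z)"
  by (auto simp: fun_simps is_subspace_def fsupp_def smul_def)

lemmas fsupp_closed = is_subspaceD[OF fsupp_subspace]

text \<open>Induction on the coordinates in place of dimension theory. If some element of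
  \<open>W\<close> is nonzero at the new coordinate \<open>y\<close>, then \<open>W\<close> is the
  part vanishing at \<open>y\<close> plus one line, and a vector spanning that line is made
  orthogonal to this part as in the Gram-Schmidt process.\<close>

lemma orth_projection:
  assumes "finite Z" "is_subspace W" "W \<subseteq> fsupp Z"
  shows "\<exists>w\<in>W. \<forall>x\<in>W. ip Z (u - w) x = 0"
  using assms
proof (induction Z arbitrary: W u rule: finite_induct)
  case empty
  then show ?case by (auto simp: ip_def is_subspace_def)
next
  case (insert y Z)
  define W0 where "W0 = {w \<in> W. w y = 0}"
  have W0: "is_subspace W0"
    using insert.prems(1) by (auto simp: fun_simps W0_def is_subspace_def smul_def)
  have W0Z: "W0 \<subseteq> fsupp Z"
    using insert.prems(2) by (auto simp: fun_simps W0_def fsupp_def)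
  have ipW0: "ip (insert y Z) v x = ip Z v x" if "x \<in> W0" for v x
    using that insert.hyps by (auto simp: ip_def W0_def)
  have proj0: "\<exists>w\<in>W0. \<forall>x\<in>W0. ip (insert y Z) (v - w) x = 0" for v
    using insert.IH[OF W0 W0Z, of v] ipW0 by auto
  show ?case
  proof (cases "W = W0")
    case True
    then show ?thesis using proj0 by blast
  next
    case False
    then obtain w1 where w1: "w1 \<in> W" "w1 y \<noteq> 0" by (auto simp: fun_simps W0_def)
    obtain q where q: "q \<in> W0" "\<forall>x\<in>W0. ip (insert y Z) (w1 - q) x = 0" using proj0 by blast
    \<comment> \<open>Subtracting the projection \<open>q\<close> of \<open>w1\<close> makes
      \<open>w2\<close> orthogonal to \<open>W0\<close> and keeps the nonzero value at
      \<open>y\<close>.\<close>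
    define w2 where "w2 = w1 - q"
    have qW: "q \<in> W" using q by (simp add: W0_def)
    have w2W: "w2 \<in> W" using w1 qW is_subspaceD[OF insert.prems(1)] by (auto simp: w2_def)
    have w2y: "w2 y \<noteq> 0" using w1 q by (auto simp: fun_simps w2_def W0_def)
    have w2n: "ip (insert y Z) w2 w2 \<noteq> 0"
      using ip_self_eq_0[of "insert y Z" w2] insert.hyps w2W insert.prems(2) w2y
      by (auto simp: zero_fun_apply)
    obtain p where p: "p \<in> W0" "\<forall>x\<in>W0. ip (insert y Z) (u - p) x = 0" using proj0 by blast
    define c where "c = ip (insert y Z) (u - p) w2 / ip (insert y Z) w2 w2"
    have pW: "p \<in> W" using p by (simp add: W0_def)
    have "p + smul c w2 \<in> W" using pW w2W is_subspaceD[OF insert.prems(1)] by auto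
    moreover have "ip (insert y Z) (u - (p + smul c w2)) x = 0" if x: "x \<in> W" for x
    proof -
      \<comment> \<open>With this \<open>d\<close> the vector \<open>x - smul d w2\<close> vanishes
        at \<open>y\<close>, so testing against \<open>W\<close> reduces to testing against
        \<open>W0\<close> and \<open>w2\<close>.\<close>
      define d where "d = x y / w2 y"
      have x0: "x - smul d w2 \<in> W0"
        using is_subspaceD(4)[OF insert.prems(1) x is_subspaceD(3)[OF insert.prems(1) w2W]] w2y
        by (simp add: fun_simps W0_def smul_apply d_def)
      have eq: "x = (x - smul d w2) + smul d w2" by simp
      have 1: "ip (insert y Z) (u - p) x = cnj d * ip (insert y Z) (u - p) w2"
        by (subst eq, simp only: ip_add_right ip_smul_right) (use p x0 in simp)
      have 2: "ip (insert y Z) w2 x = cnj d * ip (insert y Z) w2 w2"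
        by (subst eq, simp only: ip_add_right ip_smul_right) (use q x0 in \<open>simp add: w2_def\<close>)
      have "ip (insert y Z) (u - (p + smul c w2)) x
          = ip (insert y Z) (u - p) x - c * ip (insert y Z) w2 x"
        by (simp add: ip_diff_left ip_add_left ip_smul_left)
      then show ?thesis using 1 2 w2n by (simp add: c_def)
    qed
    ultimately show ?thesis by blast
  qed
qed

section \<open>Modules with a contravariant form, and intertwiners between them\<close>

locale gl_module =
  fixes n :: nat and Z :: "'z set" and E :: "nat \<Rightarrow> nat \<Rightarrow> ('z \<Rightarrow> complex) \<Rightarrow> ('z \<Rightarrow> complex)"
  assumes finZ: "finite Z"
    and E_supp: "\<lbrakk>i \<in> {1..n}; j \<in> {1..n}; u \<in> fsupp Z\<rbrakk> \<Longrightarrow> E i j u \<in> fsupp Z"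
    and E_add: "E i j (u + v) = E i j u + E i j v"
    and E_smul: "E i j (smul c u) = smul c (E i j u)"
    and E_adj: "\<lbrakk>i \<in> {1..n}; j \<in> {1..n}; u \<in> fsupp Z; v \<in> fsupp Z\<rbrakk> \<Longrightarrow>
      ip Z (E i j u) v = ip Z u (E j i v)"
    and E_comm: "\<lbrakk>i \<in> {1..n}; j \<in> {1..n}; k \<in> {1..n}; l \<in> {1..n}; u \<in> fsupp Z\<rbrakk> \<Longrightarrow>
      E i j (E k l u) = E k l (E i j u) + ((if j = k then E i l u else 0) + smul (-1) (if l = i then E k j u else 0))"
begin

lemma E_zero: "E i j 0 = 0"
  using E_smul[of i j 0 0] by simp

lemma E_diff: "E i j (u - v) = E i j u - E i j v"
  by (simp only: diff_eq_add_smul E_add E_smul)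

definition maxvec :: "(nat \<Rightarrow> complex) \<Rightarrow> ('z \<Rightarrow> complex) \<Rightarrow> bool" where
  "maxvec \<chi> u \<longleftrightarrow> u \<in> fsupp Z \<and> (\<forall>i\<in>{1..n}. \<forall>j\<in>{1..n}. i < j \<longrightarrow> E i j u = 0)
     \<and> (\<forall>i\<in>{1..n}. E i i u = smul (\<chi> i) u)"

definition stable :: "('z \<Rightarrow> complex) set \<Rightarrow> bool" where
  "stable W \<longleftrightarrow> is_subspace W \<and> W \<subseteq> fsupp Z \<and> (\<forall>i\<in>{1..n}. \<forall>j\<in>{1..n}. \<forall>u\<in>W. E i j u \<in> W)"

lemma maxvec_subspace: "is_subspace {u. maxvec \<chi> u}"
  by (simp add: is_subspace_def maxvec_def E_add E_smul E_zero smul_add fsupp_closed mult.commute)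

end

text \<open>The subspace of pairs obtained from \<open>(b, a)\<close> by lowering both components at
  once: a candidate for the graph of an intertwiner sending \<open>b\<close> to \<open>a\<close>.
  Taking both modules and both vectors equal gives the cyclic submodule generated by
  \<open>b\<close>.\<close>

inductive hw_graph :: "nat \<Rightarrow> (nat \<Rightarrow> nat \<Rightarrow> ('z \<Rightarrow> complex) \<Rightarrow> ('z \<Rightarrow> complex))
    \<Rightarrow> (nat \<Rightarrow> nat \<Rightarrow> ('y \<Rightarrow> complex) \<Rightarrow> ('y \<Rightarrow> complex))
    \<Rightarrow> ('z \<Rightarrow> complex) \<Rightarrow> ('y \<Rightarrow> complex) \<Rightarrow> ('z \<Rightarrow> complex) \<Rightarrow> ('y \<Rightarrow> complex) \<Rightarrow> bool"
  for n E E' b a where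
  base: "hw_graph n E E' b a b a"
| lower: "hw_graph n E E' b a x y \<Longrightarrow> i \<in> {1..n} \<Longrightarrow> j \<in> {1..n} \<Longrightarrow> j < i \<Longrightarrow>
    hw_graph n E E' b a (E i j x) (E' i j y)"
| add: "hw_graph n E E' b a x y \<Longrightarrow> hw_graph n E E' b a x' y' \<Longrightarrow> hw_graph n E E' b a (x + x') (y + y')"
| scale: "hw_graph n E E' b a x y \<Longrightarrow> hw_graph n E E' b a (smul c x) (smul c y)"

locale hw_pair = A: gl_module n Z E + B: gl_module n Z' E'
  for n :: nat and Z :: "'z set" and E and Z' :: "'y set" and E' +
  fixes b :: "'z \<Rightarrow> complex" and a :: "'y \<Rightarrow> complex" and \<chi> :: "nat \<Rightarrow> complex"
  assumes maxb: "A.maxvec \<chi> b" and maxa: "B.maxvec \<chi> a"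
begin

abbreviation "G \<equiv> hw_graph n E E' b a"

lemma G_in: "G x y \<Longrightarrow> x \<in> fsupp Z \<and> y \<in> fsupp Z'"
  by (induction rule: hw_graph.induct)
    (use maxa maxb in \<open>auto simp: A.maxvec_def B.maxvec_def A.E_supp B.E_supp fsupp_closed\<close>)

lemma G_zero: "G 0 0"
  using hw_graph.scale[OF hw_graph.base, of n E E' b a 0] by simp

text \<open>An operator is commuted past each lowering operator until it reaches
  \<open>(b, a)\<close>, where raising gives zero and the diagonal acts by the common scalar
  \<open>\<chi>\<close>. The commutator terms act on the shorter pair \<open>(x, y)\<close> and are
  covered by the induction hypothesis.\<close>

lemma G_act:
  assumes "G x y" "i \<in> {1..n}" "j \<in> {1..n}"
  shows "G (E i j x) (E' i j y)"
  using assms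
proof (induction arbitrary: i j rule: hw_graph.induct)
  case base
  consider "j < i" | "i = j" | "i < j" by linarith
  then show ?case
  proof cases
    case 1
    then show ?thesis using base by (intro hw_graph.lower hw_graph.base)
  next
    case 2
    then show ?thesis using base maxa maxb
      by (auto simp: A.maxvec_def B.maxvec_def intro!: hw_graph.intros)
  next
    case 3
    then have "E i j b = 0" "E' i j a = 0" using base maxa maxb
      by (auto simp: A.maxvec_def B.maxvec_def)
    then show ?thesis using G_zero by simp
  qed
next
  case (lower x y k l)
  have xy: "x \<in> fsupp Z" "y \<in> fsupp Z'" using G_in lower.hyps by auto
  have "G (if l = i then E k j x else 0) (if l = i then E' k j y else 0)"
    "G (if j = k then E i l x else 0) (if j = k then E' i l y else 0)"
    using lower G_zero by auto
  moreover have "G (E k l (E i j x)) (E' k l (E' i j y))"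
    using lower.IH[OF lower.prems] lower.hyps(2-) by (rule hw_graph.lower)
  ultimately show ?case
    unfolding A.E_comm[OF lower.prems lower.hyps(2,3) xy(1)] B.E_comm[OF lower.prems lower.hyps(2,3) xy(2)]
    by (intro hw_graph.add hw_graph.scale)
next
  case (add x y x' y')
  then show ?case by (auto simp: A.E_add B.E_add intro: hw_graph.add)
next
  case (scale x y c)
  then show ?case by (auto simp: A.E_smul B.E_smul intro: hw_graph.scale)
qed

text \<open>A lowering operator on \<open>x\<close> becomes a raising operator on \<open>b\<close>,
  and likewise for \<open>y\<close> and \<open>a\<close>, so both sides vanish after a lowering
  step.\<close>

lemma G_ip_base: "G x y \<Longrightarrow> ip Z x b * ip Z' a a = ip Z' y a * ip Z b b"
proof (induction rule: hw_graph.induct)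
  case (lower x y i j)
  have "E j i b = 0" "E' j i a = 0" "b \<in> fsupp Z" "a \<in> fsupp Z'"
    using lower maxa maxb by (auto simp: A.maxvec_def B.maxvec_def)
  then show ?case using lower G_in[OF lower.hyps(1)] by (simp add: A.E_adj B.E_adj)
qed (auto simp: ip_add_left ip_smul_left algebra_simps)

lemma ip_self_cnj: "cnj (ip W u u) = ip W u u"
  by (simp add: ip_cnj)

text \<open>Up to the factor \<open>ip Z' a a / ip Z b b\<close> the graph preserves the form. For
  nonzero \<open>b\<close> this makes it a function: a pair \<open>(0, y)\<close> in it has
  \<open>y\<close> of norm zero.\<close>

lemma G_ip: "G x y \<Longrightarrow> G x' y' \<Longrightarrow> ip Z x x' * ip Z' a a = ip Z' y y' * ip Z b b"
proof (induction arbitrary: x' y' rule: hw_graph.induct)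
  case base
  from G_ip_base[OF this] have "cnj (ip Z x' b * ip Z' a a) = cnj (ip Z' y' a * ip Z b b)" by simp
  then show ?case by (simp add: ip_cnj ip_self_cnj)
next
  case (lower x y i j)
  then show ?case
    using G_in[OF lower.hyps(1)] G_in[OF lower.prems] G_act[OF lower.prems, of j i]
    by (simp add: A.E_adj B.E_adj)
qed (auto simp: ip_add_left ip_smul_left algebra_simps)

lemma G_diff: "G x y \<Longrightarrow> G x' y' \<Longrightarrow> G (x - x') (y - y')"
  by (auto simp: diff_eq_add_smul intro!: hw_graph.intros)

lemma G_fun:
  assumes "b \<noteq> 0" "G x y" "G x y'"
  shows "y = y'"
proof -
  have 1: "G 0 (y - y')" using G_diff[OF assms(2,3)] by simp
  have "ip Z b b \<noteq> 0" using assms(1) maxb A.finZ ip_self_eq_0 by (auto simp: A.maxvec_def)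
  then have "ip Z' (y - y') (y - y') = 0" using G_ip[OF 1 1] by simp
  then have "y - y' = 0" using ip_self_eq_0 B.finZ G_in[OF 1] by blast
  then show ?thesis by simp
qed

end

context gl_module
begin

definition cyc :: "('z \<Rightarrow> complex) \<Rightarrow> ('z \<Rightarrow> complex) set" where
  "cyc b = {x. hw_graph n E E b b x x}"

lemma hw_graph_diag: "hw_graph n E E b b x y \<Longrightarrow> x = y"
  by (induction rule: hw_graph.induct) auto

lemma cyc_iff: "x \<in> cyc b \<longleftrightarrow> (\<exists>y. hw_graph n E E b b x y)"
  unfolding cyc_def using hw_graph_diag by blast

lemma cyc_base: "b \<in> cyc b"
  by (simp add: cyc_def hw_graph.base)

lemma cyc_induct [consumes 1, case_names base lower add scale]:
  assumes "x \<in> cyc b" "P b"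
    "\<And>x i j. x \<in> cyc b \<Longrightarrow> P x \<Longrightarrow> i \<in> {1..n} \<Longrightarrow> j \<in> {1..n} \<Longrightarrow> j < i \<Longrightarrow> P (E i j x)"
    "\<And>x y. x \<in> cyc b \<Longrightarrow> P x \<Longrightarrow> y \<in> cyc b \<Longrightarrow> P y \<Longrightarrow> P (x + y)"
    "\<And>x c. x \<in> cyc b \<Longrightarrow> P x \<Longrightarrow> P (smul c x)"
  shows "P x"
proof -
  have "hw_graph n E E b b x y \<Longrightarrow> P x" for x y
  proof (induction rule: hw_graph.induct)
    case base
    show ?case by (rule assms(2))
  next
    case (lower x y i j)
    then have "x \<in> cyc b" using cyc_iff by blast
    then show ?case using lower assms(3) by blast
  next
    case (add x y x' y')
    then have "x \<in> cyc b" "x' \<in> cyc b" using cyc_iff by blast+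
    then show ?case using add assms(4) by blast
  next
    case (scale x y c)
    then have "x \<in> cyc b" using cyc_iff by blast
    then show ?case using scale assms(5) by blast
  qed
  then show ?thesis using assms(1) cyc_iff by blast
qed

lemma cyc_stable:
  assumes "maxvec \<chi> b"
  shows "stable (cyc b)"
proof -
  interpret hw_pair n Z E Z E b b \<chi> by unfold_locales (fact assms)+
  show ?thesis
    unfolding stable_def cyc_def is_subspace_def mem_Collect_eq subset_iff
    using G_in G_zero G_act by (auto intro: hw_graph.add hw_graph.scale)
qed

lemma cyc_subset:
  assumes "stable W" "b \<in> W"
  shows "cyc b \<subseteq> W"
proof
  fix x assume "x \<in> cyc b"
  then show "x \<in> W"
    by (induction rule: cyc_induct) (use assms is_subspaceD in \<open>auto simp: stable_def\<close>)
qed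

lemma cyc_orth_maxvec:
  assumes "maxvec \<chi> b" "maxvec \<psi> b'" "ip Z b b' = 0" "x \<in> cyc b"
  shows "ip Z x b' = 0"
  using assms(4)
proof (induction rule: cyc_induct)
  case (lower x i j)
  have "x \<in> fsupp Z" using lower cyc_stable[OF assms(1)] by (auto simp: stable_def)
  moreover have "E j i b' = 0" "b' \<in> fsupp Z" using assms(2) lower by (auto simp: maxvec_def)
  ultimately show ?case using lower by (simp add: E_adj)
qed (use assms in \<open>auto simp: ip_add_left ip_smul_left\<close>)

text \<open>Lowering operators are moved across the form until one argument is a generator; then
  \<open>cyc_orth_maxvec\<close> applies.\<close>

lemma cyc_orth:
  assumes "maxvec \<chi> b" "maxvec \<psi> b'" "ip Z b b' = 0" "x \<in> cyc b" "x' \<in> cyc b'"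
  shows "ip Z x x' = 0"
  using assms(4,5)
proof (induction arbitrary: x' rule: cyc_induct)
  case base
  then show ?case
    using cyc_orth_maxvec[OF assms(2,1) ip_eq_0_sym[OF assms(3)]] ip_eq_0_sym by blast
next
  case (lower x i j)
  have "x \<in> fsupp Z" using lower cyc_stable[OF assms(1)] by (auto simp: stable_def)
  moreover have "x' \<in> fsupp Z" "E j i x' \<in> cyc b'"
    using lower cyc_stable[OF assms(2)] by (auto simp: stable_def)
  ultimately show ?case using lower by (simp add: E_adj)
qed (auto simp: ip_add_left ip_smul_left)

text \<open>Diagonal operators are self-adjoint, so eigenvectors for different eigenvalues are
  orthogonal. Reality of \<open>\<psi>\<close> keeps conjugation in the second argument from
  changing the eigenvalue.\<close>

lemma maxvec_orth:
  assumes "maxvec \<chi> b" "maxvec \<psi> b'" "i \<in> {1..n}" "\<chi> i \<noteq> \<psi> i" "\<And>i. i \<in> {1..n} \<Longrightarrow> cnj (\<psi> i) = \<psi> i"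
  shows "ip Z b b' = 0"
proof -
  have "ip Z (E i i b) b' = ip Z b (E i i b')"
    using assms by (intro E_adj) (auto simp: maxvec_def)
  then have "\<chi> i * ip Z b b' = \<psi> i * ip Z b b'"
    using assms by (simp add: maxvec_def ip_smul_left ip_smul_right)
  then show ?thesis using assms(4) by simp
qed

end

text \<open>The intertwiner is the orthogonal projection onto \<open>cyc b\<close> followed by the
  map with graph \<open>G\<close>. It commutes with the action because \<open>cyc b\<close> is
  stable under the adjoints of all operators, hence so is its orthogonal complement.\<close>

theorem (in hw_pair) hw_hom_exists:
  assumes "b \<noteq> 0"
  obtains F where
    "\<And>u v. u \<in> fsupp Z \<Longrightarrow> v \<in> fsupp Z \<Longrightarrow> F (u + v) = F u + F v"
    "\<And>c u. u \<in> fsupp Z \<Longrightarrow> F (smul c u) = smul c (F u)"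
    "\<And>i j u. i \<in> {1..n} \<Longrightarrow> j \<in> {1..n} \<Longrightarrow> u \<in> fsupp Z \<Longrightarrow> F (E i j u) = E' i j (F u)"
    "F b = a"
    "\<And>u. u \<in> fsupp Z \<Longrightarrow> (\<And>x. x \<in> A.cyc b \<Longrightarrow> ip Z u x = 0) \<Longrightarrow> F u = 0"
    "\<And>u. u \<in> fsupp Z \<Longrightarrow> F u \<in> B.cyc a"
proof -
  let ?R = "\<lambda>v y. \<exists>x. G x y \<and> (\<forall>x'\<in>A.cyc b. ip Z (v - x) x' = 0)"
  have dom: "\<exists>y. G x y" if "x \<in> A.cyc b" for x
    using that by (induction rule: A.cyc_induct) (blast intro: hw_graph.intros)+
  have cyc: "x \<in> A.cyc b \<and> y \<in> B.cyc a" if "G x y" for x y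
    using that by (induction rule: hw_graph.induct)
      (auto simp: A.cyc_def B.cyc_def intro: hw_graph.intros)
  note st = A.cyc_stable[OF maxb]
  have ex: "\<exists>y. ?R v y" if "v \<in> fsupp Z" for v
    using orth_projection[of Z "A.cyc b" v] st A.finZ dom unfolding A.stable_def by blast
  have uniq: "y = y'" if R: "?R v y" "?R v y'" for v y y'
  proof -
    obtain x x' where x: "G x y" "\<forall>z\<in>A.cyc b. ip Z (v - x) z = 0"
      "G x' y'" "\<forall>z\<in>A.cyc b. ip Z (v - x') z = 0" using R by blast
    have G: "G (x - x') (y - y')" using G_diff x by blast
    have in': "x - x' \<in> A.cyc b" using cyc G by blast
    have "x - x' = (v - x') - (v - x)" by simp
    then have "ip Z (x - x') (x - x') = ip Z (v - x') (x - x') - ip Z (v - x) (x - x')"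
      by (simp only: ip_diff_left)
    then have "ip Z (x - x') (x - x') = 0" using x(2,4) in' by auto
    then have "x - x' = 0" using ip_self_eq_0 A.finZ G_in[OF G] by blast
    then show ?thesis using G_fun[OF assms] x by simp
  qed
  define F where "F v = (THE y. ?R v y)" for v
  have F: "?R v (F v)" if "v \<in> fsupp Z" for v
    unfolding F_def using ex[OF that] uniq by (intro theI'[of "?R v"]) blast
  have FI: "F v = y" if "v \<in> fsupp Z" "?R v y" for v y
    using F uniq that by blast
  show ?thesis
  proof
    fix u v assume uv: "u \<in> fsupp Z" "v \<in> fsupp Z"
    obtain x x' where x: "G x (F u)" "\<forall>z\<in>A.cyc b. ip Z (u - x) z = 0"
      "G x' (F v)" "\<forall>z\<in>A.cyc b. ip Z (v - x') z = 0" using F uv by meson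
    have e: "(u + v) - (x + x') = (u - x) + (v - x')" by simp
    have "\<forall>z\<in>A.cyc b. ip Z ((u + v) - (x + x')) z = 0"
      unfolding e using x by (simp add: ip_add_left)
    then show "F (u + v) = F u + F v"
      using x uv by (intro FI) (auto intro: fsupp_closed hw_graph.add)
  next
    fix c u assume u: "u \<in> fsupp Z"
    obtain x where x: "G x (F u)" "\<forall>z\<in>A.cyc b. ip Z (u - x) z = 0" using F u by meson
    have e: "smul c u - smul c x = smul c (u - x)" by (auto simp: fun_eq_iff fun_simps smul_apply algebra_simps)
    have "\<forall>z\<in>A.cyc b. ip Z (smul c u - smul c x) z = 0"
      unfolding e using x by (simp add: ip_smul_left)
    then show "F (smul c u) = smul c (F u)"
      using x u by (intro FI) (auto intro: fsupp_closed hw_graph.scale)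
  next
    fix i j u assume u: "u \<in> fsupp Z" and ij: "i \<in> {1..n}" "j \<in> {1..n}"
    obtain x where x: "G x (F u)" "\<forall>z\<in>A.cyc b. ip Z (u - x) z = 0" using F u by meson
    have xf: "x \<in> fsupp Z" using x G_in by blast
    have "ip Z (E i j u - E i j x) z = 0" if z: "z \<in> A.cyc b" for z
    proof -
      have "z \<in> fsupp Z" "E j i z \<in> A.cyc b" using st z ij by (auto simp: A.stable_def)
      then show ?thesis using x ij u xf
        by (simp add: A.E_adj fsupp_closed flip: A.E_diff)
    qed
    moreover have "G (E i j x) (E' i j (F u))" using x(1) ij by (rule G_act)
    ultimately show "F (E i j u) = E' i j (F u)"
      using u ij by (intro FI) (auto intro: A.E_supp)
  next
    show "F b = a" using maxb by (intro FI) (auto simp: A.maxvec_def intro!: exI[of _ b] hw_graph.base)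
  next
    fix u assume "u \<in> fsupp Z" "\<And>x. x \<in> A.cyc b \<Longrightarrow> ip Z u x = 0"
    then show "F u = 0" by (intro FI) (auto intro!: exI[of _ 0] G_zero)
  next
    fix u assume "u \<in> fsupp Z"
    then show "F u \<in> B.cyc a" using F cyc by meson
  qed
qed

text \<open>The squared norm of the lowered vector \<open>E (Suc i) i u\<close> is
  \<open>\<omega> i - \<omega> (Suc i)\<close> times the squared norm of \<open>u\<close>, so this
  difference cannot be negative.\<close>

lemma (in gl_module) maxvec_dominant:
  assumes "maxvec (\<lambda>i. of_int (\<omega> i)) u" "u \<noteq> 0" "1 \<le> i" "i < n"
  shows "\<omega> (Suc i) \<le> \<omega> i"
proof -
  have ii: "i \<in> {1..n}" "Suc i \<in> {1..n}" using assms by auto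
  have u: "u \<in> fsupp Z" "E i (Suc i) u = 0" "E i i u = smul (of_int (\<omega> i)) u"
    "E (Suc i) (Suc i) u = smul (of_int (\<omega> (Suc i))) u"
    using assms(1) ii by (auto simp: maxvec_def)
  define v where "v = E (Suc i) i u"
  have v: "v \<in> fsupp Z" using ii u by (simp add: v_def E_supp)
  have "E i (Suc i) v = E i i u + smul (-1) (E (Suc i) (Suc i) u)"
    unfolding v_def using ii u by (subst E_comm) (auto simp: E_zero)
  also have "\<dots> = smul (of_int (\<omega> i - \<omega> (Suc i))) u"
    by (simp add: u smul_def fun_eq_iff fun_simps algebra_simps)
  finally have "ip Z v v = of_int (\<omega> i - \<omega> (Suc i)) * ip Z u u"
    using E_adj[OF ii(2,1) u(1) v] by (simp add: v_def ip_smul_right)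
  then have eq: "(\<Sum>z\<in>Z. (cmod (v z))\<^sup>2) = real_of_int (\<omega> i - \<omega> (Suc i)) * (\<Sum>z\<in>Z. (cmod (u z))\<^sup>2)"
    unfolding ip_self_real by (metis (mono_tags, lifting) of_real_eq_iff of_real_mult of_real_of_int_eq)
  have "(\<Sum>z\<in>Z. (cmod (u z))\<^sup>2) \<noteq> 0"
  proof
    assume "(\<Sum>z\<in>Z. (cmod (u z))\<^sup>2) = 0"
    then have "ip Z u u = 0" by (simp only: ip_self_real of_real_0)
    then show False using assms(2) u(1) finZ ip_self_eq_0 by blast
  qed
  then have pos: "(\<Sum>z\<in>Z. (cmod (u z))\<^sup>2) > 0"
    by (simp add: order_less_le sum_nonneg)
  have "0 \<le> real_of_int (\<omega> i - \<omega> (Suc i)) * (\<Sum>z\<in>Z. (cmod (u z))\<^sup>2)"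
    by (subst eq[symmetric]) (simp add: sum_nonneg)
  then have "0 \<le> real_of_int (\<omega> i - \<omega> (Suc i))"
    using pos by (simp add: zero_le_mult_iff)
  then show ?thesis by simp
qed

section \<open>Mixed tensor spaces with arbitrary sets of places\<close>

definition tidx :: "nat \<Rightarrow> nat set \<Rightarrow> nat set \<Rightarrow> idx set" where
  "tidx n P Q = PiE P (\<lambda>_. {1..n}) \<times> PiE Q (\<lambda>_. {1..n})"

text \<open>A matrix unit acting at a single tensor place, written on coefficient functions: the
  coefficient at the new letter is read off at the old one. On a dual place \<open>i\<close> and
  \<open>j\<close> change roles and a sign appears. Splitting the action into places reduces
  identities for \<open>lact\<close> to one place or two.\<close>

fun site :: "nat + nat \<Rightarrow> nat \<Rightarrow> nat \<Rightarrow> tens \<Rightarrow> tens" where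
  "site (Inl p) i j u = (\<lambda>(a, b). if a p = i then u (a(p := j), b) else 0)"
| "site (Inr q) i j u = (\<lambda>(a, b). if b q = j then - u (a, b(q := i)) else 0)"

definition lact :: "nat set \<Rightarrow> nat set \<Rightarrow> nat \<Rightarrow> nat \<Rightarrow> tens \<Rightarrow> tens" where
  "lact P Q i j u = (\<Sum>s\<in>P <+> Q. site s i j u)"

lemma lact_apply:
  assumes "finite P" "finite Q"
  shows "lact P Q i j u (a, b) = (\<Sum>p\<in>P. if a p = i then u (a(p := j), b) else 0)
     - (\<Sum>q\<in>Q. if b q = j then u (a, b(q := i)) else 0)"
proof -
  have "(\<Sum>q\<in>Q. site (Inr q) i j u (a, b)) = - (\<Sum>q\<in>Q. if b q = j then u (a, b(q := i)) else 0)"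
    unfolding sum_negf[symmetric] by (intro sum.cong) auto
  then show ?thesis using assms by (simp add: lact_def sum.Plus comp_def fun_simps sum_fun_apply)
qed

lemma site_add: "site s i j (u + v) = site s i j u + site s i j v"
  by (cases s) (auto simp: fun_eq_iff fun_simps)

lemma site_smul: "site s i j (smul c u) = smul c (site s i j u)"
  by (cases s) (auto simp: fun_eq_iff smul_def)

lemma site_zero: "site s i j 0 = 0"
  by (cases s) (auto simp: fun_eq_iff fun_simps)

lemma site_sum: "site s i j (sum f A) = (\<Sum>x\<in>A. site s i j (f x))"
  by (induction A rule: infinite_finite_induct) (auto simp: site_zero site_add)

lemma site_commute: "s \<noteq> t \<Longrightarrow> site s i j (site t k l u) = site t k l (site s i j u)"
  by (cases s; cases t) (auto simp: fun_eq_iff fun_upd_twist)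

text \<open>At one place this is the commutator relation of matrix units. Operators at different
  places commute, so the local relations add up to the relation for \<open>lact\<close>.\<close>

lemma site_comm:
  "site s i j (site s k l u) = site s k l (site s i j u)
     + ((if j = k then site s i l u else 0) + smul (-1) (if l = i then site s k j u else 0))"
proof (rule ext, clarify)
  fix a b
  show "site s i j (site s k l u) (a, b) = (site s k l (site s i j u)
     + ((if j = k then site s i l u else 0) + smul (-1) (if l = i then site s k j u else 0))) (a, b)"
    by (cases s; cases "j = k"; cases "l = i") (simp_all add: fun_simps smul_apply)
qed

lemma site_supp:
  assumes "s \<in> P <+> Q" "i \<in> {1..n}" "j \<in> {1..n}" "u \<in> fsupp (tidx n P Q)"
  shows "site s i j u \<in> fsupp (tidx n P Q)"
proof -
  have upd: "a \<in> PiE A (\<lambda>_. {1..n})" if "a(p := x) \<in> PiE A (\<lambda>_. {1..n})" "a p \<in> {1..n}" "p \<in> A"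
    for a :: "nat \<Rightarrow> nat" and A p x
    using that by (auto simp: PiE_iff extensional_def split: if_splits)
  have u: "u z = 0" if "z \<notin> tidx n P Q" for z using assms(4) that unfolding fsupp_def by blast
  have "site s i j u (a, b) = 0" if "(a, b) \<notin> tidx n P Q" for a b
  proof (cases s)
    case (Inl p)
    have "a p = i \<Longrightarrow> (a(p := j), b) \<notin> tidx n P Q"
      using that upd[of a p j P] assms(1,2) Inl by (auto simp: tidx_def)
    then show ?thesis using Inl u by simp
  next
    case (Inr p)
    have "b p = j \<Longrightarrow> (a, b(p := i)) \<notin> tidx n P Q"
      using that upd[of b p i Q] assms(1,3) Inr by (auto simp: tidx_def)
    then show ?thesis using Inr u by simp
  qed
  then show ?thesis by (auto simp: fsupp_def)
qed

lemma finite_tidx: "finite P \<Longrightarrow> finite Q \<Longrightarrow> finite (tidx n P Q)"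
  by (auto simp: tidx_def intro!: finite_PiE)

text \<open>Replacing the letter at one place is a bijection between the index pairs carrying the
  two letters there; the inverse replacement gives the adjoint.\<close>

lemma site_adj:
  assumes "s \<in> P <+> Q" "i \<in> {1..n}" "j \<in> {1..n}" "finite P" "finite Q"
  shows "ip (tidx n P Q) (site s i j u) v = ip (tidx n P Q) u (site s j i v)"
proof -
  let ?Z = "tidx n P Q"
  have fin: "finite ?Z" using assms by (simp add: finite_tidx)
  have upd: "a(p := x) \<in> PiE A (\<lambda>_. {1..n})" if "a \<in> PiE A (\<lambda>_. {1..n})" "x \<in> {1..n}" "p \<in> A"
    for a :: "nat \<Rightarrow> nat" and A p x
    using that by (auto simp: PiE_iff extensional_def)
  show ?thesis
  proof (cases s)
    case (Inl p)
    have "ip ?Z (site s i j u) v = (\<Sum>z\<in>{z\<in>?Z. fst z p = i}. u ((fst z)(p := j), snd z) * cnj (v z))"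
      unfolding ip_def Inl by (rule sum.mono_neutral_cong_right[OF fin]) (auto split: prod.splits)
    also have "\<dots> = (\<Sum>z\<in>{z\<in>?Z. fst z p = j}. u z * cnj (v ((fst z)(p := i), snd z)))"
      by (rule sum.reindex_bij_witness[where i = "\<lambda>z. ((fst z)(p := i), snd z)" and j = "\<lambda>z. ((fst z)(p := j), snd z)"])
        (use assms Inl in \<open>auto simp: tidx_def intro!: upd\<close>)
    also have "\<dots> = ip ?Z u (site s j i v)"
      unfolding ip_def Inl by (rule sum.mono_neutral_cong_left[OF fin]) (auto split: prod.splits)
    finally show ?thesis .
  next
    case (Inr p)
    have "ip ?Z (site s i j u) v = (\<Sum>z\<in>{z\<in>?Z. snd z p = j}. - u (fst z, (snd z)(p := i)) * cnj (v z))"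
      unfolding ip_def Inr by (rule sum.mono_neutral_cong_right[OF fin]) (auto split: prod.splits)
    also have "\<dots> = (\<Sum>z\<in>{z\<in>?Z. snd z p = i}. u z * cnj (- v (fst z, (snd z)(p := j))))"
      by (rule sum.reindex_bij_witness[where i = "\<lambda>z. (fst z, (snd z)(p := j))" and j = "\<lambda>z. (fst z, (snd z)(p := i))"])
        (use assms Inr in \<open>auto simp: tidx_def intro!: upd\<close>)
    also have "\<dots> = ip ?Z u (site s j i v)"
      unfolding ip_def Inr by (rule sum.mono_neutral_cong_left[OF fin]) (auto split: prod.splits)
    finally show ?thesis .
  qed
qed

lemma tensor_gl_module:
  assumes "finite P" "finite Q"
  shows "gl_module n (tidx n P Q) (lact P Q)"
proof
  let ?S = "P <+> Q"
  have fS: "finite ?S" using assms by simp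
  show "finite (tidx n P Q)" using assms by (rule finite_tidx)
  show "lact P Q i j u \<in> fsupp (tidx n P Q)"
    if "i \<in> {1..n}" "j \<in> {1..n}" "u \<in> fsupp (tidx n P Q)" for i j u
    unfolding lact_def by (intro subspace_sum[OF fsupp_subspace] site_supp that)
  show "lact P Q i j (u + v) = lact P Q i j u + lact P Q i j v" for i j u v
    by (simp add: lact_def site_add sum.distrib)
  show "lact P Q i j (smul c u) = smul c (lact P Q i j u)" for i j c u
    by (simp add: lact_def site_smul smul_apply fun_eq_iff sum_fun_apply sum_distrib_left)
  show "ip (tidx n P Q) (lact P Q i j u) v = ip (tidx n P Q) u (lact P Q j i v)"
    if ij: "i \<in> {1..n}" "j \<in> {1..n}" for i j u v
  proof -
    have sl: "ip Z (sum f ?S) w = (\<Sum>s\<in>?S. ip Z (f s) w)" for Z w and f :: "nat + nat \<Rightarrow> tens"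
      by (rule sum_comp_morphism[symmetric, unfolded comp_def, of "\<lambda>x. ip Z x w"]) (auto simp: ip_add_left)
    have sr: "ip Z w (sum f ?S) = (\<Sum>s\<in>?S. ip Z w (f s))" for Z w and f :: "nat + nat \<Rightarrow> tens"
      by (rule sum_comp_morphism[symmetric, unfolded comp_def, of "\<lambda>x. ip Z w x"]) (auto simp: ip_add_right)
    show ?thesis
      unfolding lact_def sl sr by (rule sum.cong[OF refl]) (use site_adj assms ij in auto)
  qed
  show "lact P Q i j (lact P Q k l u) = lact P Q k l (lact P Q i j u)
      + ((if j = k then lact P Q i l u else 0) + smul (-1) (if l = i then lact P Q k j u else 0))"
    for i j k l u
  proof -
    \<comment> \<open>In the double sum over places only the diagonal terms fail to commute;
      \<open>C s\<close> is the commutator at place \<open>s\<close>.\<close>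
    define C where "C s = (if j = k then site s i l u else 0) + smul (-1) (if l = i then site s k j u else 0)" for s
    have lsum: "(\<Sum>s\<in>?S. C s) = (if j = k then lact P Q i l u else 0) + smul (-1) (if l = i then lact P Q k j u else 0)"
    proof -
      have "(\<Sum>s\<in>?S. smul (-1) (f s)) = smul (-1) (sum f ?S)" for f :: "nat + nat \<Rightarrow> tens"
        by (simp add: fun_eq_iff sum_fun_apply smul_apply sum_negf)
      then show ?thesis by (simp add: C_def sum.distrib lact_def)
    qed
    have "lact P Q i j (lact P Q k l u) = (\<Sum>s\<in>?S. \<Sum>t\<in>?S. site s i j (site t k l u))"
      by (simp add: lact_def site_sum)
    also have "\<dots> = (\<Sum>s\<in>?S. \<Sum>t\<in>?S. site t k l (site s i j u) + (if t = s then C s else 0))"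
      by (intro sum.cong refl) (simp add: site_comm[of _ i j k l] site_commute C_def)
    also have "\<dots> = (\<Sum>s\<in>?S. (\<Sum>t\<in>?S. site t k l (site s i j u)) + C s)"
      by (intro sum.cong refl, subst sum.distrib, subst sum.delta[OF fS]) simp
    also have "\<dots> = (\<Sum>t\<in>?S. \<Sum>s\<in>?S. site t k l (site s i j u)) + (\<Sum>s\<in>?S. C s)"
      by (subst sum.distrib, subst sum.swap) (rule refl)
    also have "(\<Sum>t\<in>?S. \<Sum>s\<in>?S. site t k l (site s i j u)) = lact P Q k l (lact P Q i j u)"
      by (simp add: lact_def site_sum)
    also note lsum
    finally show ?thesis .
  qed
qed

section \<open>Weights and the existence of maximal vectors\<close>

definition wt :: "nat set \<Rightarrow> nat set \<Rightarrow> idx \<Rightarrow> nat \<Rightarrow> int" where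
  "wt P Q z i = int (card {p\<in>P. fst z p = i}) - int (card {q\<in>Q. snd z q = i})"

lemma lact_diag:
  assumes "finite P" "finite Q"
  shows "lact P Q i i u z = of_int (wt P Q z i) * u z"
proof -
  have *: "(\<Sum>p\<in>A. if f p = i then u (F p) else 0) = of_nat (card {p\<in>A. f p = i}) * c"
    if "finite A" "\<And>p. f p = i \<Longrightarrow> u (F p) = c" for A :: "nat set" and f :: "nat \<Rightarrow> nat" and F c
    using that by (simp add: sum.inter_filter[symmetric])
  obtain a b where z: "z = (a, b)" by (cases z)
  have 1: "(\<Sum>p\<in>P. if a p = i then u (a(p := i), b) else 0) = of_nat (card {p\<in>P. a p = i}) * u (a, b)"
    by (rule *[OF assms(1)]) auto
  have 2: "(\<Sum>p\<in>Q. if b p = i then u (a, b(p := i)) else 0) = of_nat (card {p\<in>Q. b p = i}) * u (a, b)"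
    by (rule *[OF assms(2)]) auto
  show ?thesis unfolding z lact_apply[OF assms] 1 2 by (simp add: wt_def algebra_simps)
qed

locale tensor_module =
  fixes n :: nat and P Q :: "nat set"
  assumes finP: "finite P" and finQ: "finite Q"

sublocale tensor_module \<subseteq> gl_module n "tidx n P Q" "lact P Q"
  using finP finQ by (rule tensor_gl_module)

context tensor_module
begin

text \<open>Basis tensors diagonalise all operators \<open>lact P Q i i\<close>, so being a weight
  vector is a condition on the support alone.\<close>

lemma weight_vector_iff:
  "(\<forall>i\<in>{1..n}. lact P Q i i u = smul (\<chi> i) u) \<longleftrightarrow>
   (\<forall>z. u z \<noteq> 0 \<longrightarrow> (\<forall>i\<in>{1..n}. of_int (wt P Q z i) = \<chi> i))"
proof -
  have "lact P Q i i u = smul (\<chi> i) u \<longleftrightarrow> (\<forall>z. u z \<noteq> 0 \<longrightarrow> of_int (wt P Q z i) = \<chi> i)" for i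
    by (simp only: fun_eq_iff lact_diag[OF finP finQ] smul_apply mult_cancel_right) metis
  then show ?thesis by metis
qed

lemma maxvec_wt: "maxvec \<chi> u \<Longrightarrow> u z \<noteq> 0 \<Longrightarrow> i \<in> {1..n} \<Longrightarrow> \<chi> i = of_int (wt P Q z i)"
  using weight_vector_iff[of u \<chi>] unfolding maxvec_def by metis

text \<open>A nonzero vector of \<open>W\<close> with smallest support works. If two indices of its
  support had different weights, a diagonal operator minus its eigenvalue at one of them would
  produce a nonzero vector of \<open>W\<close> with smaller support.\<close>

lemma exists_weight_vector:
  assumes "stable W" "W \<noteq> {0}"
  shows "\<exists>u\<in>W. u \<noteq> 0 \<and> (\<forall>z z'. u z \<noteq> 0 \<longrightarrow> u z' \<noteq> 0 \<longrightarrow> (\<forall>i\<in>{1..n}. wt P Q z i = wt P Q z' i))"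
proof -
  have sub: "is_subspace W" using assms by (simp add: stable_def)
  have "\<exists>u\<in>W. u \<noteq> 0" using assms is_subspaceD(1)[OF sub] by blast
  then obtain u where u: "u \<in> W" "u \<noteq> 0"
    and min: "\<And>v. v \<in> W \<Longrightarrow> v \<noteq> 0 \<Longrightarrow> card {z. u z \<noteq> 0} \<le> card {z. v z \<noteq> 0}"
    using arg_min_nat_lemma[of "\<lambda>u. u \<in> W \<and> u \<noteq> 0" _ "\<lambda>u. card {z. u z \<noteq> 0}"] by blast
  have fin: "finite {z. u z \<noteq> 0}"
    by (rule finite_subset[OF _ finite_tidx[OF finP finQ]])
      (use assms u in \<open>auto simp: stable_def fsupp_def\<close>)
  have same: "wt P Q z i = wt P Q z' i" if z: "u z \<noteq> 0" "u z' \<noteq> 0" "i \<in> {1..n}" for z z' i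
  proof (rule ccontr)
    assume ne: "wt P Q z i \<noteq> wt P Q z' i"
    define v where "v = lact P Q i i u - smul (of_int (wt P Q z i)) u"
    have v_eq: "v y = of_int (wt P Q y i - wt P Q z i) * u y" for y
      by (simp add: v_def fun_simps smul_def lact_diag[OF finP finQ] algebra_simps)
    have "v \<in> W" unfolding v_def
      using u z assms is_subspaceD[OF sub] by (auto simp: stable_def)
    moreover have "v z' \<noteq> 0" using ne z by (simp add: v_eq)
    ultimately have le: "card {z. u z \<noteq> 0} \<le> card {z. v z \<noteq> 0}"
      using min[of v] by (metis zero_fun_apply)
    have "{y. v y \<noteq> 0} \<subset> {y. u y \<noteq> 0}"
    proof (rule psubsetI)
      show "{y. v y \<noteq> 0} \<subseteq> {y. u y \<noteq> 0}" by (rule subsetI) (simp add: v_eq)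
      have "z \<in> {y. u y \<noteq> 0}" "z \<notin> {y. v y \<noteq> 0}" using z by (simp_all add: v_eq)
      then show "{y. v y \<noteq> 0} \<noteq> {y. u y \<noteq> 0}" by metis
    qed
    then show False using psubset_card_mono[OF fin] le by (metis not_le)
  qed
  show ?thesis
    by (rule bexI[OF _ u(1)]) (intro conjI u(2) allI impI ballI, erule (2) same)
qed

text \<open>Among the weight vectors of \<open>W\<close> one is taken whose weight maximises the
  linear function \<open>h\<close>. A raising operator with \<open>i < j\<close> increases
  \<open>h\<close> by \<open>j - i\<close>, so it has to kill this vector.\<close>

lemma exists_maxvec:
  assumes "stable W" "W \<noteq> {0}"
  shows "\<exists>u \<omega>. u \<in> W \<and> u \<noteq> 0 \<and> maxvec (\<lambda>i. of_int (\<omega> i)) u"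
proof -
  let ?Z = "tidx n P Q"
  define h where "h z = (\<Sum>i\<in>{1..n}. (int n - int i) * wt P Q z i)" for z
  define wv where "wv u \<longleftrightarrow> u \<in> W \<and> u \<noteq> 0 \<and>
    (\<forall>z z'. u z \<noteq> 0 \<longrightarrow> u z' \<noteq> 0 \<longrightarrow> (\<forall>i\<in>{1..n}. wt P Q z i = wt P Q z' i))" for u
  let ?H = "{z \<in> ?Z. \<exists>u. wv u \<and> u z \<noteq> 0}"
  have WZ: "u \<in> fsupp ?Z" if "u \<in> W" for u using that assms by (auto simp: stable_def)
  have finH: "finite ?H" using finite_tidx[OF finP finQ] by simp
  have inH: "z \<in> ?H" if "wv u" "u z \<noteq> 0" for u z
    using that WZ unfolding wv_def fsupp_def by blast
  obtain u0 where "wv u0" using exists_weight_vector[OF assms] by (auto simp: wv_def)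
  then obtain z0 where "u0 z0 \<noteq> 0" by (auto simp: wv_def fun_eq_iff fun_simps)
  then have ne: "?H \<noteq> {}" using \<open>wv u0\<close> inH by blast
  have "Max (h ` ?H) \<in> h ` ?H" by (rule Max_in) (use finH ne in simp_all)
  then obtain z where z: "z \<in> ?H" and hz: "Max (h ` ?H) = h z" by (rule imageE)
  have zmax: "h y \<le> h z" if "y \<in> ?H" for y
    unfolding hz[symmetric] by (rule Max_ge) (use finH that in simp_all)
  have "\<exists>u. wv u \<and> u z \<noteq> 0" using z by simp
  then obtain u where u: "wv u" "u z \<noteq> 0" by (elim exE conjE)
  define \<omega> where "\<omega> = wt P Q z"
  have ww: "lact P Q i i u = smul (of_int (\<omega> i)) u" if "i \<in> {1..n}" for i
  proof -
    have "\<forall>z'. u z' \<noteq> 0 \<longrightarrow> (\<forall>i\<in>{1..n}. of_int (wt P Q z' i) = (of_int (\<omega> i) :: complex))"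
      using u unfolding wv_def \<omega>_def by metis
    then show ?thesis using weight_vector_iff[of u "\<lambda>i. of_int (\<omega> i)"] that by blast
  qed
  have uW: "u \<in> W" and uZ: "u \<in> fsupp ?Z" using u WZ by (auto simp: wv_def)
  have "lact P Q i j u = 0" if ij: "i \<in> {1..n}" "j \<in> {1..n}" "i < j" for i j
  proof (rule ccontr)
    assume nz: "lact P Q i j u \<noteq> 0"
    define v where "v = lact P Q i j u"
    have "lact P Q k k v = smul (of_int (\<omega> k + (if k = i then 1 else 0) - (if k = j then 1 else 0))) v"
      if k: "k \<in> {1..n}" for k
    proof -
      have "lact P Q k k v = smul (of_int (\<omega> k)) v + ((if k = i then v else 0) + smul (-1) (if j = k then v else 0))"
        unfolding v_def E_comm[OF k k ij(1,2) uZ] ww[OF k] E_smul by simp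
      then show ?thesis by (auto simp: fun_eq_iff fun_simps smul_def algebra_simps)
    qed
    then have wv: "wt P Q y k = \<omega> k + (if k = i then 1 else 0) - (if k = j then 1 else 0)"
      if "v y \<noteq> 0" "k \<in> {1..n}" for y k
      using weight_vector_iff[of v "\<lambda>k. of_int (\<omega> k + (if k = i then 1 else 0) - (if k = j then 1 else 0))"]
        that of_int_eq_iff by blast
    have "v \<in> W" using assms(1) uW ij by (auto simp: v_def stable_def)
    then have wvv: "wv v" using nz wv unfolding wv_def v_def[symmetric] by metis
    obtain y where y: "v y \<noteq> 0" using nz by (auto simp: v_def fun_eq_iff fun_simps)
    have "h y = (\<Sum>k\<in>{1..n}. (int n - int k) * \<omega> k + ((if k = i then int n - int k else 0) - (if k = j then int n - int k else 0)))"
      unfolding h_def by (rule sum.cong) (auto simp: wv[OF y] algebra_simps)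
    also have "\<dots> = h z + ((int n - int i) - (int n - int j))"
      using ij by (simp add: sum.distrib sum_subtractf h_def \<omega>_def sum.delta)
    finally have "h y > h z" using ij by simp
    then show False using zmax[OF inH[OF wvv y]] by simp
  qed
  then have "maxvec (\<lambda>i. of_int (\<omega> i)) u" using ww uZ by (auto simp: maxvec_def)
  then show ?thesis using uW u by (auto simp: wv_def)
qed

end

section \<open>Contractions\<close>

lemma contr_add: "contr n k i j (u + v) = contr n k i j u + contr n k i j v"
  by (auto simp: contr_def fun_eq_iff fun_simps sum.distrib)

lemma contr_smul: "contr n k i j (smul c u) = smul c (contr n k i j u)"
  by (auto simp: contr_def fun_eq_iff smul_def sum_distrib_left)

lemma contr_zero: "contr n k i j 0 = 0"
  using contr_smul[of n k i j 0 0] by simp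

lemma contr_diff: "contr n k i j (u - v) = contr n k i j u - contr n k i j v"
  by (simp only: diff_eq_add_smul contr_add contr_smul)

lemma contr_sum: "contr n k i j (sum f A) = (\<Sum>x\<in>A. contr n k i j (f x))"
  by (induction A rule: infinite_finite_induct) (auto simp: contr_zero contr_add)

lemma tidx_Idx: "tidx n {1..k} {1..k} = Idx n k"
  by (simp add: tidx_def Idx_def)

lemma Mset_fsupp: "Mset n k = fsupp (Idx n k)"
  by (simp add: Mset_def fsupp_def)

lemma contr_in: "contr n k i j u \<in> Mset n k"
  by (auto simp: contr_def Mset_def)

lemma PiE_upd:
  "a \<in> PiE A (\<lambda>_. B) \<Longrightarrow> p \<in> A \<Longrightarrow> x \<in> B \<Longrightarrow> a(p := x) \<in> PiE A (\<lambda>_. B)"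
  by (auto simp: PiE_iff extensional_def)

lemma PiE_upd_iff:
  "p \<in> A \<Longrightarrow> x \<in> B \<Longrightarrow> a p \<in> B \<Longrightarrow> a(p := x) \<in> PiE A (\<lambda>_. B) \<longleftrightarrow> a \<in> PiE A (\<lambda>_. B)"
  by (auto simp: PiE_iff extensional_def)

lemma contr_commute:
  assumes "i \<in> {1..k}" "j \<in> {1..k}"
  shows "contr n k i i (contr n k j j u) = contr n k j j (contr n k i i u)"
proof (cases "i = j")
  case False
  show ?thesis
  proof (rule ext, clarify)
    fix a b
    show "contr n k i i (contr n k j j u) (a, b) = contr n k j j (contr n k i i u) (a, b)"
    proof (cases "(a, b) \<in> Idx n k \<and> a i = b i \<and> a j = b j")
      case True
      have in1: "(a(l := m), b(l := m)) \<in> Idx n k" if "l \<in> {1..k}" "m \<in> {1..n}" for l m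
        using True that by (auto simp: Idx_def intro!: PiE_upd)
      have "contr n k i i (contr n k j j u) (a, b)
          = (\<Sum>m\<in>{1..n}. \<Sum>m'\<in>{1..n}. u (a(i := m, j := m'), b(i := m, j := m')))"
        using True False in1[OF assms(1)] by (simp add: contr_def)
      also have "\<dots> = (\<Sum>m'\<in>{1..n}. \<Sum>m\<in>{1..n}. u (a(j := m', i := m), b(j := m', i := m)))"
        using False by (subst sum.swap) (simp add: fun_upd_twist)
      also have "\<dots> = contr n k j j (contr n k i i u) (a, b)"
        using True False in1[OF assms(2)] by (simp add: contr_def)
      finally show ?thesis .
    next
      case F: False
      then show ?thesis using False by (auto simp: contr_def)
    qed
  qed
qed simp

text \<open>Contracting the inserted canonical tensor gives the trace of the identity; this is what
  the factor \<open>1 / n\<close> in \<open>proj\<close> normalises.\<close>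

lemma contr_idem:
  assumes "i \<in> {1..k}"
  shows "contr n k i i (contr n k i i u) = smul (of_nat n) (contr n k i i u)"
proof (rule ext, clarify)
  fix a b
  show "contr n k i i (contr n k i i u) (a, b) = smul (of_nat n) (contr n k i i u) (a, b)"
  proof (cases "(a, b) \<in> Idx n k \<and> a i = b i")
    case True
    have in1: "(a(i := m), b(i := m)) \<in> Idx n k" if "m \<in> {1..n}" for m
      using True that assms by (auto simp: Idx_def intro!: PiE_upd)
    then show ?thesis using True by (simp add: contr_def smul_apply)
  qed (auto simp: contr_def smul_apply)
qed

lemma contr_site:
  assumes "s \<in> {1..k} <+> {1..k}" "s \<noteq> Inl i" "s \<noteq> Inr i" "c \<in> {1..n}" "d \<in> {1..n}"
  shows "contr n k i i (site s c d u) = site s c d (contr n k i i u)"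
proof (rule ext, clarify)
  fix a b
  show "contr n k i i (site s c d u) (a, b) = site s c d (contr n k i i u) (a, b)"
  proof (cases s)
    case (Inl p)
    have "a p = c \<Longrightarrow> (a(p := d), b) \<in> Idx n k \<longleftrightarrow> (a, b) \<in> Idx n k"
      using Inl assms PiE_upd_iff[of p "{1..k}" d "{1..n}" a] unfolding Idx_def by blast
    then show ?thesis using Inl assms by (auto simp: contr_def fun_upd_twist)
  next
    case (Inr p)
    have "b p = d \<Longrightarrow> (a, b(p := c)) \<in> Idx n k \<longleftrightarrow> (a, b) \<in> Idx n k"
      using Inr assms PiE_upd_iff[of p "{1..k}" c "{1..n}" b] unfolding Idx_def by blast
    then show ?thesis using Inr assms by (auto simp: contr_def fun_upd_twist sum_negf)
  qed
qed

text \<open>The two places touched by the contraction contribute with opposite signs: both the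
  pairing that is evaluated and the canonical tensor that is inserted are invariant.\<close>

lemma contr_site_pair:
  assumes "i \<in> {1..k}" "c \<in> {1..n}" "d \<in> {1..n}"
  shows "contr n k i i (site (Inl i) c d u) + contr n k i i (site (Inr i) c d u) = 0"
    "site (Inl i) c d (contr n k i i u) + site (Inr i) c d (contr n k i i u) = 0"
proof -
  show "contr n k i i (site (Inl i) c d u) + contr n k i i (site (Inr i) c d u) = 0"
  proof (rule ext, clarify)
    fix a b
    have 1: "(\<Sum>m\<in>{1..n}. site (Inl i) c d u (a(i := m), b(i := m))) = u (a(i := d), b(i := c))"
      using assms by (simp add: sum.delta if_distrib cong: if_cong)
    have 2: "(\<Sum>m\<in>{1..n}. site (Inr i) c d u (a(i := m), b(i := m))) = - u (a(i := d), b(i := c))"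
      using assms by (simp add: sum.delta if_distrib cong: if_cong)
    show "(contr n k i i (site (Inl i) c d u) + contr n k i i (site (Inr i) c d u)) (a, b) = 0 (a, b)"
      unfolding fun_simps contr_def split_conv 1 2 by simp
  qed
  show "site (Inl i) c d (contr n k i i u) + site (Inr i) c d (contr n k i i u) = 0"
  proof (rule ext, clarify)
    fix a b
    have "a i = c \<Longrightarrow> (a(i := d), b) \<in> Idx n k \<longleftrightarrow> (a, b) \<in> Idx n k"
      "b i = d \<Longrightarrow> (a, b(i := c)) \<in> Idx n k \<longleftrightarrow> (a, b) \<in> Idx n k"
      using assms PiE_upd_iff[of i "{1..k}" d "{1..n}" a] PiE_upd_iff[of i "{1..k}" c "{1..n}" b]
      unfolding Idx_def by blast+
    then show "(site (Inl i) c d (contr n k i i u) + site (Inr i) c d (contr n k i i u)) (a, b) = 0 (a, b)"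
      by (auto simp: contr_def fun_simps)
  qed
qed

lemma contr_lact:
  assumes "i \<in> {1..k}" "c \<in> {1..n}" "d \<in> {1..n}"
  shows "contr n k i i (lact {1..k} {1..k} c d u) = lact {1..k} {1..k} c d (contr n k i i u)"
proof -
  let ?S = "{1..k} <+> {1..k}" and ?R = "{1..k} <+> {1..k} - {Inl i, Inr i}"
  have S: "sum f ?S = sum f ?R + (f (Inl i) + f (Inr i))" for f :: "nat + nat \<Rightarrow> tens"
  proof -
    have "sum f ?S = sum f ?R + sum f {Inl i, Inr i}"
      using assms by (intro sum.subset_diff) auto
    then show ?thesis by simp
  qed
  have R: "(\<Sum>s\<in>?R. contr n k i i (site s c d u)) = (\<Sum>s\<in>?R. site s c d (contr n k i i u))"
    by (intro sum.cong refl contr_site) (use assms in auto)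
  show ?thesis
    unfolding lact_def contr_sum S R contr_add contr_site_pair[OF assms] ..
qed

section \<open>The idempotent and the space of traceless tensors\<close>

definition esub :: "nat \<Rightarrow> nat \<Rightarrow> nat \<Rightarrow> tens \<Rightarrow> tens" where
  "esub n k i v = v - proj n k i v"

text \<open>The product defining \<open>eop\<close> with its index list as a parameter, which makes
  induction on the list possible.\<close>

definition efold :: "nat \<Rightarrow> nat \<Rightarrow> nat list \<Rightarrow> tens \<Rightarrow> tens" where
  "efold n k L = foldr (\<lambda>i f. (\<lambda>v. v - proj n k i v) \<circ> f) L id"

lemma efold_simps [simp]: "efold n k [] v = v" "efold n k (i # L) v = esub n k i (efold n k L v)"
  by (simp_all add: efold_def esub_def)

lemma eop_efold: "eop n k = efold n k [1..<k+1]"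
  by (simp only: eop_def efold_def)

lemma esub_linear: "esub n k i (u + v) = esub n k i u + esub n k i v"
  "esub n k i (smul c u) = smul c (esub n k i u)"
  by (simp_all add: esub_def proj_def contr_add contr_smul smul_apply fun_eq_iff fun_simps algebra_simps)

lemma eop_closed:
  assumes "is_subspace N" "\<And>i u. i \<in> {1..k} \<Longrightarrow> u \<in> N \<Longrightarrow> contr n k i i u \<in> N" "u \<in> N"
  shows "eop n k u \<in> N"
proof -
  have "set L \<subseteq> {1..k} \<Longrightarrow> efold n k L u \<in> N" for L
  proof (induction L)
    case (Cons i L)
    then show ?case unfolding efold_simps esub_def proj_def
      using assms(2) by (auto intro!: is_subspaceD[OF assms(1)])
  qed (use assms in simp)
  then show ?thesis by (simp_all add: eop_efold atLeastLessThanSuc_atLeastAtMost del: upt_Suc)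
qed

text \<open>The contraction commutes with every factor and kills the factor with its own index, by
  \<open>contr_idem\<close>.\<close>

lemma contr_eop:
  assumes "i \<in> {1..k}" "n > 0"
  shows "contr n k i i (eop n k u) = 0"
proof -
  have zero: "contr n k i i (esub n k i v) = 0" for v
    using assms(2) by (simp add: esub_def proj_def contr_diff contr_smul contr_idem[OF assms(1)])
  have comm: "contr n k i i (esub n k j v) = esub n k j (contr n k i i v)" if "j \<in> {1..k}" for j v
    using contr_commute[OF assms(1) that] by (simp add: esub_def proj_def contr_diff contr_smul)
  have "set L \<subseteq> {1..k} \<Longrightarrow> i \<in> set L \<Longrightarrow>
      contr n k i i (efold n k L u) = 0" for L
  proof (induction L)
    case (Cons j L)
    show ?case
    proof (cases "i = j")
      case True
      then show ?thesis unfolding efold_simps using zero by simp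
    next
      case False
      then have "contr n k i i (efold n k L u) = 0"
        using Cons by auto
      moreover have "esub n k j 0 = 0" using esub_linear(2)[of n k j 0 0] by simp
      ultimately show ?thesis unfolding efold_simps using comm[of j] Cons.prems by simp
    qed
  qed simp
  from this[of "[1..<k+1]"] show ?thesis using assms by (simp add: eop_efold atLeastLessThanSuc_atLeastAtMost del: upt_Suc)
qed

lemma eop_id:
  assumes "\<And>i. i \<in> {1..k} \<Longrightarrow> contr n k i i u = 0"
  shows "eop n k u = u"
proof -
  have "set L \<subseteq> {1..k} \<Longrightarrow> efold n k L u = u" for L
  proof (induction L)
    case (Cons i L)
    then show ?case unfolding efold_simps esub_def proj_def using assms[of i] by simp
  qed simp
  then show ?thesis by (simp_all add: eop_efold atLeastLessThanSuc_atLeastAtMost del: upt_Suc)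
qed

text \<open>The image of the idempotent is the common kernel of the contractions
  \<open>contr n k i i\<close>. This description makes stability under the action immediate. The
  bound makes \<open>n\<close> positive as soon as there is a place.\<close>

lemma eM_iff:
  assumes "k \<le> n"
  shows "u \<in> eM n k \<longleftrightarrow> u \<in> Mset n k \<and> (\<forall>i\<in>{1..k}. contr n k i i u = 0)"
proof
  assume "u \<in> eM n k"
  then obtain v where v: "v \<in> Mset n k" "u = eop n k v" by (auto simp: eM_def)
  have "u \<in> Mset n k" unfolding v(2)
    by (rule eop_closed) (use v in \<open>auto simp: Mset_fsupp fsupp_subspace contr_in[unfolded Mset_fsupp]\<close>)
  moreover have "contr n k i i u = 0" if "i \<in> {1..k}" for i
    unfolding v(2) using that assms by (intro contr_eop) auto
  ultimately show "u \<in> Mset n k \<and> (\<forall>i\<in>{1..k}. contr n k i i u = 0)" by blast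
next
  assume u: "u \<in> Mset n k \<and> (\<forall>i\<in>{1..k}. contr n k i i u = 0)"
  then have "eop n k u = u" by (intro eop_id) auto
  then show "u \<in> eM n k" using u unfolding eM_def by (metis image_eqI)
qed

text \<open>Passage from arbitrary matrices to matrix units; it lets membership in the commutant be
  tested on matrix units.\<close>

lemma gl_act_lact:
  assumes "u \<in> Mset n k"
  shows "gl_act n k x u = (\<Sum>i\<in>{1..n}. \<Sum>j\<in>{1..n}. smul (x i j) (lact {1..k} {1..k} i j u))"
proof (rule ext, clarify)
  fix a b
  let ?K = "{1..k}" and ?N = "{1..n}"
  interpret gl_module n "tidx n ?K ?K" "lact ?K ?K" by (rule tensor_gl_module) auto
  show "gl_act n k x u (a, b) = (\<Sum>i\<in>?N. \<Sum>j\<in>?N. smul (x i j) (lact ?K ?K i j u)) (a, b)"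
  proof (cases "(a, b) \<in> Idx n k")
    case False
    have "lact ?K ?K i j u (a, b) = 0" if "i \<in> ?N" "j \<in> ?N" for i j
      using E_supp[OF that, of u] assms False unfolding tidx_Idx Mset_fsupp fsupp_def by blast
    then show ?thesis using False by (auto simp: gl_act_def sum_fun_apply smul_apply intro!: sum.neutral)
  next
    case True
    have ab: "p \<in> ?K \<Longrightarrow> a p \<in> ?N" "p \<in> ?K \<Longrightarrow> b p \<in> ?N" for p using True by (auto simp: Idx_def)
    have "(\<Sum>i\<in>?N. \<Sum>j\<in>?N. smul (x i j) (lact ?K ?K i j u)) (a, b)
      = (\<Sum>i\<in>?N. \<Sum>j\<in>?N. (\<Sum>p\<in>?K. if i = a p then x i j * u (a(p := j), b) else 0)
          - (\<Sum>q\<in>?K. if j = b q then x i j * u (a, b(q := i)) else 0))"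
      unfolding sum_fun_apply smul_apply
      by (intro sum.cong refl) (simp add: lact_apply right_diff_distrib sum_distrib_left if_distrib
        eq_commute[of "a _"] eq_commute[of "b _"] cong: if_cong)
    also have "\<dots> = (\<Sum>i\<in>?N. \<Sum>j\<in>?N. \<Sum>p\<in>?K. if i = a p then x i j * u (a(p := j), b) else 0)
        - (\<Sum>i\<in>?N. \<Sum>j\<in>?N. \<Sum>q\<in>?K. if j = b q then x i j * u (a, b(q := i)) else 0)"
      by (simp only: sum_subtractf)
    also have "(\<Sum>i\<in>?N. \<Sum>j\<in>?N. \<Sum>p\<in>?K. if i = a p then x i j * u (a(p := j), b) else 0)
      = (\<Sum>p\<in>?K. \<Sum>j\<in>?N. \<Sum>i\<in>?N. if i = a p then x i j * u (a(p := j), b) else 0)"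
      by (subst sum.swap, subst (2) sum.swap, subst sum.swap) (rule refl)
    also have "\<dots> = (\<Sum>p\<in>?K. \<Sum>j\<in>?N. x (a p) j * u (a(p := j), b))"
      by (intro sum.cong refl, subst sum.delta) (use ab in auto)
    also have "(\<Sum>i\<in>?N. \<Sum>j\<in>?N. \<Sum>q\<in>?K. if j = b q then x i j * u (a, b(q := i)) else 0)
      = (\<Sum>q\<in>?K. \<Sum>i\<in>?N. \<Sum>j\<in>?N. if j = b q then x i j * u (a, b(q := i)) else 0)"
      by (subst (2) sum.swap, subst sum.swap) (rule refl)
    also have "\<dots> = (\<Sum>q\<in>?K. \<Sum>i\<in>?N. x i (b q) * u (a, b(q := i)))"
      by (intro sum.cong refl, subst sum.delta) (use ab in auto)
    finally show ?thesis using True by (simp only: gl_act_def split_conv if_True)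
  qed
qed

section \<open>Simple modules of the commutant\<close>

text \<open>Letters and places are counted from 1, and the intervals \<open>{1..n}\<close> and
  \<open>{1..k}\<close> should keep this form under simplification.\<close>

declare One_nat_def [simp del]

text \<open>A finiteness bound, by which a largest orthogonal family of maximal vectors
  exists.\<close>

lemma orthogonal_card_le:
  fixes B :: "('z \<Rightarrow> complex) set"
  assumes "finite Z" "finite B" "B \<subseteq> fsupp Z" "0 \<notin> B"
    "\<And>b b'. b \<in> B \<Longrightarrow> b' \<in> B \<Longrightarrow> b \<noteq> b' \<Longrightarrow> ip Z b b' = 0"
  shows "card B \<le> card Z"
proof -
  interpret vs: vector_space "smul :: complex \<Rightarrow> ('z \<Rightarrow> complex) \<Rightarrow> ('z \<Rightarrow> complex)"
    by unfold_locales (auto simp: smul_add add_smul)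
  define d where "d z = (\<lambda>y. if y = z then 1 else 0 :: complex)" for z :: 'z
  have "B \<subseteq> vs.span (d ` Z)"
  proof
    fix u assume "u \<in> B"
    then have u: "u z = 0" if "z \<notin> Z" for z using assms(3) that unfolding fsupp_def by blast
    have "u = (\<Sum>z\<in>Z. smul (u z) (d z))"
    proof
      fix y
      show "u y = (\<Sum>z\<in>Z. smul (u z) (d z)) y"
        using u[of y] assms(1) by (simp add: sum_fun_apply smul_apply d_def if_distrib sum.delta cong: if_cong)
    qed
    moreover have "(\<Sum>z\<in>Z. smul (u z) (d z)) \<in> vs.span (d ` Z)"
      by (intro vs.span_sum vs.span_scale vs.span_base) simp
    ultimately show "u \<in> vs.span (d ` Z)" by metis
  qed
  moreover have "vs.independent B"
    unfolding vs.dependent_finite[OF assms(2)]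
  proof clarify
    fix c b assume c: "(\<Sum>v\<in>B. smul (c v) v) = 0" and b: "b \<in> B" "c b \<noteq> 0"
    have "0 = ip Z (\<Sum>v\<in>B. smul (c v) v) b" using c by simp
    also have "\<dots> = (\<Sum>v\<in>B. c v * ip Z v b)"
      by (subst sum_comp_morphism[symmetric, unfolded comp_def, of "\<lambda>x. ip Z x b"])
        (simp_all add: ip_add_left ip_smul_left)
    also have "\<dots> = (\<Sum>v\<in>B. if v = b then c b * ip Z b b else 0)"
      by (intro sum.cong refl) (use assms(5) b in auto)
    also have "\<dots> = c b * ip Z b b" using assms(2) b by simp
    finally have "ip Z b b = 0" using b by simp
    then have "b = 0" using ip_self_eq_0 assms(1,3) b by blast
    then show False using assms(4) b by simp
  qed
  ultimately have "card B \<le> card (d ` Z)"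
    using vs.independent_span_bound[of "d ` Z" B] assms(1) by simp
  then show ?thesis using card_image_le[OF assms(1), of d] by linarith
qed

locale mixed_tensors =
  fixes n k :: nat
  assumes k_le_n: "k \<le> n"

sublocale mixed_tensors \<subseteq> tensor_module n "{1..k}" "{1..k}"
  by unfold_locales auto

context mixed_tensors
begin

abbreviation "L \<equiv> lact {1..k} {1..k}"

lemmas Mset_eq = Mset_fsupp[of n k, folded tidx_Idx]

lemma eM_stable: "stable (eM n k)"
  unfolding stable_def is_subspace_def
  by (auto simp: eM_iff[OF k_le_n] Mset_eq fsupp_closed contr_zero contr_add contr_smul contr_lact E_zero E_supp)

lemmas eM_subspace = eM_stable[unfolded stable_def, THEN conjunct1]
lemmas eM_closed = is_subspaceD[OF eM_subspace]

lemma eM_fsupp: "u \<in> eM n k \<Longrightarrow> u \<in> fsupp (tidx n {1..k} {1..k})"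
  using eM_stable unfolding stable_def by blast

lemma eM_L: "i \<in> {1..n} \<Longrightarrow> j \<in> {1..n} \<Longrightarrow> u \<in> eM n k \<Longrightarrow> L i j u \<in> eM n k"
  using eM_stable unfolding stable_def by blast

lemma EndC_D:
  assumes "f \<in> EndC n k"
  shows "u \<in> eM n k \<Longrightarrow> f u \<in> eM n k"
    "u \<in> eM n k \<Longrightarrow> v \<in> eM n k \<Longrightarrow> f (u + v) = f u + f v"
    "u \<in> eM n k \<Longrightarrow> f (smul c u) = smul c (f u)"
    "i \<in> {1..n} \<Longrightarrow> j \<in> {1..n} \<Longrightarrow> u \<in> eM n k \<Longrightarrow> f (L i j u) = L i j (f u)"
    "u \<notin> eM n k \<Longrightarrow> f u = 0"
proof -
  show 1: "u \<in> eM n k \<Longrightarrow> f u \<in> eM n k" for u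
    using assms by (simp add: EndC_def)
  show "u \<in> eM n k \<Longrightarrow> v \<in> eM n k \<Longrightarrow> f (u + v) = f u + f v"
    "u \<in> eM n k \<Longrightarrow> f (smul c u) = smul c (f u)"
    "u \<notin> eM n k \<Longrightarrow> f u = 0"
    using assms by (simp_all add: EndC_def)
  assume ij: "i \<in> {1..n}" "j \<in> {1..n}" and u: "u \<in> eM n k"
  define x where "x i' j' = (if i' = i then if j' = j then 1 else 0 else 0 :: complex)" for i' j'
  have *: "gl_act n k x v = L i j v" if "v \<in> eM n k" for v
  proof -
    have "gl_act n k x v = (\<Sum>i'\<in>{1..n}. \<Sum>j'\<in>{1..n}. if j' = j then (if i' = i then L i j v else 0) else 0)"
      unfolding gl_act_lact[OF eM_fsupp[OF that, folded Mset_eq]]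
      by (intro sum.cong refl) (simp add: x_def)
    also have "\<dots> = L i j v" using ij by (simp add: sum.delta del: atLeastAtMost_iff)
    finally show ?thesis .
  qed
  have "f (gl_act n k x u) = gl_act n k x (f u)" using assms u by (simp add: EndC_def)
  then show "f (L i j u) = L i j (f u)" using * u 1 by simp
qed

lemma EndC_I:
  assumes "\<And>u. u \<in> eM n k \<Longrightarrow> f u \<in> eM n k"
    "\<And>u v. u \<in> eM n k \<Longrightarrow> v \<in> eM n k \<Longrightarrow> f (u + v) = f u + f v"
    "\<And>u c. u \<in> eM n k \<Longrightarrow> f (smul c u) = smul c (f u)"
    "\<And>u i j. i \<in> {1..n} \<Longrightarrow> j \<in> {1..n} \<Longrightarrow> u \<in> eM n k \<Longrightarrow> f (L i j u) = L i j (f u)"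
    "\<And>u. u \<notin> eM n k \<Longrightarrow> f u = 0"
  shows "f \<in> EndC n k"
proof -
  have f0: "f 0 = 0" using assms(3)[of 0 0] eM_closed(1) by simp
  have fsum: "f (sum g A) = (\<Sum>x\<in>A. f (g x))" if "\<And>x. x \<in> A \<Longrightarrow> g x \<in> eM n k" for g and A :: "nat set"
    using that
  proof (induction A rule: infinite_finite_induct)
    case (insert x A)
    then have "f (g x + sum g A) = f (g x) + f (sum g A)"
      by (intro assms(2) subspace_sum[OF eM_subspace]) auto
    then show ?case using insert by simp
  qed (simp_all add: f0)
  have "f (gl_act n k x u) = gl_act n k x (f u)" if u: "u \<in> eM n k" for x u
  proof -
    have in1: "smul (x i j) (L i j u) \<in> eM n k" if "i \<in> {1..n}" "j \<in> {1..n}" for i j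
      using that u by (intro eM_closed eM_L)
    have "f (gl_act n k x u) = (\<Sum>i\<in>{1..n}. \<Sum>j\<in>{1..n}. f (smul (x i j) (L i j u)))"
    proof -
      have "f (gl_act n k x u) = (\<Sum>i\<in>{1..n}. f (\<Sum>j\<in>{1..n}. smul (x i j) (L i j u)))"
        unfolding gl_act_lact[OF eM_fsupp[OF u, folded Mset_eq]]
        by (intro fsum subspace_sum[OF eM_subspace] in1)
      also have "\<dots> = (\<Sum>i\<in>{1..n}. \<Sum>j\<in>{1..n}. f (smul (x i j) (L i j u)))"
        by (intro sum.cong refl fsum in1)
      finally show ?thesis .
    qed
    also have "\<dots> = (\<Sum>i\<in>{1..n}. \<Sum>j\<in>{1..n}. smul (x i j) (L i j (f u)))"
      by (intro sum.cong refl) (simp add: assms(3,4) eM_L u)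
    also have "\<dots> = gl_act n k x (f u)"
      using assms(1)[OF u] by (subst gl_act_lact) (simp_all add: Mset_eq eM_fsupp)
    finally show ?thesis .
  qed
  then show ?thesis using assms by (simp add: EndC_def)
qed

lemma EndC_zero: "f \<in> EndC n k \<Longrightarrow> f 0 = 0"
  using EndC_D(3)[of f 0 0] eM_closed(1) by simp

lemma EndC_add: "f \<in> EndC n k \<Longrightarrow> g \<in> EndC n k \<Longrightarrow> f + g \<in> EndC n k"
  by (rule EndC_I) (auto simp: plus_fun_apply[of f g] EndC_D eM_closed E_add smul_add)

lemma EndC_smul: "f \<in> EndC n k \<Longrightarrow> (\<lambda>v. smul c (f v)) \<in> EndC n k"
  by (rule EndC_I) (auto simp: EndC_D eM_closed E_smul smul_add mult.commute)

lemma EndC_comp: "f \<in> EndC n k \<Longrightarrow> g \<in> EndC n k \<Longrightarrow> f \<circ> g \<in> EndC n k"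
  by (rule EndC_I) (auto simp: EndC_D eM_closed EndC_zero)

lemma EndC_0: "0 \<in> EndC n k"
  by (rule EndC_I) (auto simp: zero_fun_apply[where 'b = tens] eM_closed E_zero)

lemma EndC_sum: "(\<And>x. x \<in> A \<Longrightarrow> f x \<in> EndC n k) \<Longrightarrow> sum f A \<in> EndC n k"
  by (induction A rule: infinite_finite_induct) (auto simp: EndC_0 EndC_add)

lemma unitC_EndC: "unitC n k \<in> EndC n k"
  by (rule EndC_I) (auto simp: unitC_def eM_closed eM_L)

section \<open>Spaces of maximal vectors and the operators between them\<close>

definition H :: "(nat \<Rightarrow> int) \<Rightarrow> tens set" where
  "H \<omega> = {u \<in> eM n k. maxvec (\<lambda>i. of_int (\<omega> i)) u}"

lemma H_subspace: "is_subspace (H \<omega>)"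
  using eM_subspace maxvec_subspace[of "\<lambda>i. of_int (\<omega> i)"] unfolding H_def is_subspace_def by simp

lemmas H_closed = is_subspaceD[OF H_subspace]

lemma EndC_H:
  assumes "f \<in> EndC n k" "u \<in> H \<omega>"
  shows "f u \<in> H \<omega>"
proof -
  have u: "u \<in> eM n k" "maxvec (\<lambda>i. of_int (\<omega> i)) u" using assms(2) by (auto simp: H_def)
  have "L i j (f u) = 0" if "i \<in> {1..n}" "j \<in> {1..n}" "i < j" for i j
    using EndC_D(4)[OF assms(1) that(1,2) u(1)] u(2) that EndC_zero[OF assms(1)]
    unfolding maxvec_def by metis
  moreover have "L i i (f u) = smul (of_int (\<omega> i)) (f u)" if "i \<in> {1..n}" for i
    using EndC_D(4)[OF assms(1) that that u(1)] u that EndC_D(3)[OF assms(1) u(1)]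
    unfolding maxvec_def by metis
  ultimately show ?thesis
    using EndC_D(1)[OF assms(1) u(1)] eM_fsupp unfolding H_def maxvec_def by blast
qed

lemma H_eM: "u \<in> H \<omega> \<Longrightarrow> u \<in> eM n k"
  by (simp add: H_def)

lemma H_maxvec: "u \<in> H \<omega> \<Longrightarrow> maxvec (\<lambda>i. of_int (\<omega> i)) u"
  by (simp add: H_def)

definition oc :: "tens \<Rightarrow> tens set" where
  "oc b = {u \<in> eM n k. \<forall>x\<in>cyc b. ip (tidx n {1..k} {1..k}) u x = 0}"

lemma cyc_eM: "b \<in> H \<omega> \<Longrightarrow> cyc b \<subseteq> eM n k"
  by (intro cyc_subset eM_stable) (rule H_eM)

text \<open>The values of the intertwiner from \<open>hw_hom_exists\<close> lie in
  \<open>cyc a\<close>, which is contained in \<open>eM n k\<close>; so its restriction belongs to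
  the commutant.\<close>

lemma rank_one_exists:
  assumes "b \<in> H \<omega>" "a \<in> H \<omega>" "b \<noteq> 0"
  shows "\<exists>f\<in>EndC n k. f b = a \<and> (\<forall>u\<in>oc b. f u = 0) \<and> (\<forall>u\<in>eM n k. f u \<in> cyc a)"
proof -
  let ?Z = "tidx n {1..k} {1..k}"
  interpret hw_pair n ?Z L ?Z L b a "\<lambda>i. of_int (\<omega> i)"
    by unfold_locales (use assms H_maxvec in auto)
  show ?thesis
  proof (rule hw_hom_exists[OF assms(3)])
  fix F assume F:
    "\<And>u v. u \<in> fsupp ?Z \<Longrightarrow> v \<in> fsupp ?Z \<Longrightarrow> F (u + v) = F u + F v"
    "\<And>c u. u \<in> fsupp ?Z \<Longrightarrow> F (smul c u) = smul c (F u)"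
    "\<And>i j u. i \<in> {1..n} \<Longrightarrow> j \<in> {1..n} \<Longrightarrow> u \<in> fsupp ?Z \<Longrightarrow> F (L i j u) = L i j (F u)"
    "F b = a"
    "\<And>u. u \<in> fsupp ?Z \<Longrightarrow> (\<And>x. x \<in> cyc b \<Longrightarrow> ip ?Z u x = 0) \<Longrightarrow> F u = 0"
    "\<And>u. u \<in> fsupp ?Z \<Longrightarrow> F u \<in> cyc a"
  define f where "f u = (if u \<in> eM n k then F u else 0)" for u
  have "f \<in> EndC n k"
    by (rule EndC_I) (use F cyc_eM[OF assms(2)] in \<open>auto simp: f_def eM_fsupp eM_closed eM_L\<close>)
  moreover have "f b = a" using assms F(4) by (simp add: f_def H_eM)
  moreover have "\<forall>u\<in>oc b. f u = 0" using F(5) by (auto simp: f_def oc_def eM_fsupp)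
  moreover have "\<forall>u\<in>eM n k. f u \<in> cyc a" using F(6) by (auto simp: f_def eM_fsupp)
  ultimately show ?thesis by blast
  qed
qed

lemma EndC_eq_cyc:
  assumes "b \<in> H \<omega>" "f \<in> EndC n k" "g \<in> EndC n k" "f b = g b" "x \<in> cyc b"
  shows "f x = g x"
  using assms(5)
proof (induction rule: cyc_induct)
  case base
  then show ?case by (rule assms(4))
qed (use cyc_eM[OF assms(1)] in \<open>simp_all add: subset_iff EndC_D[OF assms(2)] EndC_D[OF assms(3)]\<close>)

lemma cyc_decompose:
  assumes "b \<in> H \<omega>" "u \<in> eM n k"
  obtains x y where "x \<in> cyc b" "y \<in> oc b" "u = x + y"
proof -
  have "stable (cyc b)" by (rule cyc_stable[OF H_maxvec[OF assms(1)]])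
  then obtain x where x: "x \<in> cyc b" "\<forall>z\<in>cyc b. ip (tidx n {1..k} {1..k}) (u - x) z = 0"
    using orth_projection[OF finZ, of "cyc b" u] unfolding stable_def by blast
  have "u - x \<in> eM n k" using assms x cyc_eM by (intro eM_closed) auto
  then have "u - x \<in> oc b" using x by (simp add: oc_def)
  then show ?thesis using that[OF x(1)] by simp
qed

text \<open>The space \<open>eM n k\<close> is the sum of \<open>cyc b\<close> and
  \<open>oc b\<close>, and on \<open>cyc b\<close> an intertwiner is determined by its value at
  \<open>b\<close>.\<close>

lemma EndC_eqI:
  assumes "b \<in> H \<omega>" "f \<in> EndC n k" "g \<in> EndC n k" "f b = g b"
    "\<And>u. u \<in> oc b \<Longrightarrow> f u = 0" "\<And>u. u \<in> oc b \<Longrightarrow> g u = 0"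
  shows "f = g"
proof
  fix u
  show "f u = g u"
  proof (cases "u \<in> eM n k")
    case True
    then obtain x y where xy: "x \<in> cyc b" "y \<in> oc b" "u = x + y" using cyc_decompose assms(1) by blast
    then have "x \<in> eM n k" "y \<in> eM n k" using cyc_eM[OF assms(1)] by (auto simp: oc_def)
    then show ?thesis
      unfolding xy(3) using EndC_eq_cyc[OF assms(1-4) xy(1)] assms(5,6)[OF xy(2)]
      by (simp add: EndC_D[OF assms(2)] EndC_D[OF assms(3)])
  qed (simp add: EndC_D[OF assms(2)] EndC_D[OF assms(3)])
qed

text \<open>The analogue of a matrix unit. For maximal vectors \<open>a\<close> and \<open>b\<close>
  of the same weight with \<open>b\<close> nonzero, \<open>EndC_eqI\<close> determines it by its
  value at \<open>b\<close> and its vanishing on \<open>oc b\<close>. Hence it is linear in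
  \<open>a\<close> and compatible with composition in spite of the choice.\<close>

definition rk :: "tens \<Rightarrow> tens \<Rightarrow> tens \<Rightarrow> tens" where
  "rk a b = (SOME f. f \<in> EndC n k \<and> f b = a \<and> (\<forall>u\<in>oc b. f u = 0) \<and> (\<forall>u\<in>eM n k. f u \<in> cyc a))"

context
  fixes b :: tens and \<omega> :: "nat \<Rightarrow> int"
  assumes bH: "b \<in> H \<omega>" and b0: "b \<noteq> 0"
begin

lemma rk:
  assumes "a \<in> H \<omega>"
  shows "rk a b \<in> EndC n k" "rk a b b = a" "u \<in> oc b \<Longrightarrow> rk a b u = 0" "u \<in> eM n k \<Longrightarrow> rk a b u \<in> cyc a"
proof -
  have "\<exists>f. f \<in> EndC n k \<and> f b = a \<and> (\<forall>u\<in>oc b. f u = 0) \<and> (\<forall>u\<in>eM n k. f u \<in> cyc a)"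
    using rank_one_exists[OF bH assms b0] by blast
  from someI_ex[OF this, folded rk_def]
  show "rk a b \<in> EndC n k" "rk a b b = a" "u \<in> oc b \<Longrightarrow> rk a b u = 0" "u \<in> eM n k \<Longrightarrow> rk a b u \<in> cyc a"
    by auto
qed

lemma rk_add: "a \<in> H \<omega> \<Longrightarrow> a' \<in> H \<omega> \<Longrightarrow> rk (a + a') b = rk a b + rk a' b"
  by (rule EndC_eqI[OF bH])
    (auto simp: rk H_closed EndC_add plus_fun_apply[where 'b = tens])

lemma rk_smul: "a \<in> H \<omega> \<Longrightarrow> rk (smul c a) b = (\<lambda>v. smul c (rk a b v))"
  by (rule EndC_eqI[OF bH]) (auto simp: rk H_closed EndC_smul)

text \<open>Together with \<open>rk_add\<close> and \<open>rk_smul\<close> this embeds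
  \<open>H \<omega>\<close> into the commutant as the left ideal of all \<open>rk a b\<close> with
  \<open>b\<close> fixed; through this ideal an abstract simple module is compared with
  \<open>H \<omega>\<close>.\<close>

lemma rk_comp: "a \<in> H \<omega> \<Longrightarrow> g \<in> EndC n k \<Longrightarrow> rk (g a) b = g \<circ> rk a b"
  by (rule EndC_eqI[OF bH]) (auto simp: rk EndC_H EndC_comp EndC_zero)

lemma rk_diag_cyc: "x \<in> cyc b \<Longrightarrow> rk b b x = x"
  using EndC_eq_cyc[OF bH rk(1)[OF bH] unitC_EndC, of x] rk(2)[OF bH] bH cyc_eM[OF bH]
  by (auto simp: unitC_def H_eM)

lemma rk_diag_diff:
  assumes "u \<in> eM n k" "x \<in> cyc b"
  shows "ip (tidx n {1..k} {1..k}) (u - rk b b u) x = 0"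
proof -
  obtain y z where yz: "y \<in> cyc b" "z \<in> oc b" "u = y + z" using cyc_decompose assms bH by blast
  then have in1: "y \<in> eM n k" "z \<in> eM n k" using cyc_eM[OF bH] by (auto simp: oc_def)
  have "rk b b u = y"
    unfolding yz(3) using in1 yz by (simp add: EndC_D[OF rk(1)[OF bH]] rk_diag_cyc rk(3)[OF bH])
  then show ?thesis using yz assms(2) by (simp add: oc_def)
qed

end

lemma H_Cmod: "is_Cmod n k (H \<omega>) (\<lambda>f u. f u)"
  unfolding is_Cmod_def
  by (auto simp: H_subspace EndC_H EndC_D H_eM unitC_def plus_fun_apply[where 'b = tens])

text \<open>Any nonzero \<open>b\<close> generates, because every \<open>a\<close> is
  \<open>rk a b\<close> applied to \<open>b\<close>.\<close>

theorem H_irreducible: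
  assumes "H \<omega> \<noteq> {0}"
  shows "irreducible_Cmod n k (H \<omega>) (\<lambda>f u. f u)"
  unfolding irreducible_Cmod_def
proof (intro conjI H_Cmod assms allI impI)
  fix W assume W: "is_Csubmod n k (H \<omega>) (\<lambda>f u. f u) W"
  then have sub: "is_subspace W" "W \<subseteq> H \<omega>" by (auto simp: is_Csubmod_def)
  show "W = {0} \<or> W = H \<omega>"
  proof (cases "W = {0}")
    case False
    then obtain b where b: "b \<in> W" "b \<noteq> 0" using is_subspaceD(1)[OF sub(1)] by blast
    have bH: "b \<in> H \<omega>" using b sub by blast
    have "a \<in> W" if "a \<in> H \<omega>" for a
      using rk(1,2)[OF bH b(2) that] W b(1) unfolding is_Csubmod_def by metis
    then show ?thesis using sub by blast
  qed simp
qed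

text \<open>The element \<open>rk b b\<close> fixes \<open>b\<close>. The image
  \<open>\<phi> b\<close> has another weight, so it is orthogonal to \<open>cyc b\<close> and
  \<open>rk b b\<close> kills it, which no isomorphism allows.\<close>

theorem H_not_iso:
  assumes "H \<omega> \<noteq> {0}" "i \<in> {1..n}" "\<omega> i \<noteq> \<psi> i"
  shows "\<not> Cmod_iso n k (H \<omega>) (\<lambda>f u. f u) (H \<psi>) (\<lambda>f u. f u)"
proof
  assume "Cmod_iso n k (H \<omega>) (\<lambda>f u. f u) (H \<psi>) (\<lambda>f u. f u)"
  then obtain \<phi> where \<phi>: "bij_betw \<phi> (H \<omega>) (H \<psi>)"
    "\<And>c u. u \<in> H \<omega> \<Longrightarrow> \<phi> (smul c u) = smul c (\<phi> u)"
    "\<And>f u. f \<in> EndC n k \<Longrightarrow> u \<in> H \<omega> \<Longrightarrow> \<phi> (f u) = f (\<phi> u)"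
    unfolding Cmod_iso_def by blast
  obtain b where b: "b \<in> H \<omega>" "b \<noteq> 0" using assms(1) H_closed(1) by blast
  have "\<phi> 0 = 0" using \<phi>(2)[of 0 0] H_closed(1) by simp
  then have nz: "\<phi> b \<noteq> 0"
    using \<phi>(1) b H_closed(1) unfolding bij_betw_def inj_on_def by metis
  have "\<phi> b \<in> H \<psi>" using \<phi>(1) b by (auto simp: bij_betw_def)
  moreover have "\<phi> b \<in> oc b"
  proof -
    have "ip (tidx n {1..k} {1..k}) b (\<phi> b) = 0"
      using assms(3)
      by (intro maxvec_orth[OF H_maxvec[OF b(1)] H_maxvec[OF \<open>\<phi> b \<in> H \<psi>\<close>] assms(2)]) auto
    then have "\<forall>x\<in>cyc b. ip (tidx n {1..k} {1..k}) x (\<phi> b) = 0"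
      using cyc_orth_maxvec[OF H_maxvec[OF b(1)] H_maxvec[OF \<open>\<phi> b \<in> H \<psi>\<close>]] by blast
    then show ?thesis using \<open>\<phi> b \<in> H \<psi>\<close> ip_eq_0_sym unfolding oc_def by (blast intro: H_eM)
  qed
  ultimately have "rk b b (\<phi> b) = 0" using rk(3)[OF b b(1)] by blast
  moreover have "\<phi> (rk b b b) = rk b b (\<phi> b)" using \<phi>(3) rk(1)[OF b b(1)] b by blast
  ultimately show False using nz rk(2)[OF b b(1)] by simp
qed

text \<open>Each \<open>rk b b\<close> is the orthogonal projection onto \<open>cyc b\<close>. For a
  largest orthogonal family of nonzero maximal vectors the joint complement \<open>S\<close> is
  stable, and a nonzero \<open>S\<close> would contain a further maximal vector. So the projections
  add up to the identity.\<close>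

lemma unit_decomposition:
  "\<exists>B. finite B \<and> (\<forall>b\<in>B. b \<noteq> 0 \<and> (\<exists>\<omega>. b \<in> H \<omega>)) \<and> unitC n k = (\<Sum>b\<in>B. rk b b)"
proof -
  let ?Z = "tidx n {1..k} {1..k}"
  define good where "good B \<longleftrightarrow> finite B \<and> (\<forall>b\<in>B. b \<noteq> 0 \<and> (\<exists>\<omega>. b \<in> H \<omega>))
    \<and> (\<forall>b\<in>B. \<forall>b'\<in>B. b \<noteq> b' \<longrightarrow> ip ?Z b b' = 0)" for B
  have bound: "card B \<le> card ?Z" if "good B" for B
    using that by (intro orthogonal_card_le[OF finZ]) (auto simp: good_def dest: eM_fsupp[OF H_eM])
  have "good {}" by (simp add: good_def)
  then obtain B where B: "good B" and max: "\<And>B'. good B' \<Longrightarrow> card B' \<le> card B"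
    using ex_has_greatest_nat[of good "{}" card "Suc (card ?Z)"] bound by (metis le_imp_less_Suc)
  have fin: "finite B" using B by (simp add: good_def)
  have BH: "b \<noteq> 0 \<and> (\<exists>\<omega>. b \<in> H \<omega>)" if "b \<in> B" for b using B that by (simp add: good_def)
  have Borth: "ip ?Z b b' = 0" if "b \<in> B" "b' \<in> B" "b \<noteq> b'" for b b' using B that by (simp add: good_def)
  define S where "S = {u \<in> eM n k. \<forall>b\<in>B. \<forall>x\<in>cyc b. ip ?Z u x = 0}"
  have "stable S"
    unfolding stable_def
  proof (intro conjI ballI)
    show "is_subspace S"
      by (auto simp: S_def is_subspace_def eM_closed ip_add_left ip_smul_left)
    show "S \<subseteq> fsupp ?Z" by (auto simp: S_def eM_fsupp)
    fix i j u assume ij: "i \<in> {1..n}" "j \<in> {1..n}" and u: "u \<in> S"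
    have "ip ?Z (L i j u) x = 0" if bx: "b \<in> B" "x \<in> cyc b" for b x
    proof -
      obtain \<omega> where "b \<in> H \<omega>" using BH[OF bx(1)] by blast
      then have "stable (cyc b)" using cyc_stable H_maxvec by blast
      then have "x \<in> fsupp ?Z" "L j i x \<in> cyc b" using bx ij unfolding stable_def by blast+
      then show ?thesis using u bx ij eM_fsupp by (simp add: E_adj S_def)
    qed
    then show "L i j u \<in> S" using u ij by (auto simp: S_def eM_L)
  qed
  have S0: "S = {0}"
  proof (rule ccontr)
    assume "S \<noteq> {0}"
    then obtain b \<omega> where b: "b \<in> S" "b \<noteq> 0" "maxvec (\<lambda>i. of_int (\<omega> i)) b"
      using exists_maxvec[OF \<open>stable S\<close>] by blast
    have bo: "ip ?Z b b' = 0" if "b' \<in> B" for b' using b(1) that cyc_base by (auto simp: S_def)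
    have notin: "b \<notin> B" using bo[of b] b(1,2) ip_self_eq_0[OF finZ, of b] eM_fsupp by (auto simp: S_def)
    have "good (insert b B)"
      unfolding good_def
    proof (intro conjI ballI impI)
      show "finite (insert b B)" using fin by simp
      fix c assume c: "c \<in> insert b B"
      show "c \<noteq> 0" using c b BH by blast
      show "\<exists>\<omega>. c \<in> H \<omega>" using c b BH by (auto simp: H_def S_def)
      fix c' assume "c' \<in> insert b B" "c \<noteq> c'"
      then show "ip ?Z c c' = 0" using c bo Borth ip_eq_0_sym by blast
    qed
    from max[OF this] notin fin show False by simp
  qed
  have rkB: "rk b b \<in> EndC n k" "u \<in> eM n k \<Longrightarrow> rk b b u \<in> cyc b"
    "u \<in> eM n k \<Longrightarrow> x \<in> cyc b \<Longrightarrow> ip ?Z (u - rk b b u) x = 0"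
    "cyc b \<subseteq> eM n k" if b: "b \<in> B" for b u x
  proof -
    obtain \<omega> where bH: "b \<in> H \<omega>" "b \<noteq> 0" using BH b by blast
    show "rk b b \<in> EndC n k" "u \<in> eM n k \<Longrightarrow> rk b b u \<in> cyc b"
      "u \<in> eM n k \<Longrightarrow> x \<in> cyc b \<Longrightarrow> ip ?Z (u - rk b b u) x = 0" "cyc b \<subseteq> eM n k"
      using rk(1)[OF bH bH(1)] rk(4)[OF bH bH(1)] rk_diag_diff[OF bH] cyc_eM[OF bH(1)] by simp_all
  qed
  have "unitC n k = (\<Sum>b\<in>B. rk b b)"
  proof
    fix u
    show "unitC n k u = (\<Sum>b\<in>B. rk b b) u"
    proof (cases "u \<in> eM n k")
      case True
      let ?s = "\<Sum>b\<in>B. rk b b u"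
      have sM: "?s \<in> eM n k" using True by (intro subspace_sum[OF eM_subspace] EndC_D(1)[OF rkB(1)])
      have "ip ?Z (u - ?s) x = 0" if b: "b \<in> B" and x: "x \<in> cyc b" for b x
      proof -
        have "ip ?Z (u - ?s) x = ip ?Z u x - (\<Sum>c\<in>B. ip ?Z (rk c c u) x)"
          by (subst sum_comp_morphism[of "\<lambda>v. ip ?Z v x", unfolded comp_def])
            (simp_all add: ip_diff_left ip_add_left)
        also have "(\<Sum>c\<in>B. ip ?Z (rk c c u) x) = (\<Sum>c\<in>B. if c = b then ip ?Z (rk b b u) x else 0)"
        proof (intro sum.cong refl)
          fix c assume c: "c \<in> B"
          show "ip ?Z (rk c c u) x = (if c = b then ip ?Z (rk b b u) x else 0)"
          proof (cases "c = b")
            case False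
            obtain \<omega> \<psi> where bc: "b \<in> H \<omega>" "c \<in> H \<psi>" using BH b c by blast
            have "ip ?Z (rk c c u) x = 0"
              by (rule cyc_orth[OF H_maxvec[OF bc(2)] H_maxvec[OF bc(1)] Borth[OF c b False] rkB(2)[OF c True] x])
            then show ?thesis using False by simp
          qed simp
        qed
        also have "\<dots> = ip ?Z (rk b b u) x" using fin b by simp
        also have "ip ?Z u x - ip ?Z (rk b b u) x = 0"
          using rkB(3)[OF b True x] by (simp add: ip_diff_left)
        finally show ?thesis .
      qed
      then have "u - ?s \<in> S" using True sM by (auto simp: S_def eM_closed)
      then have "u = ?s" using S0 by simp
      then show ?thesis using True by (simp add: unitC_def sum_fun_apply)
    next
      case False
      then show ?thesis by (simp add: unitC_def sum_fun_apply EndC_D(5)[OF rkB(1)])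
    qed
  qed
  then show ?thesis using fin BH by blast
qed

text \<open>Some summand \<open>rk b b\<close> of the unit does not kill \<open>u0\<close>. Then
  sending \<open>a\<close> to \<open>\<rho> (rk a b) u0\<close> is a nonzero homomorphism between
  simple modules, hence bijective by Schur's argument on kernel and image.\<close>

theorem irreducible_iso_H:
  assumes "irreducible_Cmod n k N \<rho>"
  shows "\<exists>\<omega>. H \<omega> \<noteq> {0} \<and> Cmod_iso n k N \<rho> (H \<omega>) (\<lambda>f u. f u)"
proof -
  have mod: "is_Cmod n k N \<rho>" and N0: "N \<noteq> {0}"
    and irr: "\<And>W. is_Csubmod n k N \<rho> W \<Longrightarrow> W = {0} \<or> W = N"
    using assms unfolding irreducible_Cmod_def by blast+
  have sub: "is_subspace N"
    and \<rho>_in: "\<And>f u. f \<in> EndC n k \<Longrightarrow> u \<in> N \<Longrightarrow> \<rho> f u \<in> N"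
    and \<rho>_add: "\<And>f u v. f \<in> EndC n k \<Longrightarrow> u \<in> N \<Longrightarrow> v \<in> N \<Longrightarrow> \<rho> f (u + v) = \<rho> f u + \<rho> f v"
    and \<rho>_smul: "\<And>f u c. f \<in> EndC n k \<Longrightarrow> u \<in> N \<Longrightarrow> \<rho> f (smul c u) = smul c (\<rho> f u)"
    and \<rho>_fadd: "\<And>f g u. f \<in> EndC n k \<Longrightarrow> g \<in> EndC n k \<Longrightarrow> u \<in> N \<Longrightarrow> \<rho> (f + g) u = \<rho> f u + \<rho> g u"
    and \<rho>_fsmul: "\<And>f c u. f \<in> EndC n k \<Longrightarrow> u \<in> N \<Longrightarrow> \<rho> (\<lambda>v. smul c (f v)) u = smul c (\<rho> f u)"
    and \<rho>_comp: "\<And>f g u. f \<in> EndC n k \<Longrightarrow> g \<in> EndC n k \<Longrightarrow> u \<in> N \<Longrightarrow> \<rho> (f \<circ> g) u = \<rho> f (\<rho> g u)"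
    and \<rho>_unit: "\<And>u. u \<in> N \<Longrightarrow> \<rho> (unitC n k) u = u"
    using mod unfolding is_Cmod_def by blast+
  obtain u0 where u0: "u0 \<in> N" "u0 \<noteq> 0" using N0 is_subspaceD(1)[OF sub] by blast
  obtain B where B: "finite B" "\<forall>b\<in>B. b \<noteq> 0 \<and> (\<exists>\<omega>. b \<in> H \<omega>)" "unitC n k = (\<Sum>b\<in>B. rk b b)"
    using unit_decomposition by (elim exE conjE)
  have rkB: "rk b b \<in> EndC n k" if "b \<in> B" for b
  proof -
    obtain \<omega> where bH: "b \<in> H \<omega>" "b \<noteq> 0" using B(2) \<open>b \<in> B\<close> by blast
    show ?thesis by (rule rk(1)[OF bH bH(1)])
  qed
  have \<rho>0: "\<rho> 0 u = 0" if "u \<in> N" for u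
    using \<rho>_fadd[OF EndC_0 EndC_0 that] by (simp add: fun_eq_iff fun_simps)
  have \<rho>_sum: "\<rho> (\<Sum>b\<in>A. rk b b) u0 = (\<Sum>b\<in>A. \<rho> (rk b b) u0)" if "A \<subseteq> B" for A
    using that
  proof (induction A rule: infinite_finite_induct)
    case (insert b A)
    then have "\<rho> (rk b b + (\<Sum>b\<in>A. rk b b)) u0 = \<rho> (rk b b) u0 + \<rho> (\<Sum>b\<in>A. rk b b) u0"
      by (intro \<rho>_fadd rkB EndC_sum u0) auto
    then show ?case using insert by simp
  qed (simp_all add: \<rho>0 u0)
  have u0_sum: "u0 = (\<Sum>b\<in>B. \<rho> (rk b b) u0)" using \<rho>_unit[OF u0(1)] \<rho>_sum[of B] B(3) by simp
  have "\<exists>b\<in>B. \<rho> (rk b b) u0 \<noteq> 0"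
  proof (rule ccontr)
    assume "\<not> (\<exists>b\<in>B. \<rho> (rk b b) u0 \<noteq> 0)"
    then have "(\<Sum>b\<in>B. \<rho> (rk b b) u0) = 0" by (intro sum.neutral) simp
    then show False using u0_sum u0(2) by simp
  qed
  then obtain b where b: "b \<in> B" "\<rho> (rk b b) u0 \<noteq> 0" by (elim bexE)
  obtain \<omega> where bH: "b \<in> H \<omega>" "b \<noteq> 0" using bspec[OF B(2) b(1)] by blast
  define \<psi> where "\<psi> a = \<rho> (rk a b) u0" for a
  have \<psi>_in: "\<psi> a \<in> N" if "a \<in> H \<omega>" for a
    unfolding \<psi>_def using that by (intro \<rho>_in rk(1)[OF bH] u0(1))
  have \<psi>_add: "\<psi> (a + a') = \<psi> a + \<psi> a'" if "a \<in> H \<omega>" "a' \<in> H \<omega>" for a a'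
    unfolding \<psi>_def rk_add[OF bH that] using that by (intro \<rho>_fadd rk(1)[OF bH] u0(1))
  have \<psi>_smul: "\<psi> (smul c a) = smul c (\<psi> a)" if "a \<in> H \<omega>" for a c
    unfolding \<psi>_def rk_smul[OF bH that] using that by (intro \<rho>_fsmul rk(1)[OF bH] u0(1))
  have \<psi>_comp: "\<psi> (f a) = \<rho> f (\<psi> a)" if "a \<in> H \<omega>" "f \<in> EndC n k" for a f
    unfolding \<psi>_def rk_comp[OF bH that] using that by (intro \<rho>_comp rk(1)[OF bH] u0(1))
  have \<psi>0: "\<psi> 0 = 0" using \<psi>_smul[of 0 0] H_closed(1) by simp
  have irrH: "W = {0} \<or> W = H \<omega>" if "is_Csubmod n k (H \<omega>) (\<lambda>f u. f u) W" for W
    using H_irreducible[of \<omega>] bH that unfolding irreducible_Cmod_def by blast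
  have \<psi>b: "\<psi> b \<noteq> 0" using b by (simp add: \<psi>_def)
  have "is_Csubmod n k (H \<omega>) (\<lambda>f u. f u) {a \<in> H \<omega>. \<psi> a = 0}"
    unfolding is_Csubmod_def is_subspace_def
  proof (intro conjI ballI allI)
    fix f a assume f: "f \<in> EndC n k" and a: "a \<in> {a \<in> H \<omega>. \<psi> a = 0}"
    have "\<rho> f 0 = 0" using \<rho>_smul[OF f, of 0 0] is_subspaceD(1)[OF sub] by simp
    then show "f a \<in> {a \<in> H \<omega>. \<psi> a = 0}" using a f \<psi>_comp by (simp add: EndC_H)
  qed (auto simp: H_closed \<psi>0 \<psi>_add \<psi>_smul)
  from irrH[OF this] have ker: "{a \<in> H \<omega>. \<psi> a = 0} = {0}" using \<psi>b bH by auto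
  have inj: "inj_on \<psi> (H \<omega>)"
  proof (rule inj_onI)
    fix a a' assume a: "a \<in> H \<omega>" "a' \<in> H \<omega>" "\<psi> a = \<psi> a'"
    have "\<psi> (a - a') = 0"
      using a by (simp add: diff_eq_add_smul \<psi>_add \<psi>_smul H_closed) (simp add: fun_eq_iff fun_simps smul_apply)
    then have "a - a' \<in> {a \<in> H \<omega>. \<psi> a = 0}" using a H_closed by simp
    then show "a = a'" unfolding ker by simp
  qed
  have "is_Csubmod n k N \<rho> (\<psi> ` H \<omega>)"
    unfolding is_Csubmod_def is_subspace_def
  proof (intro conjI ballI allI)
    show "\<psi> ` H \<omega> \<subseteq> N" using \<psi>_in by blast
    show "0 \<in> \<psi> ` H \<omega>" using \<psi>0 H_closed(1) by (metis image_eqI)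
    fix u assume "u \<in> \<psi> ` H \<omega>"
    then obtain a where a: "a \<in> H \<omega>" "u = \<psi> a" by blast
    show "smul c u \<in> \<psi> ` H \<omega>" for c using a \<psi>_smul H_closed(3) by (metis image_eqI)
    show "\<rho> f u \<in> \<psi> ` H \<omega>" if "f \<in> EndC n k" for f using a \<psi>_comp that EndC_H by (metis image_eqI)
    fix v assume "v \<in> \<psi> ` H \<omega>"
    then obtain a' where "a' \<in> H \<omega>" "v = \<psi> a'" by blast
    then show "u + v \<in> \<psi> ` H \<omega>" using a \<psi>_add H_closed(2) by (metis image_eqI)
  qed
  from irr[OF this] have img: "\<psi> ` H \<omega> = N" using \<psi>b bH by blast
  have bij: "bij_betw \<psi> (H \<omega>) N" using inj img by (simp add: bij_betw_def)
  define \<phi> where "\<phi> = the_inv_into (H \<omega>) \<psi>"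
  have \<phi>\<psi>: "\<phi> (\<psi> a) = a" if "a \<in> H \<omega>" for a
    using that inj by (simp add: \<phi>_def the_inv_into_f_f)
  have "Cmod_iso n k N \<rho> (H \<omega>) (\<lambda>f u. f u)"
    unfolding Cmod_iso_def
  proof (intro exI[of _ \<phi>] conjI ballI allI)
    show "bij_betw \<phi> N (H \<omega>)" unfolding \<phi>_def by (rule bij_betw_the_inv_into[OF bij])
    fix u assume "u \<in> N"
    then obtain a where a: "a \<in> H \<omega>" "u = \<psi> a" using img by blast
    show "\<phi> (smul c u) = smul c (\<phi> u)" for c
      using a \<phi>\<psi> \<psi>_smul H_closed(3) by metis
    show "\<phi> (\<rho> f u) = f (\<phi> u)" if "f \<in> EndC n k" for f
      using a \<phi>\<psi> \<psi>_comp that EndC_H by metis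
    fix v assume "v \<in> N"
    then obtain a' where "a' \<in> H \<omega>" "v = \<psi> a'" using img by blast
    then show "\<phi> (u + v) = \<phi> u + \<phi> v" using a \<phi>\<psi> \<psi>_add H_closed(2) by metis
  qed
  moreover have "H \<omega> \<noteq> {0}" using bH by blast
  ultimately show ?thesis by blast
qed

end

section \<open>Lattice words and the Young symmetrizer\<close>

definition part :: "nat list \<Rightarrow> nat \<Rightarrow> nat" where
  "part lam i = (if 1 \<le> i \<and> i \<le> length lam then lam ! (i - 1) else 0)"

definition cnt :: "nat set \<Rightarrow> (nat \<Rightarrow> nat) \<Rightarrow> nat \<Rightarrow> nat" where
  "cnt P \<alpha> i = card {p \<in> P. \<alpha> p = i}"

text \<open>The coefficient at \<open>\<alpha>\<close> of a matrix unit applied to \<open>g\<close>,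
  all places in \<open>P\<close> being of natural type.\<close>

definition raised :: "nat set \<Rightarrow> ((nat \<Rightarrow> nat) \<Rightarrow> complex) \<Rightarrow> nat \<Rightarrow> nat \<Rightarrow> (nat \<Rightarrow> nat) \<Rightarrow> complex" where
  "raised P g i j \<alpha> = (\<Sum>p\<in>P. if \<alpha> p = i then g (\<alpha>(p := j)) else 0)"

text \<open>Maximal vectors of weight \<open>lam\<close> in a tensor power of the natural module, as
  functions on words. Words are total functions over an unbounded alphabet, so no membership
  conditions have to be carried along; the last clause makes \<open>g\<close> a function of the
  letters on \<open>P\<close>.\<close>

definition hw_word :: "nat list \<Rightarrow> nat set \<Rightarrow> ((nat \<Rightarrow> nat) \<Rightarrow> complex) \<Rightarrow> bool" where
  "hw_word lam P g \<longleftrightarrow> (\<forall>\<alpha> i j. 1 \<le> i \<and> i < j \<longrightarrow> raised P g i j \<alpha> = 0)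
     \<and> (\<forall>\<alpha>. g \<alpha> \<noteq> 0 \<longrightarrow> (\<forall>i. cnt P \<alpha> i = part lam i))
     \<and> (\<forall>\<alpha> \<beta>. (\<forall>p\<in>P. \<alpha> p = \<beta> p) \<longrightarrow> g \<alpha> = g \<beta>)"

lemma hw_wordD:
  assumes "hw_word lam P g"
  shows "1 \<le> i \<Longrightarrow> i < j \<Longrightarrow> (\<Sum>p\<in>P. if \<alpha> p = i then g (\<alpha>(p := j)) else 0) = 0"
    "g \<alpha> \<noteq> 0 \<Longrightarrow> cnt P \<alpha> i = part lam i"
    "(\<And>p. p \<in> P \<Longrightarrow> \<alpha> p = \<beta> p) \<Longrightarrow> g \<alpha> = g \<beta>"
proof -
  show "1 \<le> i \<Longrightarrow> i < j \<Longrightarrow> (\<Sum>p\<in>P. if \<alpha> p = i then g (\<alpha>(p := j)) else 0) = 0"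
    using assms unfolding hw_word_def raised_def by (elim conjE) simp
  show "g \<alpha> \<noteq> 0 \<Longrightarrow> cnt P \<alpha> i = part lam i"
    using assms unfolding hw_word_def by simp
  show "(\<And>p. p \<in> P \<Longrightarrow> \<alpha> p = \<beta> p) \<Longrightarrow> g \<alpha> = g \<beta>"
    using assms unfolding hw_word_def by simp
qed

lemma hw_word_letter:
  assumes "hw_word lam P g" "finite P" "g \<alpha> \<noteq> 0" "p \<in> P"
  shows "1 \<le> \<alpha> p \<and> \<alpha> p \<le> length lam"
proof -
  have "cnt P \<alpha> (\<alpha> p) \<noteq> 0" using assms(2,4) by (auto simp: cnt_def)
  then have "part lam (\<alpha> p) \<noteq> 0" using hw_wordD(2)[OF assms(1,3)] by metis
  then show ?thesis by (simp add: part_def split: if_splits)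
qed

lemma sum_nz: "(\<Sum>x\<in>A. f x) \<noteq> (0::complex) \<Longrightarrow> \<exists>x\<in>A. f x \<noteq> 0"
  by (metis sum.neutral)

lemma hw_word_sum:
  assumes "\<And>x. x \<in> X \<Longrightarrow> hw_word lam P (g x)"
  shows "hw_word lam P (\<lambda>\<alpha>. \<Sum>x\<in>X. g x \<alpha>)"
  unfolding hw_word_def raised_def
proof (intro conjI allI impI)
  fix \<alpha> :: "nat \<Rightarrow> nat" and i j :: nat assume ij: "1 \<le> i \<and> i < j"
  have "(\<Sum>p\<in>P. if \<alpha> p = i then \<Sum>x\<in>X. g x (\<alpha>(p := j)) else 0)
    = (\<Sum>p\<in>P. \<Sum>x\<in>X. if \<alpha> p = i then g x (\<alpha>(p := j)) else 0)" by (intro sum.cong) auto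
  also have "\<dots> = (\<Sum>x\<in>X. \<Sum>p\<in>P. if \<alpha> p = i then g x (\<alpha>(p := j)) else 0)" by (rule sum.swap)
  also have "\<dots> = 0" by (intro sum.neutral ballI hw_wordD(1)[OF assms]) (use ij in auto)
  finally show "(\<Sum>p\<in>P. if \<alpha> p = i then \<Sum>x\<in>X. g x (\<alpha>(p := j)) else 0) = 0" .
next
  fix \<alpha> i assume "(\<Sum>x\<in>X. g x \<alpha>) \<noteq> 0"
  then obtain x where "x \<in> X" "g x \<alpha> \<noteq> 0" by (blast dest: sum_nz)
  then show "cnt P \<alpha> i = part lam i" using hw_wordD(2)[OF assms] by blast
next
  fix \<alpha> \<beta> :: "nat \<Rightarrow> nat" assume "\<forall>p\<in>P. \<alpha> p = \<beta> p"
  then show "(\<Sum>x\<in>X. g x \<alpha>) = (\<Sum>x\<in>X. g x \<beta>)"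
    by (intro sum.cong refl hw_wordD(3)[OF assms]) auto
qed

lemma hw_word_scale:
  assumes "hw_word lam P g"
  shows "hw_word lam P (\<lambda>\<alpha>. c * g \<alpha>)"
  unfolding hw_word_def raised_def
proof (intro conjI allI impI)
  fix \<alpha> :: "nat \<Rightarrow> nat" and i j :: nat assume ij: "1 \<le> i \<and> i < j"
  have "(\<Sum>p\<in>P. if \<alpha> p = i then c * g (\<alpha>(p := j)) else 0)
    = c * (\<Sum>p\<in>P. if \<alpha> p = i then g (\<alpha>(p := j)) else 0)"
    unfolding sum_distrib_left by (intro sum.cong) auto
  then show "(\<Sum>p\<in>P. if \<alpha> p = i then c * g (\<alpha>(p := j)) else 0) = 0"
    using hw_wordD(1)[OF assms, of i j \<alpha>] ij by simp
next
  fix \<alpha> i assume "c * g \<alpha> \<noteq> 0"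
  then show "cnt P \<alpha> i = part lam i" using hw_wordD(2)[OF assms] by simp
next
  fix \<alpha> \<beta> :: "nat \<Rightarrow> nat" assume "\<forall>p\<in>P. \<alpha> p = \<beta> p"
  then show "c * g \<alpha> = c * g \<beta>" using hw_wordD(3)[OF assms, of \<alpha> \<beta>] by simp
qed

lemma hw_word_add:
  assumes "hw_word lam P g" "hw_word lam P h"
  shows "hw_word lam P (\<lambda>\<alpha>. g \<alpha> + h \<alpha>)"
  using hw_word_sum[of "{True, False}" lam P "\<lambda>x. if x then g else h"] assms by simp

lemma cnt_permute:
  assumes "\<rho> permutes P"
  shows "cnt P (\<alpha> \<circ> \<rho>) i = cnt P \<alpha> i"
proof -
  have "{p \<in> P. \<alpha> p = i} = \<rho> ` {p \<in> P. (\<alpha> \<circ> \<rho>) p = i}"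
  proof (intro equalityI subsetI)
    fix p assume "p \<in> {p \<in> P. \<alpha> p = i}"
    then show "p \<in> \<rho> ` {p \<in> P. (\<alpha> \<circ> \<rho>) p = i}"
      using assms by (intro image_eqI[of _ _ "inv \<rho> p"])
        (simp_all add: permutes_inverses permutes_in_image permutes_inv)
  qed (use assms in \<open>auto simp: permutes_in_image\<close>)
  moreover have "inj_on \<rho> A" for A using permutes_inj[OF assms] inj_on_subset by blast
  ultimately show ?thesis by (simp add: cnt_def card_image)
qed

lemma hw_word_permute:
  assumes "hw_word lam P g" "\<rho> permutes P"
  shows "hw_word lam P (\<lambda>\<alpha>. g (\<alpha> \<circ> \<rho>))"
  unfolding hw_word_def raised_def
proof (intro conjI allI impI)
  fix \<alpha> :: "nat \<Rightarrow> nat" and i j :: nat assume ij: "1 \<le> i \<and> i < j"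
  have upd: "(\<alpha>(\<rho> p := j)) \<circ> \<rho> = (\<alpha> \<circ> \<rho>)(p := j)" for p
    using permutes_inj[OF assms(2)] by (auto simp: fun_eq_iff inj_eq)
  have "(\<Sum>p\<in>P. if \<alpha> p = i then g (\<alpha>(p := j) \<circ> \<rho>) else 0)
    = (\<Sum>p\<in>P. if (\<alpha> \<circ> \<rho>) p = i then g ((\<alpha> \<circ> \<rho>)(p := j)) else 0)"
    by (rule sum.reindex_bij_betw[OF permutes_imp_bij[OF assms(2)], symmetric, THEN trans])
      (simp only: upd comp_apply)
  then show "(\<Sum>p\<in>P. if \<alpha> p = i then g (\<alpha>(p := j) \<circ> \<rho>) else 0) = 0"
    using hw_wordD(1)[OF assms(1), of i j "\<alpha> \<circ> \<rho>"] ij by simp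
next
  fix \<alpha> i assume "g (\<alpha> \<circ> \<rho>) \<noteq> 0"
  then have "cnt P (\<alpha> \<circ> \<rho>) i = part lam i" by (rule hw_wordD(2)[OF assms(1)])
  then show "cnt P \<alpha> i = part lam i" using cnt_permute[OF assms(2)] by simp
next
  fix \<alpha> \<beta> :: "nat \<Rightarrow> nat" assume "\<forall>p\<in>P. \<alpha> p = \<beta> p"
  then show "g (\<alpha> \<circ> \<rho>) = g (\<beta> \<circ> \<rho>)"
    by (intro hw_wordD(3)[OF assms(1)]) (use assms(2) in \<open>auto simp: permutes_in_image\<close>)
qed

text \<open>The word is chosen greedily: the largest possible letter at the last place, then at the
  place before it, and so on.\<close>

lemma exists_revlex_max:
  fixes X :: "(nat \<Rightarrow> nat) set"
  assumes "finite P" "X \<noteq> {}" "\<And>p \<beta>. p \<in> P \<Longrightarrow> \<beta> \<in> X \<Longrightarrow> \<beta> p \<le> N"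
  shows "\<exists>\<alpha>\<in>X. \<forall>\<beta>\<in>X. \<forall>p\<in>P. (\<forall>q\<in>P. p < q \<longrightarrow> \<beta> q = \<alpha> q) \<longrightarrow> \<beta> p \<le> \<alpha> p"
  using assms
proof (induction P arbitrary: X rule: finite_linorder_max_induct)
  case empty
  then show ?case by auto
next
  case (insert b A)
  obtain \<alpha>0 where \<alpha>0: "\<alpha>0 \<in> X" "\<And>\<beta>. \<beta> \<in> X \<Longrightarrow> \<beta> b \<le> \<alpha>0 b"
  proof -
    obtain \<beta>0 where "\<beta>0 \<in> X" using insert.prems(1) by blast
    then have "\<exists>\<alpha>. \<alpha> \<in> X \<and> (\<forall>\<beta>. \<beta> \<in> X \<longrightarrow> \<beta> b \<le> \<alpha> b)"
      using insert.prems(2)[of b]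
      by (intro ex_has_greatest_nat[of "\<lambda>\<alpha>. \<alpha> \<in> X" \<beta>0 "\<lambda>\<alpha>. \<alpha> b" "Suc N"]) (auto simp: le_imp_less_Suc)
    then show ?thesis using that by blast
  qed
  define X' where "X' = {\<beta> \<in> X. \<beta> b = \<alpha>0 b}"
  have "X' \<noteq> {}" using \<alpha>0 by (auto simp: X'_def)
  then have "\<exists>\<alpha>\<in>X'. \<forall>\<beta>\<in>X'. \<forall>p\<in>A. (\<forall>q\<in>A. p < q \<longrightarrow> \<beta> q = \<alpha> q) \<longrightarrow> \<beta> p \<le> \<alpha> p"
    by (rule insert.IH) (simp add: X'_def insert.prems(2))
  then obtain \<alpha> where \<alpha>: "\<alpha> \<in> X'" "\<forall>\<beta>\<in>X'. \<forall>p\<in>A. (\<forall>q\<in>A. p < q \<longrightarrow> \<beta> q = \<alpha> q) \<longrightarrow> \<beta> p \<le> \<alpha> p"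
    by (elim bexE)
  have "\<beta> p \<le> \<alpha> p" if \<beta>: "\<beta> \<in> X" "p \<in> insert b A" "\<forall>q\<in>insert b A. p < q \<longrightarrow> \<beta> q = \<alpha> q" for \<beta> p
  proof (cases "p = b")
    case True
    then show ?thesis using \<alpha>0(2)[OF \<beta>(1)] \<alpha>(1) by (simp add: X'_def)
  next
    case False
    then have "p \<in> A" "p < b" using \<beta> insert.hyps by auto
    then have "\<beta> \<in> X'" using \<beta> \<alpha>(1) by (simp add: X'_def)
    then show ?thesis using bspec[OF bspec[OF \<alpha>(2)] \<open>p \<in> A\<close>] \<beta>(3) by simp
  qed
  moreover have "\<alpha> \<in> X" using \<alpha>(1) by (simp add: X'_def)
  ultimately show ?case by (intro bexI[of _ \<alpha>]) auto
qed

text \<open>Dominance is transferred from \<open>maxvec_dominant\<close> by truncating the alphabet.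
  The content \<open>\<omega>\<close> is an arbitrary integer function, since freezing letters
  leaves functions whose weight is not known beforehand to be a partition.\<close>

lemma word_dominant:
  assumes "finite P" "\<And>\<alpha> i j. 1 \<le> i \<Longrightarrow> i < j \<Longrightarrow> raised P h i j \<alpha> = 0"
    "\<And>\<alpha> i. h \<alpha> \<noteq> 0 \<Longrightarrow> int (cnt P \<alpha> i) = \<omega> i"
    "\<And>\<alpha> p. h \<alpha> \<noteq> 0 \<Longrightarrow> p \<in> P \<Longrightarrow> 1 \<le> \<alpha> p \<and> \<alpha> p \<le> l"
    "\<And>\<alpha> \<beta>. (\<And>p. p \<in> P \<Longrightarrow> \<alpha> p = \<beta> p) \<Longrightarrow> h \<alpha> = h \<beta>"
    "h \<alpha> \<noteq> 0" "1 \<le> i"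
  shows "\<omega> (Suc i) \<le> \<omega> i"
proof -
  \<comment> \<open>Large enough to contain every letter in the support of \<open>h\<close> and to
    have \<open>i < n\<close>.\<close>
  define n where "n = l + Suc i"
  interpret tensor_module n P "{}" by unfold_locales (use assms(1) in auto)
  define u where "u z = (if z \<in> tidx n P {} then h (fst z) else 0)" for z
  have uZ: "u \<in> fsupp (tidx n P {})" by (simp add: fsupp_def u_def)
  have tidx0: "(a, b) \<in> tidx n P {} \<longleftrightarrow> a \<in> PiE P (\<lambda>_. {1..n}) \<and> b = (\<lambda>_. undefined)" for a b
    by (simp add: tidx_def)
  have "lact P {} i' j u = 0" if ij: "i' \<in> {1..n}" "j \<in> {1..n}" "i' < j" for i' j
  proof (rule ext, clarify)
    fix a b
    have sup: "lact P {} i' j u \<in> fsupp (tidx n P {})" by (rule E_supp[OF ij(1,2) uZ])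
    show "lact P {} i' j u (a, b) = 0 (a, b)"
    proof (cases "(a, b) \<in> tidx n P {}")
      case True
      then have inP: "(a(p := j), b) \<in> tidx n P {}" if "p \<in> P" for p
        using that ij(2) unfolding tidx0 by (auto intro: PiE_upd)
      then have "lact P {} i' j u (a, b) = raised P h i' j a"
        unfolding lact_apply[OF assms(1) finite.emptyI] raised_def sum.empty diff_0_right
        by (intro sum.cong refl) (simp add: u_def inP)
      then show ?thesis using assms(2)[of i' j a] ij by (simp add: zero_fun_apply)
    next
      case False
      then show ?thesis using sup unfolding fsupp_def by (simp add: zero_fun_apply)
    qed
  qed
  moreover have "\<forall>j\<in>{1..n}. lact P {} j j u = smul (of_int (\<omega> j)) u"
    unfolding weight_vector_iff
  proof (intro allI impI ballI)
    fix z j assume "u z \<noteq> 0"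
    then have "h (fst z) \<noteq> 0" by (auto simp: u_def split: if_splits)
    then show "complex_of_int (wt P {} z j) = complex_of_int (\<omega> j)"
      using assms(3) by (simp add: wt_def cnt_def)
  qed
  ultimately have max: "maxvec (\<lambda>i. of_int (\<omega> i)) u" using uZ by (simp add: maxvec_def)
  have "restrict \<alpha> P \<in> PiE P (\<lambda>_. {1..n})" using assms(4)[OF assms(6)] by (fastforce simp: n_def)
  then have "u (restrict \<alpha> P, \<lambda>_. undefined) = h \<alpha>"
    using assms(5)[of "restrict \<alpha> P" \<alpha>] by (simp add: u_def tidx0)
  then have "u \<noteq> 0" using assms(6) by (metis zero_fun_apply)
  then show ?thesis using maxvec_dominant[OF max] assms(7) by (simp add: n_def)
qed

section \<open>Standard tableaux and lattice words\<close>

lemma cells_Sigma: "cells lam = (SIGMA i:{1..length lam}. {1..lam ! (i - 1)})"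
  by (auto simp: cells_def)

lemma finite_cells: "finite (cells lam)"
  by (simp add: cells_Sigma)

lemma card_cells: "card (cells lam) = sum_list lam"
proof -
  have "card (cells lam) = (\<Sum>i\<in>{1..length lam}. lam ! (i - 1))"
    by (simp add: cells_Sigma)
  also have "\<dots> = (\<Sum>i\<in>{0..<length lam}. lam ! i)"
    by (rule sum.reindex_bij_witness[of _ Suc "\<lambda>i. i - 1"]) auto
  finally show ?thesis by (simp add: sum_list_sum_nth)
qed

lemma row_col_of:
  assumes "bij_betw T (cells lam) P" "c \<in> cells lam"
  shows "row_of lam T (T c) = fst c" "col_of lam T (T c) = snd c"
proof -
  have "(THE d. d \<in> cells lam \<and> T d = T c) = c"
    using assms by (intro the_equality) (auto simp: bij_betw_def inj_on_def)
  then show "row_of lam T (T c) = fst c" "col_of lam T (T c) = snd c"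
    by (simp_all add: row_of_def col_of_def)
qed

lemma tab_pos:
  assumes "bij_betw T (cells lam) P" "p \<in> P"
  shows "(row_of lam T p, col_of lam T p) \<in> cells lam" "T (row_of lam T p, col_of lam T p) = p"
proof -
  obtain c where "c \<in> cells lam" "p = T c" using assms by (auto simp: bij_betw_def)
  then show "(row_of lam T p, col_of lam T p) \<in> cells lam" "T (row_of lam T p, col_of lam T p) = p"
    using row_col_of[OF assms(1)] by simp_all
qed

lemma cnt_row_of:
  assumes "bij_betw T (cells lam) P"
  shows "cnt P (row_of lam T) i = part lam i"
proof -
  have "{p \<in> P. row_of lam T p = i} = T ` {c \<in> cells lam. fst c = i}"
    using assms tab_pos[OF assms] row_col_of[OF assms] by (force simp: bij_betw_def)
  moreover have "inj_on T {c \<in> cells lam. fst c = i}"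
    using assms by (auto simp: bij_betw_def inj_on_def)
  moreover have "{c \<in> cells lam. fst c = i} = (if 1 \<le> i \<and> i \<le> length lam then {i} \<times> {1..lam ! (i - 1)} else {})"
    by (auto simp: cells_def)
  ultimately show ?thesis by (simp add: cnt_def part_def card_image card_cartesian_product)
qed

text \<open>The classical bijection: the place of the j-th occurrence of the letter \<open>i\<close>
  goes into the cell \<open>(i, j)\<close>. Rows increase by construction. Columns increase because,
  once \<open>i'\<close> has occurred \<open>j\<close> times, the lattice condition gives at least
  \<open>j\<close> occurrences of the smaller letter \<open>i\<close>.\<close>

lemma lattice_word_tableau:
  assumes "finite P" "card P = sum_list lam" "\<And>i. cnt P \<alpha> i = part lam i"
    "\<And>m i. 1 \<le> i \<Longrightarrow> cnt {p \<in> P. p \<le> m} \<alpha> (Suc i) \<le> cnt {p \<in> P. p \<le> m} \<alpha> i"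
  shows "\<exists>T. std_tableau lam P T \<and> (\<forall>p\<in>P. row_of lam T p = \<alpha> p)"
proof -
  have lat: "cnt {p \<in> P. p \<le> m} \<alpha> i' \<le> cnt {p \<in> P. p \<le> m} \<alpha> i" if "1 \<le> i" "i \<le> i'" for m i i'
    using that(2,1)
  proof (induction i' rule: dec_induct)
    case (step j)
    then show ?case using assms(4)[of j m] by simp
  qed simp
  define rank where "rank p = card {q \<in> P. \<alpha> q = \<alpha> p \<and> q \<le> p}" for p
  define R where "R p = (\<alpha> p, rank p)" for p
  have rank_cnt: "rank p = cnt {q \<in> P. q \<le> p} \<alpha> (\<alpha> p)" for p
    unfolding rank_def cnt_def by (rule arg_cong[where f = card]) auto
  have mono: "rank q < rank p" if "p \<in> P" "q \<in> P" "\<alpha> q = \<alpha> p" "q < p" for p q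
  proof -
    have sub: "{r \<in> P. \<alpha> r = \<alpha> q \<and> r \<le> q} \<subseteq> {r \<in> P. \<alpha> r = \<alpha> p \<and> r \<le> p} - {p}" using that by auto
    have "rank q \<le> card ({r \<in> P. \<alpha> r = \<alpha> p \<and> r \<le> p} - {p})"
      unfolding rank_def by (rule card_mono[OF _ sub]) (use assms(1) in simp)
    also have "card ({r \<in> P. \<alpha> r = \<alpha> p \<and> r \<le> p} - {p}) < rank p"
      unfolding rank_def using that assms(1) by (intro card_Diff1_less) auto
    finally show ?thesis .
  qed
  have inj: "inj_on R P"
  proof (rule inj_onI)
    fix p q assume pq: "p \<in> P" "q \<in> P" "R p = R q"
    then have eq: "\<alpha> p = \<alpha> q" "rank p = rank q" by (simp_all add: R_def)
    then have "\<not> q < p" "\<not> p < q"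
      using mono[OF pq(1,2) eq(1)[symmetric]] mono[OF pq(2,1) eq(1)] by linarith+
    then show "p = q" by simp
  qed
  have Rc: "R p \<in> cells lam" if p: "p \<in> P" for p
  proof -
    have "p \<in> {q \<in> P. \<alpha> q = \<alpha> p \<and> q \<le> p}" using p by simp
    then have "rank p \<noteq> 0" unfolding rank_def using assms(1) by (subst card_0_eq) auto
    then have "1 \<le> rank p" by simp
    moreover have "rank p \<le> cnt P \<alpha> (\<alpha> p)"
      unfolding rank_def cnt_def using assms(1) by (intro card_mono) auto
    ultimately have "1 \<le> rank p" "rank p \<le> part lam (\<alpha> p)" using assms(3) by auto
    then show ?thesis by (auto simp: R_def cells_def part_def split: if_splits)
  qed
  have "R ` P = cells lam"
    by (rule card_subset_eq[OF finite_cells]) (use Rc in \<open>auto simp: card_image[OF inj] card_cells assms(2)\<close>)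
  then have bijR: "bij_betw R P (cells lam)" using inj by (simp add: bij_betw_def)
  define T where "T = inv_into P R"
  have bijT: "bij_betw T (cells lam) P" unfolding T_def by (rule bij_betw_inv_into[OF bijR])
  have RT: "T c \<in> P" "R (T c) = c" if "c \<in> cells lam" for c
    using that bijR bijT by (auto simp: T_def bij_betw_def f_inv_into_f)
  have "std_tableau lam P T"
    unfolding std_tableau_def
  proof (intro conjI allI impI bijT; elim conjE)
    fix i j j' assume c: "(i, j) \<in> cells lam" "(i, j') \<in> cells lam" "j < j'"
    show "T (i, j) < T (i, j')"
    proof (rule ccontr)
      assume n: "\<not> T (i, j) < T (i, j')"
      have r: "\<alpha> (T (i, j)) = i" "\<alpha> (T (i, j')) = i" "rank (T (i, j)) = j" "rank (T (i, j')) = j'"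
        using RT(2)[OF c(1)] RT(2)[OF c(2)] by (auto simp: R_def)
      have "T (i, j') \<noteq> T (i, j)" using r(3,4) c(3) by auto
      then have "rank (T (i, j')) < rank (T (i, j))"
        using n r by (intro mono RT(1) c) auto
      then show False using r(3,4) c(3) by simp
    qed
  next
    fix i i' j assume c: "(i, j) \<in> cells lam" "(i', j) \<in> cells lam" "i < i'"
    have r: "\<alpha> (T (i, j)) = i" "\<alpha> (T (i', j)) = i'" "rank (T (i, j)) = j" "rank (T (i', j)) = j"
      using RT(2)[OF c(1)] RT(2)[OF c(2)] by (auto simp: R_def)
    show "T (i, j) < T (i', j)"
    proof (rule ccontr)
      assume n: "\<not> T (i, j) < T (i', j)"
      define p p' where "p = T (i, j)" and "p' = T (i', j)"
      have "p' < p" using n r(1,2) c(3) by (metis p_def p'_def linorder_neqE_nat nat_less_le)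
      \<comment> \<open>Up to \<open>p'\<close> the letter \<open>i'\<close> has occurred
        \<open>j\<close> times, whereas the smaller letter \<open>i\<close> has its
        \<open>j\<close>-th occurrence only at the later place \<open>p\<close>; this contradicts
        the lattice condition.\<close>
      have "j = cnt {q \<in> P. q \<le> p'} \<alpha> i'" using rank_cnt[of p'] r by (simp add: p'_def)
      also have "\<dots> \<le> cnt {q \<in> P. q \<le> p'} \<alpha> i" using c by (intro lat) (auto simp: cells_def)
      also have "\<dots> < cnt {q \<in> P. q \<le> p} \<alpha> i"
      proof -
        define A B where "A = {r \<in> {q \<in> P. q \<le> p'}. \<alpha> r = i}" and "B = {r \<in> {q \<in> P. q \<le> p}. \<alpha> r = i}"
        have "p \<in> B" using RT(1)[OF c(1)] r(1) by (simp add: p_def B_def)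
        moreover have "p \<notin> A" using \<open>p' < p\<close> by (simp add: A_def)
        moreover have "A \<subseteq> B" using \<open>p' < p\<close> by (auto simp: A_def B_def)
        ultimately have "A \<subset> B" by blast
        moreover have "finite B" using assms(1) by (simp add: B_def)
        ultimately have "card A < card B" by (simp add: psubset_card_mono)
        then show ?thesis by (simp only: cnt_def A_def B_def)
      qed
      also have "\<dots> = j" using rank_cnt[of p] r by (simp add: p_def)
      finally show False by simp
    qed
  qed
  moreover have "row_of lam T p = \<alpha> p" if p: "p \<in> P" for p
  proof -
    have "T (R p) = p" using inj p by (simp add: T_def)
    then show ?thesis using row_col_of(1)[OF bijT Rc[OF p]] by (simp add: R_def)
  qed
  ultimately show ?thesis by blast
qed

text \<open>The support of a highest weight function contains a lattice word, namely its largest word in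
  the reverse lexicographic order: by maximality, freezing the letters after position \<open>m\<close> leaves a
  highest weight function of the first letters, whose weight is dominant.\<close>

lemma hw_word_eq_0:
  assumes "finite P" "card P = sum_list lam" "hw_word lam P g"
    "\<And>T. std_tableau lam P T \<Longrightarrow> g (row_of lam T) = 0"
  shows "g \<alpha> = 0"
proof (rule ccontr)
  assume "g \<alpha> \<noteq> 0"
  note D = hw_wordD[OF assms(3)]
  define X where "X = {\<alpha>. g \<alpha> \<noteq> 0}"
  have "X \<noteq> {}" using \<open>g \<alpha> \<noteq> 0\<close> by (auto simp: X_def)
  moreover have "\<beta> p \<le> length lam" if "p \<in> P" "\<beta> \<in> X" for p \<beta>
    using hw_word_letter[OF assms(3,1) _ that(1), of \<beta>] that(2) by (simp add: X_def)
  ultimately have "\<exists>\<tau>\<in>X. \<forall>\<beta>\<in>X. \<forall>p\<in>P. (\<forall>q\<in>P. p < q \<longrightarrow> \<beta> q = \<tau> q) \<longrightarrow> \<beta> p \<le> \<tau> p"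
    by (intro exists_revlex_max[OF assms(1), of X "length lam"])
  then obtain \<tau> where \<tau>X: "\<tau> \<in> X"
    and max': "\<forall>\<beta>\<in>X. \<forall>p\<in>P. (\<forall>q\<in>P. p < q \<longrightarrow> \<beta> q = \<tau> q) \<longrightarrow> \<beta> p \<le> \<tau> p"
    by (elim bexE)
  have max: "\<beta> p \<le> \<tau> p" if "\<beta> \<in> X" "p \<in> P" "\<forall>q\<in>P. p < q \<longrightarrow> \<beta> q = \<tau> q" for \<beta> p
    using bspec[OF bspec[OF max' that(1)] that(2)] that(3) by (rule mp)
  from \<tau>X have g\<tau>: "g \<tau> \<noteq> 0" by (simp add: X_def)
  have lat: "cnt {p \<in> P. p \<le> m} \<tau> (Suc i) \<le> cnt {p \<in> P. p \<le> m} \<tau> i" if "1 \<le> i" for m i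
  proof -
    let ?Q = "{p \<in> P. p \<le> m}"
    \<comment> \<open>Only the letters up to place \<open>m\<close> vary; the later ones are frozen
      to those of the maximal word \<open>\<tau>\<close>.\<close>
    define mix where "mix \<gamma> = (\<lambda>p. if p \<le> m then \<gamma> p else \<tau> p)" for \<gamma> :: "nat \<Rightarrow> nat"
    define h where "h \<gamma> = g (mix \<gamma>)" for \<gamma>
    define \<omega> where "\<omega> i = int (part lam i) - int (cnt {p \<in> P. m < p} \<tau> i)" for i
    have \<omega>: "int (cnt ?Q \<gamma> i) = \<omega> i" if "h \<gamma> \<noteq> 0" for \<gamma> i
    proof -
      have "part lam i = cnt P (mix \<gamma>) i" using D(2)[of "mix \<gamma>" i] that by (simp add: h_def)
      also have "\<dots> = card ({p \<in> ?Q. \<gamma> p = i} \<union> {p \<in> {p \<in> P. m < p}. \<tau> p = i})"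
        unfolding cnt_def by (rule arg_cong[where f = card]) (auto simp: mix_def)
      also have "\<dots> = cnt ?Q \<gamma> i + cnt {p \<in> P. m < p} \<tau> i"
        unfolding cnt_def using assms(1) by (intro card_Un_disjoint) auto
      finally show ?thesis by (simp add: \<omega>_def)
    qed
    have "\<omega> (Suc i) \<le> \<omega> i"
    proof (rule word_dominant[of ?Q h \<omega> "length lam" \<tau> i])
      show "finite ?Q" using assms(1) by simp
      show "int (cnt ?Q \<gamma> i) = \<omega> i" if "h \<gamma> \<noteq> 0" for \<gamma> i using that by (rule \<omega>)
      show "1 \<le> \<gamma> p \<and> \<gamma> p \<le> length lam" if "h \<gamma> \<noteq> 0" "p \<in> ?Q" for \<gamma> p
        using hw_word_letter[OF assms(3,1), of "mix \<gamma>" p] that by (simp add: h_def mix_def)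
      show "h \<beta> = h \<gamma>" if "\<And>p. p \<in> ?Q \<Longrightarrow> \<beta> p = \<gamma> p" for \<beta> \<gamma>
        unfolding h_def by (rule D(3)) (use that in \<open>auto simp: mix_def\<close>)
      show "h \<tau> \<noteq> 0" using g\<tau> by (simp add: h_def mix_def)
      show "1 \<le> i" by fact
      fix \<gamma> i' j assume ij: "1 \<le> i'" "i' < (j::nat)"
      \<comment> \<open>Raising a frozen letter would give a word of the support that agrees with
        \<open>\<tau>\<close> after \<open>p\<close> and is larger at \<open>p\<close>, against
        maximality. So only the places in \<open>?Q\<close> survive in the raising
        condition.\<close>
      have tail: "g ((mix \<gamma>)(p := j)) = 0" if p: "p \<in> P" "m < p" "\<tau> p = i'" for p
      proof (rule ccontr)
        assume "g ((mix \<gamma>)(p := j)) \<noteq> 0"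
        then have "(mix \<gamma>)(p := j) \<in> X" by (simp add: X_def)
        then have "((mix \<gamma>)(p := j)) p \<le> \<tau> p"
          using max[of "(mix \<gamma>)(p := j)" p] p by (simp add: mix_def)
        then show False using p ij by simp
      qed
      have "raised ?Q h i' j \<gamma> = (\<Sum>p\<in>?Q. if (mix \<gamma>) p = i' then g ((mix \<gamma>)(p := j)) else 0)"
        unfolding raised_def h_def
        by (intro sum.cong refl if_cong arg_cong[where f = g]) (auto simp: mix_def)
      also have "\<dots> = (\<Sum>p\<in>P. if (mix \<gamma>) p = i' then g ((mix \<gamma>)(p := j)) else 0)"
      proof (rule sum.mono_neutral_left)
        show "\<forall>p\<in>P - ?Q. (if (mix \<gamma>) p = i' then g ((mix \<gamma>)(p := j)) else 0) = 0"
        proof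
          fix p assume p: "p \<in> P - ?Q"
          then have "mix \<gamma> p = \<tau> p" by (simp add: mix_def)
          then show "(if (mix \<gamma>) p = i' then g ((mix \<gamma>)(p := j)) else 0) = 0"
            using tail[of p] p by (simp add: not_le)
        qed
      qed (use assms(1) in auto)
      also have "\<dots> = 0" using ij by (rule D(1))
      finally show "raised ?Q h i' j \<gamma> = 0" .
    qed
    moreover have "h \<tau> \<noteq> 0" using g\<tau> by (simp add: h_def mix_def)
    ultimately show ?thesis using \<omega>[of \<tau> i] \<omega>[of \<tau> "Suc i"] by linarith
  qed
  have "\<exists>T. std_tableau lam P T \<and> (\<forall>p\<in>P. row_of lam T p = \<tau> p)"
    by (rule lattice_word_tableau[OF assms(1,2) D(2)[OF g\<tau>]]) (rule lat)
  then obtain T where T: "std_tableau lam P T" "\<forall>p\<in>P. row_of lam T p = \<tau> p"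
    by (elim exE conjE)
  have "g \<tau> = g (row_of lam T)" by (rule D(3)) (use T in auto)
  then show False using assms(4)[OF T(1)] g\<tau> by simp
qed

section \<open>Coefficient functions of Young symmetrizers\<close>

locale tableau =
  fixes lam :: "nat list" and P :: "nat set" and T :: "nat \<times> nat \<Rightarrow> nat"
  assumes lam_sorted: "sorted_wrt (\<ge>) lam" and bij: "bij_betw T (cells lam) P"
begin

abbreviation "row \<equiv> row_of lam T"
abbreviation "col \<equiv> col_of lam T"
abbreviation "RT \<equiv> row_perms lam T"
abbreviation "CT \<equiv> col_perms lam T"

lemma TP: "T ` cells lam = P"
  using bij by (simp add: bij_betw_def)

lemma finite_P: "finite P"
  using finite_cells[of lam] TP by (metis finite_imageI)

lemma RT_iff: "\<sigma> \<in> RT \<longleftrightarrow> \<sigma> permutes P \<and> (\<forall>p\<in>P. row (\<sigma> p) = row p)"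
  by (simp add: row_perms_def TP)

lemma CT_iff: "\<sigma> \<in> CT \<longleftrightarrow> \<sigma> permutes P \<and> (\<forall>p\<in>P. col (\<sigma> p) = col p)"
  by (simp add: col_perms_def TP)

lemma finite_RT: "finite RT" and finite_CT: "finite CT"
  by (rule finite_subset[OF _ finite_permutations[OF finite_P]]; auto simp: RT_iff CT_iff)+

lemma id_RT: "id \<in> RT"
  by (simp add: RT_iff permutes_id)

lemma RT_comp: "\<sigma> \<in> RT \<Longrightarrow> \<tau> \<in> RT \<Longrightarrow> \<sigma> \<circ> \<tau> \<in> RT"
  by (auto simp: RT_iff permutes_compose permutes_in_image)

lemma CT_comp: "\<sigma> \<in> CT \<Longrightarrow> \<tau> \<in> CT \<Longrightarrow> \<sigma> \<circ> \<tau> \<in> CT"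
  by (auto simp: CT_iff permutes_compose permutes_in_image)

lemma RT_inv:
  assumes "\<sigma> \<in> RT"
  shows "inv \<sigma> \<in> RT"
proof -
  have s: "\<sigma> permutes P" using assms by (simp add: RT_iff)
  have "row (inv \<sigma> p) = row p" if "p \<in> P" for p
  proof -
    have "inv \<sigma> p \<in> P" using that permutes_in_image[OF permutes_inv[OF s]] by simp
    then have "row (\<sigma> (inv \<sigma> p)) = row (inv \<sigma> p)" using assms by (simp add: RT_iff)
    then show ?thesis using permutes_inverses(1)[OF s] by simp
  qed
  then show ?thesis using permutes_inv[OF s] by (simp add: RT_iff)
qed

lemma RT_comp_bij:
  assumes "\<rho>' \<in> RT"
  shows "bij_betw (\<lambda>\<rho>. \<rho>' \<circ> \<rho>) RT RT"
proof (rule bij_betw_byWitness[where f' = "\<lambda>\<rho>. inv \<rho>' \<circ> \<rho>"])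
  have p: "\<rho>' permutes P" using assms by (simp add: RT_iff)
  show "\<forall>\<rho>\<in>RT. inv \<rho>' \<circ> (\<rho>' \<circ> \<rho>) = \<rho>" "\<forall>\<rho>\<in>RT. \<rho>' \<circ> (inv \<rho>' \<circ> \<rho>) = \<rho>"
    using permutes_inverses[OF p] by (auto simp: fun_eq_iff)
  show "(\<lambda>\<rho>. \<rho>' \<circ> \<rho>) ` RT \<subseteq> RT" "(\<lambda>\<rho>. inv \<rho>' \<circ> \<rho>) ` RT \<subseteq> RT"
    using RT_comp assms RT_inv by blast+
qed

lemma row_RT: "\<rho> \<in> RT \<Longrightarrow> p \<in> P \<Longrightarrow> (row \<circ> \<rho>) p = row p"
  by (simp add: RT_iff)

lemma pos_unique: "p \<in> P \<Longrightarrow> q \<in> P \<Longrightarrow> row p = row q \<Longrightarrow> col p = col q \<Longrightarrow> p = q"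
  using tab_pos(2)[OF bij] by metis

lemma cnt_row: "cnt P row i = part lam i"
  by (rule cnt_row_of[OF bij])

text \<open>Inside a row the letters of an invariant function can be permuted freely, so raising a letter
  \<open>j > i\<close> of row \<open>i\<close> to \<open>i\<close> expresses a value through words with more letters \<open>i\<close> in row \<open>i\<close>.\<close>

lemma row_invariant_eq_0:
  assumes hw: "hw_word lam P f" and inv: "\<And>\<rho> \<alpha>. \<rho> \<in> RT \<Longrightarrow> f (\<alpha> \<circ> \<rho>) = f \<alpha>"
    and f0: "f row = 0"
  shows "f \<alpha> = 0"
proof -
  note D = hw_wordD[OF hw]
  \<comment> \<open>The outer induction runs downwards on \<open>i\<close>: the rows before
    \<open>i\<close> already carry their row number. The inner one is on the number of places of row
    \<open>i\<close> with a different letter.\<close>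
  have main: "f \<alpha> = 0" if "i \<le> Suc (length lam)" "\<forall>p\<in>P. row p < i \<longrightarrow> \<alpha> p = row p" for i \<alpha>
    using that
  proof (induction i arbitrary: \<alpha> rule: inc_induct)
    case base
    have "f \<alpha> = f row"
    proof (rule D(3))
      fix p assume p: "p \<in> P"
      have "row p \<le> length lam" using tab_pos(1)[OF bij p] by (simp add: cells_def)
      then show "\<alpha> p = row p" using base p by simp
    qed
    then show ?case using f0 by simp
  next
    case (step i)
    have "f \<alpha> = 0" if "card {p \<in> P. row p = i \<and> \<alpha> p \<noteq> i} = w" "\<forall>p\<in>P. row p < i \<longrightarrow> \<alpha> p = row p" for w \<alpha>
      using that
    proof (induction w arbitrary: \<alpha> rule: less_induct)
      case (less w)
      show ?case
      proof (cases "{p \<in> P. row p = i \<and> \<alpha> p \<noteq> i} = {}")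
        case True
        have "\<forall>p\<in>P. row p < Suc i \<longrightarrow> \<alpha> p = row p"
        proof (intro ballI impI)
          fix p assume p: "p \<in> P" "row p < Suc i"
          show "\<alpha> p = row p"
          proof (cases "row p = i")
            case T: True
            then show ?thesis using True p by auto
          next
            case False
            then show ?thesis using less.prems(2) p by simp
          qed
        qed
        then show ?thesis by (rule step.IH)
      next
        case False
        then obtain p where p: "p \<in> P" "row p = i" "\<alpha> p \<noteq> i" by blast
        have i1: "1 \<le> i" using tab_pos(1)[OF bij p(1)] p(2) by (simp add: cells_def)
        show ?thesis
        proof (rule ccontr)
          assume fa: "f \<alpha> \<noteq> 0"
          define j where "j = \<alpha> p"
          \<comment> \<open>A letter \<open>j < i\<close> at a place outside row \<open>j\<close>
            would be one too many, since row \<open>j\<close> already holds all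
            \<open>part lam j\<close> copies of it.\<close>
          have "i < j"
          proof (rule ccontr)
            assume "\<not> i < j"
            then have ji: "j < i" using p(3) by (simp add: j_def)
            have "insert p {q \<in> P. row q = j} \<subseteq> {q \<in> P. \<alpha> q = j}"
            proof
              fix q assume q: "q \<in> insert p {q \<in> P. row q = j}"
              show "q \<in> {q \<in> P. \<alpha> q = j}"
              proof (cases "q = p")
                case True
                then show ?thesis using p(1) by (simp add: j_def)
              next
                case False
                then have "q \<in> P" "row q = j" using q by auto
                then show ?thesis using less.prems(2) ji by simp
              qed
            qed
            then have "card (insert p {q \<in> P. row q = j}) \<le> cnt P \<alpha> j"
              unfolding cnt_def using finite_P by (intro card_mono) auto
            moreover have "card (insert p {q \<in> P. row q = j}) = Suc (cnt P row j)"
              unfolding cnt_def using finite_P p(2) ji by (subst card_insert_disjoint) auto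
            ultimately show False using D(2)[OF fa, of j] cnt_row[of j] by simp
          qed
          define \<beta> where "\<beta> = \<alpha>(p := i)"
          \<comment> \<open>The raising condition at \<open>\<beta>\<close> is solved for
            \<open>f \<alpha>\<close>. A place of row \<open>i\<close> with letter \<open>i\<close>
            gives \<open>f \<alpha>\<close> by a transposition within the row; earlier rows carry no
            letter \<open>i\<close>; a later row gives a word with fewer wrong letters in row
            \<open>i\<close>, where \<open>f\<close> vanishes by induction.\<close>
          have trm: "(if \<beta> q = i then f (\<beta>(q := j)) else 0) = (if \<beta> q = i \<and> row q = i then f \<alpha> else 0)"
            if q: "q \<in> P" for q
          proof (cases "\<beta> q = i")
            case True
            consider "row q = i" | "row q < i" | "row q > i" by linarith
            then show ?thesis
            proof cases
              case 1
              have tr: "transpose p q \<in> RT"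
                using p q 1 by (auto simp: RT_iff permutes_swap_id transpose_def)
              have "\<beta>(q := j) = \<alpha> \<circ> transpose p q"
                using True by (auto simp: fun_eq_iff \<beta>_def j_def transpose_def)
              then show ?thesis using inv[OF tr, of \<alpha>] True 1 by simp
            next
              case 2
              then have "q \<noteq> p" using p by auto
              then have "\<beta> q = row q" using less.prems(2) q 2 by (simp add: \<beta>_def)
              then show ?thesis using True 2 by simp
            next
              case 3
              have "{x \<in> P. row x = i \<and> (\<beta>(q := j)) x \<noteq> i} \<subset> {x \<in> P. row x = i \<and> \<alpha> x \<noteq> i}"
              proof (rule psubsetI)
                show "{x \<in> P. row x = i \<and> (\<beta>(q := j)) x \<noteq> i} \<subseteq> {x \<in> P. row x = i \<and> \<alpha> x \<noteq> i}"
                  using 3 by (auto simp: \<beta>_def)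
                have "p \<in> {x \<in> P. row x = i \<and> \<alpha> x \<noteq> i}" "p \<notin> {x \<in> P. row x = i \<and> (\<beta>(q := j)) x \<noteq> i}"
                  using p 3 by (auto simp: \<beta>_def)
                then show "{x \<in> P. row x = i \<and> (\<beta>(q := j)) x \<noteq> i} \<noteq> {x \<in> P. row x = i \<and> \<alpha> x \<noteq> i}"
                  by metis
              qed
              then have "card {x \<in> P. row x = i \<and> (\<beta>(q := j)) x \<noteq> i} < w"
                unfolding less.prems(1)[symmetric] using finite_P by (intro psubset_card_mono) auto
              moreover have "\<forall>x\<in>P. row x < i \<longrightarrow> (\<beta>(q := j)) x = row x"
                using less.prems(2) 3 p(2) by (auto simp: \<beta>_def)
              ultimately have "f (\<beta>(q := j)) = 0" using less.IH by blast
              then show ?thesis using 3 by simp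
            qed
          qed simp
          have "0 = (\<Sum>q\<in>P. if \<beta> q = i then f (\<beta>(q := j)) else 0)"
            using D(1)[OF i1 \<open>i < j\<close>, of \<beta>] by simp
          also have "\<dots> = (\<Sum>q\<in>P. if \<beta> q = i \<and> row q = i then f \<alpha> else 0)"
            by (intro sum.cong refl trm)
          also have "\<dots> = of_nat (card {q \<in> P. \<beta> q = i \<and> row q = i}) * f \<alpha>"
            using finite_P by (simp flip: sum.inter_filter)
          finally have "card {q \<in> P. \<beta> q = i \<and> row q = i} = 0" using fa by simp
          moreover have "p \<in> {q \<in> P. \<beta> q = i \<and> row q = i}" using p by (simp add: \<beta>_def)
          ultimately show False using finite_P by (auto simp: card_eq_0_iff)
        qed
      qed
    qed
    then show ?case using step.prems by blast
  qed
  show ?thesis by (rule main[of 0]) auto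
qed

text \<open>The coefficient function of the row word after antisymmetrisation over the columns;
  \<open>fT\<close> also symmetrises over the rows and so belongs to the full Young symmetrizer, see
  \<open>fT_expand\<close>. Both are integer valued, so conjugation drops out of the form.\<close>

definition eT :: "(nat \<Rightarrow> nat) \<Rightarrow> int" where
  "eT \<alpha> = (\<Sum>\<gamma>\<in>CT. if \<forall>p\<in>P. (\<alpha> \<circ> \<gamma>) p = row p then sign \<gamma> else 0)"

definition fT :: "(nat \<Rightarrow> nat) \<Rightarrow> int" where
  "fT \<alpha> = (\<Sum>\<rho>\<in>RT. eT (\<alpha> \<circ> \<rho>))"

text \<open>Composition with the transposition of \<open>p\<close> and \<open>q\<close> preserves
  the condition and flips the sign, so the sum equals its own negative.\<close>

lemma column_antisym_0:
  assumes "p \<in> P" "q \<in> P" "p \<noteq> q" "col p = col q" "\<beta> p = \<beta> q"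
  shows "(\<Sum>\<gamma>\<in>CT. if \<forall>x\<in>P. (\<alpha> \<circ> \<gamma>) x = \<beta> x then sign \<gamma> else 0) = (0::int)" (is "?S = 0")
proof -
  let ?t = "transpose p q"
  have t: "?t \<in> CT" using assms by (auto simp: CT_iff permutes_swap_id transpose_def)
  have tP: "?t permutes P" using t by (simp add: CT_iff)
  have "(\<forall>x\<in>P. (\<alpha> \<circ> (\<gamma> \<circ> ?t)) x = \<beta> x) \<longleftrightarrow> (\<forall>x\<in>P. (\<alpha> \<circ> \<gamma>) x = \<beta> x)" for \<gamma>
  proof -
    have \<beta>t: "\<beta> (?t x) = \<beta> x" for x using assms(5) by (auto simp: transpose_def)
    have "(\<forall>x\<in>P. (\<alpha> \<circ> \<gamma>) x = \<beta> x) \<longleftrightarrow> (\<forall>x\<in>?t ` P. (\<alpha> \<circ> \<gamma>) x = \<beta> x)"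
      using permutes_image[OF tP] by simp
    then show ?thesis using \<beta>t by simp
  qed
  moreover have "sign (\<gamma> \<circ> ?t) = - sign \<gamma>" if "\<gamma> \<in> CT" for \<gamma>
  proof -
    have "permutation \<gamma>" using that finite_P by (auto simp: CT_iff permutation_permutes)
    then show ?thesis using assms(3) by (simp add: sign_compose permutation_swap_id sign_swap_id)
  qed
  moreover have "bij_betw (\<lambda>\<gamma>. \<gamma> \<circ> ?t) CT CT"
    by (rule bij_betw_byWitness[where f' = "\<lambda>\<gamma>. \<gamma> \<circ> ?t"]) (use CT_comp t in \<open>auto simp: comp_assoc\<close>)
  then have "?S = (\<Sum>\<gamma>\<in>CT. if \<forall>x\<in>P. (\<alpha> \<circ> (\<gamma> \<circ> ?t)) x = \<beta> x then sign (\<gamma> \<circ> ?t) else 0)"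
    by (rule sum.reindex_bij_betw[symmetric])
  ultimately have "?S = (\<Sum>\<gamma>\<in>CT. - (if \<forall>x\<in>P. (\<alpha> \<circ> \<gamma>) x = \<beta> x then sign \<gamma> else 0))"
    by (simp cong: sum.cong if_cong) (auto intro!: sum.cong)
  then have "?S = - ?S" by (simp add: sum_negf)
  then show ?thesis by simp
qed

lemma part_decreasing: "1 \<le> i \<Longrightarrow> i \<le> j \<Longrightarrow> j \<le> length lam \<Longrightarrow> lam ! (j - 1) \<le> lam ! (i - 1)"
  using sorted_wrt_nth_less[OF lam_sorted, of "i - 1" "j - 1"] by (cases "i = j") auto

text \<open>Raising turns the row word into one where a cell of row \<open>j\<close> carries the
  letter \<open>i\<close>. The cell of row \<open>i\<close> in the same column exists because the
  shape is a partition, and it carries \<open>i\<close> too; antisymmetrisation over that column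
  gives zero.\<close>

lemma eT_hw: "hw_word lam P (\<lambda>\<alpha>. of_int (eT \<alpha>))"
  unfolding hw_word_def
proof (intro conjI allI impI)
  fix \<alpha> :: "nat \<Rightarrow> nat" and i j :: nat assume ij: "1 \<le> i \<and> i < j"
  \<comment> \<open>Writing the raised place as \<open>\<gamma> p\<close> moves the change of letter
    from \<open>\<alpha>\<close> to the fixed word \<open>row\<close>.\<close>
  have upd: "(\<forall>x\<in>P. (\<alpha>(\<gamma> p := j) \<circ> \<gamma>) x = row x) \<and> \<alpha> (\<gamma> p) = i
      \<longleftrightarrow> row p = j \<and> (\<forall>x\<in>P. (\<alpha> \<circ> \<gamma>) x = (row(p := i)) x)" if "\<gamma> \<in> CT" "p \<in> P" for \<gamma> p
  proof -
    have "inj \<gamma>" using that by (auto simp: CT_iff permutes_inj)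
    then have "\<alpha>(\<gamma> p := j) \<circ> \<gamma> = (\<alpha> \<circ> \<gamma>)(p := j)" by (auto simp: fun_eq_iff inj_eq)
    then show ?thesis using that(2) by (auto split: if_splits)
  qed
  have "(\<Sum>p\<in>P. if \<alpha> p = i then eT (\<alpha>(p := j)) else 0)
    = (\<Sum>p\<in>P. \<Sum>\<gamma>\<in>CT. if (\<forall>x\<in>P. (\<alpha>(p := j) \<circ> \<gamma>) x = row x) \<and> \<alpha> p = i then sign \<gamma> else 0)"
    unfolding eT_def by (intro sum.cong refl) auto
  also have "\<dots> = (\<Sum>\<gamma>\<in>CT. \<Sum>p\<in>P. if (\<forall>x\<in>P. (\<alpha>(p := j) \<circ> \<gamma>) x = row x) \<and> \<alpha> p = i then sign \<gamma> else 0)"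
    by (rule sum.swap)
  also have "\<dots> = (\<Sum>\<gamma>\<in>CT. \<Sum>p\<in>P. if (\<forall>x\<in>P. (\<alpha>(\<gamma> p := j) \<circ> \<gamma>) x = row x) \<and> \<alpha> (\<gamma> p) = i then sign \<gamma> else 0)"
    by (intro sum.cong refl sum.reindex_bij_betw[symmetric] permutes_imp_bij) (simp add: CT_iff)
  also have "\<dots> = (\<Sum>\<gamma>\<in>CT. \<Sum>p\<in>P. if row p = j \<and> (\<forall>x\<in>P. (\<alpha> \<circ> \<gamma>) x = (row(p := i)) x) then sign \<gamma> else 0)"
    by (intro sum.cong refl if_cong upd)
  also have "\<dots> = (\<Sum>p\<in>P. \<Sum>\<gamma>\<in>CT. if row p = j \<and> (\<forall>x\<in>P. (\<alpha> \<circ> \<gamma>) x = (row(p := i)) x) then sign \<gamma> else 0)"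
    by (rule sum.swap)
  also have "\<dots> = 0"
  proof (rule sum.neutral, rule ballI)
    fix p assume p: "p \<in> P"
    show "(\<Sum>\<gamma>\<in>CT. if row p = j \<and> (\<forall>x\<in>P. (\<alpha> \<circ> \<gamma>) x = (row(p := i)) x) then sign \<gamma> else 0) = 0"
    proof (cases "row p = j")
      case True
      have c: "(row p, col p) \<in> cells lam" using tab_pos(1)[OF bij p] .
      then have c': "(i, col p) \<in> cells lam"
        using ij True part_decreasing[of i j] by (auto simp: cells_def)
      define q where "q = T (i, col p)"
      have q: "q \<in> P" "row q = i" "col q = col p"
        using c' TP row_col_of[OF bij c'] by (auto simp: q_def)
      have "(\<Sum>\<gamma>\<in>CT. if \<forall>x\<in>P. (\<alpha> \<circ> \<gamma>) x = (row(p := i)) x then sign \<gamma> else 0) = (0::int)"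
        by (rule column_antisym_0[OF p q(1)]) (use q ij True in auto)
      then show ?thesis using True by simp
    qed simp
  qed
  finally have "complex_of_int (\<Sum>p\<in>P. if \<alpha> p = i then eT (\<alpha>(p := j)) else 0) = 0" by simp
  then show "raised P (\<lambda>\<alpha>. complex_of_int (eT \<alpha>)) i j \<alpha> = 0"
    by (simp add: raised_def if_distrib cong: if_cong)
next
  fix \<alpha> i assume "complex_of_int (eT \<alpha>) \<noteq> 0"
  then have "eT \<alpha> \<noteq> 0" by simp
  have "\<exists>\<gamma>\<in>CT. \<forall>p\<in>P. (\<alpha> \<circ> \<gamma>) p = row p"
  proof (rule ccontr)
    assume "\<not> ?thesis"
    then have "eT \<alpha> = 0" unfolding eT_def by (intro sum.neutral) auto
    then show False using \<open>eT \<alpha> \<noteq> 0\<close> by simp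
  qed
  then obtain \<gamma> where \<gamma>: "\<gamma> \<in> CT" "\<forall>p\<in>P. (\<alpha> \<circ> \<gamma>) p = row p" by (elim bexE)
  have "cnt P \<alpha> i = cnt P (\<alpha> \<circ> \<gamma>) i" using \<gamma>(1) by (simp add: cnt_permute CT_iff)
  also have "\<dots> = cnt P row i" unfolding cnt_def by (rule arg_cong[where f = card]) (use \<gamma>(2) in auto)
  finally show "cnt P \<alpha> i = part lam i" by (simp add: cnt_row)
next
  fix \<alpha> \<beta> :: "nat \<Rightarrow> nat" assume eq: "\<forall>p\<in>P. \<alpha> p = \<beta> p"
  have "(\<forall>p\<in>P. (\<alpha> \<circ> \<gamma>) p = row p) \<longleftrightarrow> (\<forall>p\<in>P. (\<beta> \<circ> \<gamma>) p = row p)" if "\<gamma> \<in> CT" for \<gamma>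
    using that eq by (auto simp: CT_iff permutes_in_image)
  then have "eT \<alpha> = eT \<beta>" unfolding eT_def by (intro sum.cong) simp_all
  then show "complex_of_int (eT \<alpha>) = complex_of_int (eT \<beta>)" by simp
qed

lemma sum_RT_hw: "hw_word lam P g \<Longrightarrow> hw_word lam P (\<lambda>\<alpha>. \<Sum>\<rho>\<in>RT. g (\<alpha> \<circ> \<rho>))"
  by (intro hw_word_sum hw_word_permute) (auto simp: RT_iff)

lemma fT_hw: "hw_word lam P (\<lambda>\<alpha>. of_int (fT \<alpha>))"
  using sum_RT_hw[OF eT_hw] by (simp add: fT_def)

lemma sum_RT_invariant:
  assumes "\<rho>' \<in> RT"
  shows "(\<Sum>\<rho>\<in>RT. g ((\<alpha> \<circ> \<rho>') \<circ> \<rho>)) = (\<Sum>\<rho>\<in>RT. g (\<alpha> \<circ> \<rho>) :: 'a :: comm_monoid_add)"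
  using sum.reindex_bij_betw[OF RT_comp_bij[OF assms], of "\<lambda>\<rho>. g (\<alpha> \<circ> \<rho>)"] by (simp add: comp_assoc)

lemma fT_invariant: "\<rho>' \<in> RT \<Longrightarrow> fT (\<alpha> \<circ> \<rho>') = fT \<alpha>"
  unfolding fT_def by (rule sum_RT_invariant)

lemma sum_RT_row: "hw_word lam P g \<Longrightarrow> (\<Sum>\<rho>\<in>RT. g (row \<circ> \<rho>)) = of_nat (card RT) * g row"
proof -
  assume "hw_word lam P g"
  then have "g (row \<circ> \<rho>) = g row" if "\<rho> \<in> RT" for \<rho>
    by (rule hw_wordD(3)) (rule row_RT[OF that])
  then show ?thesis by simp
qed

text \<open>A column permutation that preserves every row is the identity, so a single term of the
  sum survives.\<close>

lemma eT_row: "eT row = 1"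
proof -
  have "(\<forall>p\<in>P. (row \<circ> \<gamma>) p = row p) \<longleftrightarrow> \<gamma> = id" if g: "\<gamma> \<in> CT" for \<gamma>
  proof
    assume r: "\<forall>p\<in>P. (row \<circ> \<gamma>) p = row p"
    have gP: "\<gamma> permutes P" using g by (simp add: CT_iff)
    have "\<gamma> p = p" for p
    proof (cases "p \<in> P")
      case True
      then have a: "\<gamma> p \<in> P" using permutes_in_image[OF gP] by simp
      have b: "row (\<gamma> p) = row p" using bspec[OF r True] by simp
      have c: "col (\<gamma> p) = col p" using g True by (simp add: CT_iff)
      show ?thesis by (rule pos_unique[OF a True b c])
    next
      case False
      then show ?thesis using permutes_not_in[OF gP] by simp
    qed
    then show "\<gamma> = id" by (intro ext) simp
  qed simp
  then have "eT row = (\<Sum>\<gamma>\<in>CT. if \<gamma> = id then sign \<gamma> else 0)"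
    unfolding eT_def by (intro sum.cong refl) simp
  also have "\<dots> = (\<Sum>\<gamma>\<in>CT. if \<gamma> = id then 1 else 0)" by (intro sum.cong refl) simp
  also have "\<dots> = 1" using finite_CT by (simp add: CT_iff permutes_id)
  finally show ?thesis .
qed

lemma fT_row: "fT row = int (card RT)"
proof -
  have "complex_of_int (fT row) = of_nat (card RT)"
    using sum_RT_row[OF eT_hw] by (simp add: fT_def eT_row)
  then show ?thesis by (metis of_int_of_nat_eq of_int_eq_iff)
qed

lemma fT_row_nz: "fT row \<noteq> 0"
  using id_RT finite_RT by (auto simp: fT_row card_eq_0_iff)

text \<open>Symmetrising \<open>g\<close> over the rows gives a row invariant highest weight
  function, which \<open>row_invariant_eq_0\<close> identifies with \<open>g row\<close> times
  \<open>fT\<close>. Its pairing with \<open>fT\<close> is \<open>card RT\<close> times that of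
  \<open>g\<close>, hence zero, while \<open>fT\<close> paired with itself is positive.\<close>

lemma orthogonal_fT:
  assumes hw: "hw_word lam P g" and n: "length lam \<le> n"
    and orth: "(\<Sum>\<alpha>\<in>PiE P (\<lambda>_. {1..n}). g \<alpha> * of_int (fT \<alpha>)) = 0"
  shows "g row = 0"
proof -
  let ?W = "PiE P (\<lambda>_. {1..n})"
  define f where "f \<alpha> = (\<Sum>\<rho>\<in>RT. g (\<alpha> \<circ> \<rho>))" for \<alpha>
  have f_eq: "f \<alpha> = g row * of_int (fT \<alpha>)" for \<alpha>
  proof -
    have "f \<alpha> + (- g row) * of_int (fT \<alpha>) = 0"
    proof (rule row_invariant_eq_0[where f = "\<lambda>\<alpha>. f \<alpha> + (- g row) * of_int (fT \<alpha>)"])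
      show "hw_word lam P (\<lambda>\<alpha>. f \<alpha> + (- g row) * of_int (fT \<alpha>))"
        unfolding f_def by (intro hw_word_add hw_word_scale sum_RT_hw hw fT_hw)
      show "f (\<alpha> \<circ> \<rho>) + (- g row) * of_int (fT (\<alpha> \<circ> \<rho>)) = f \<alpha> + (- g row) * of_int (fT \<alpha>)" if "\<rho> \<in> RT" for \<rho> \<alpha>
        using that unfolding f_def by (simp add: sum_RT_invariant fT_invariant)
      show "f row + (- g row) * of_int (fT row) = 0"
        unfolding f_def sum_RT_row[OF hw] fT_row by simp
    qed
    then show ?thesis by simp
  qed
  have comp_bij: "bij_betw (\<lambda>\<alpha>. \<alpha> \<circ> \<rho>) ?W ?W" if "\<rho> \<in> RT" for \<rho>
  proof (rule bij_betw_byWitness[where f' = "\<lambda>\<alpha>. \<alpha> \<circ> inv \<rho>"])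
    have p: "\<rho> permutes P" using that by (simp add: RT_iff)
    note p' = permutes_inv[OF p]
    show "\<forall>\<alpha>\<in>?W. (\<alpha> \<circ> \<rho>) \<circ> inv \<rho> = \<alpha>" "\<forall>\<alpha>\<in>?W. (\<alpha> \<circ> inv \<rho>) \<circ> \<rho> = \<alpha>"
      using permutes_inverses[OF p] by (auto simp: fun_eq_iff)
    have "\<alpha> \<circ> \<sigma> \<in> ?W" if "\<sigma> permutes P" "\<alpha> \<in> ?W" for \<alpha> \<sigma>
      using that permutes_in_image[OF that(1)] permutes_not_in[OF that(1)]
      by (auto simp: PiE_iff extensional_def)
    then show "(\<lambda>\<alpha>. \<alpha> \<circ> \<rho>) ` ?W \<subseteq> ?W" "(\<lambda>\<alpha>. \<alpha> \<circ> inv \<rho>) ` ?W \<subseteq> ?W" using p p' by blast+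
  qed
  have finW: "finite ?W" using finite_P by (intro finite_PiE) auto
  have "(\<Sum>\<alpha>\<in>?W. f \<alpha> * of_int (fT \<alpha>)) = (\<Sum>\<alpha>\<in>?W. \<Sum>\<rho>\<in>RT. g (\<alpha> \<circ> \<rho>) * of_int (fT (\<alpha> \<circ> \<rho>)))"
    unfolding f_def sum_distrib_right by (intro sum.cong refl) (simp add: fT_invariant)
  also have "\<dots> = (\<Sum>\<rho>\<in>RT. \<Sum>\<alpha>\<in>?W. g (\<alpha> \<circ> \<rho>) * of_int (fT (\<alpha> \<circ> \<rho>)))" by (rule sum.swap)
  also have "\<dots> = (\<Sum>\<rho>\<in>RT. \<Sum>\<alpha>\<in>?W. g \<alpha> * of_int (fT \<alpha>))"
    by (rule sum.cong[OF refl], rule sum.reindex_bij_betw[OF comp_bij])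
  also have "\<dots> = 0" by (simp add: orth)
  finally have "g row * of_int (\<Sum>\<alpha>\<in>?W. fT \<alpha> * fT \<alpha>) = 0"
    unfolding f_eq by (simp add: sum_distrib_left mult.assoc)
  moreover
  have "(\<Sum>\<alpha>\<in>?W. fT \<alpha> * fT \<alpha>) > 0"
  proof (rule sum_pos2[OF finW])
    show "restrict row P \<in> ?W"
    proof (rule restrict_PiE_iff[THEN iffD2], rule ballI)
      fix p assume "p \<in> P"
      then have "(row p, col p) \<in> cells lam" by (rule tab_pos(1)[OF bij])
      then show "row p \<in> {1..n}" using n by (simp add: cells_def)
    qed
    have "complex_of_int (fT (restrict row P)) = complex_of_int (fT row)"
      by (rule hw_wordD(3)[OF fT_hw]) simp
    then have "fT (restrict row P) = fT row" by simp
    then show "0 < fT (restrict row P) * fT (restrict row P)"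
      using fT_row_nz by (metis not_real_square_gt_zero zero_less_mult_iff linorder_neqE_linordered_idom)
  qed auto
  then have "complex_of_int (\<Sum>\<alpha>\<in>?W. fT \<alpha> * fT \<alpha>) \<noteq> 0" by (simp only: of_int_eq_0_iff)
  ultimately show ?thesis by (metis mult_eq_0_iff)
qed

end

text \<open>Orthogonality makes the values at the row words of standard tableaux vanish, and by
  \<open>hw_word_eq_0\<close> these values detect a highest weight function.\<close>

theorem hw_word_orthogonal_0:
  assumes "finite P" "card P = sum_list lam" "sorted_wrt (\<ge>) lam" "length lam \<le> n" "hw_word lam P g"
    "\<And>T. std_tableau lam P T \<Longrightarrow> (\<Sum>\<alpha>\<in>PiE P (\<lambda>_. {1..n}). g \<alpha> * of_int (tableau.fT lam P T \<alpha>)) = 0"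
  shows "g \<alpha> = 0"
proof (rule hw_word_eq_0[OF assms(1,2,5)])
  fix T assume T: "std_tableau lam P T"
  interpret tableau lam P T by unfold_locales (use assms T in \<open>auto simp: std_tableau_def\<close>)
  show "g (row_of lam T) = 0" by (rule orthogonal_fT[OF assms(5,4) assms(6)[OF T]])
qed

section \<open>The first fundamental theorem for kernels on words\<close>

definition bijs :: "'p set \<Rightarrow> 'q set \<Rightarrow> ('p \<Rightarrow> 'q) set" where
  "bijs A B = {\<sigma> \<in> PiE A (\<lambda>_. B). bij_betw \<sigma> A B}"

definition matches :: "'p set \<Rightarrow> ('p \<Rightarrow> 'q) \<Rightarrow> ('p \<Rightarrow> nat) \<Rightarrow> ('q \<Rightarrow> nat) \<Rightarrow> bool" where
  "matches A \<sigma> \<alpha> \<beta> \<longleftrightarrow> (\<forall>p\<in>A. \<alpha> p = \<beta> (\<sigma> p))"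

text \<open>\<open>D\<close> is the matrix of a linear map from the tensor power over
  \<open>B\<close> to the one over \<open>A\<close>, and the second clause says that it commutes
  with all matrix units. The index types are arbitrary because disjoint unions of places are
  inserted later.\<close>

definition inv_kernel :: "nat \<Rightarrow> 'p set \<Rightarrow> 'q set \<Rightarrow> (('p \<Rightarrow> nat) \<Rightarrow> ('q \<Rightarrow> nat) \<Rightarrow> complex) \<Rightarrow> bool" where
  "inv_kernel n A B D \<longleftrightarrow> (\<forall>\<alpha> \<beta> \<alpha>' \<beta>'. (\<forall>p\<in>A. \<alpha> p = \<alpha>' p) \<longrightarrow> (\<forall>q\<in>B. \<beta> q = \<beta>' q) \<longrightarrow> D \<alpha> \<beta> = D \<alpha>' \<beta>')
    \<and> (\<forall>\<alpha> \<beta> i j. \<alpha> ` A \<subseteq> {1..n} \<longrightarrow> \<beta> ` B \<subseteq> {1..n} \<longrightarrow> i \<in> {1..n} \<longrightarrow> j \<in> {1..n} \<longrightarrow>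
      (\<Sum>p\<in>A. if \<alpha> p = i then D (\<alpha>(p := j)) \<beta> else 0) = (\<Sum>q\<in>B. if \<beta> q = j then D \<alpha> (\<beta>(q := i)) else 0))"

lemma inv_kernelD:
  assumes "inv_kernel n A B D"
  shows "(\<And>p. p \<in> A \<Longrightarrow> \<alpha> p = \<alpha>' p) \<Longrightarrow> (\<And>q. q \<in> B \<Longrightarrow> \<beta> q = \<beta>' q) \<Longrightarrow> D \<alpha> \<beta> = D \<alpha>' \<beta>'"
    "\<alpha> ` A \<subseteq> {1..n} \<Longrightarrow> \<beta> ` B \<subseteq> {1..n} \<Longrightarrow> i \<in> {1..n} \<Longrightarrow> j \<in> {1..n} \<Longrightarrow>
      (\<Sum>p\<in>A. if \<alpha> p = i then D (\<alpha>(p := j)) \<beta> else 0) = (\<Sum>q\<in>B. if \<beta> q = j then D \<alpha> (\<beta>(q := i)) else 0)"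
proof -
  show "(\<And>p. p \<in> A \<Longrightarrow> \<alpha> p = \<alpha>' p) \<Longrightarrow> (\<And>q. q \<in> B \<Longrightarrow> \<beta> q = \<beta>' q) \<Longrightarrow> D \<alpha> \<beta> = D \<alpha>' \<beta>'"
    using assms[unfolded inv_kernel_def, THEN conjunct1, rule_format] .
  show "\<alpha> ` A \<subseteq> {1..n} \<Longrightarrow> \<beta> ` B \<subseteq> {1..n} \<Longrightarrow> i \<in> {1..n} \<Longrightarrow> j \<in> {1..n} \<Longrightarrow>
      (\<Sum>p\<in>A. if \<alpha> p = i then D (\<alpha>(p := j)) \<beta> else 0) = (\<Sum>q\<in>B. if \<beta> q = j then D \<alpha> (\<beta>(q := i)) else 0)"
    using assms[unfolded inv_kernel_def, THEN conjunct2, rule_format] .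
qed

text \<open>Place permutations are intertwiners: the two sums agree term by term along
  \<open>\<sigma>\<close>.\<close>

lemma matches_kernel:
  assumes "\<sigma> \<in> bijs A B"
  shows "inv_kernel n A B (\<lambda>\<alpha> \<beta>. if matches A \<sigma> \<alpha> \<beta> then c else 0)"
  unfolding inv_kernel_def
proof (intro conjI allI impI)
  have b: "bij_betw \<sigma> A B" using assms by (simp add: bijs_def)
  have \<sigma>B: "\<sigma> p \<in> B" if "p \<in> A" for p using b that by (auto simp: bij_betw_def)
  have \<sigma>i: "\<sigma> p = \<sigma> q \<longleftrightarrow> p = q" if "p \<in> A" "q \<in> A" for p q
    using b that by (auto simp: bij_betw_def inj_on_def)
  {
    fix \<alpha> \<alpha>' :: "'a \<Rightarrow> nat" and \<beta> \<beta>' :: "'b \<Rightarrow> nat"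
    assume "\<forall>p\<in>A. \<alpha> p = \<alpha>' p" "\<forall>q\<in>B. \<beta> q = \<beta>' q"
    then have "matches A \<sigma> \<alpha> \<beta> \<longleftrightarrow> matches A \<sigma> \<alpha>' \<beta>'" using \<sigma>B by (simp add: matches_def)
    then show "(if matches A \<sigma> \<alpha> \<beta> then c else 0) = (if matches A \<sigma> \<alpha>' \<beta>' then c else 0)" by simp
  next
    fix \<alpha> :: "'a \<Rightarrow> nat" and \<beta> :: "'b \<Rightarrow> nat" and i j :: nat
    have "(\<Sum>q\<in>B. if \<beta> q = j then if matches A \<sigma> \<alpha> (\<beta>(q := i)) then c else 0 else 0)
      = (\<Sum>p\<in>A. if \<beta> (\<sigma> p) = j then if matches A \<sigma> \<alpha> (\<beta>(\<sigma> p := i)) then c else 0 else 0)"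
      by (rule sum.reindex_bij_betw[OF b, symmetric])
    also have "\<dots> = (\<Sum>p\<in>A. if \<alpha> p = i then if matches A \<sigma> (\<alpha>(p := j)) \<beta> then c else 0 else 0)"
    proof (rule sum.cong[OF refl])
      fix p assume p: "p \<in> A"
      have "\<beta> (\<sigma> p) = j \<and> matches A \<sigma> \<alpha> (\<beta>(\<sigma> p := i)) \<longleftrightarrow> \<alpha> p = i \<and> matches A \<sigma> (\<alpha>(p := j)) \<beta>"
        using p \<sigma>i by (auto simp: matches_def)
      then show "(if \<beta> (\<sigma> p) = j then if matches A \<sigma> \<alpha> (\<beta>(\<sigma> p := i)) then c else 0 else 0)
        = (if \<alpha> p = i then if matches A \<sigma> (\<alpha>(p := j)) \<beta> then c else 0 else 0)"
        by (cases "\<beta> (\<sigma> p) = j"; cases "\<alpha> p = i") simp_all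
    qed
    finally show "(\<Sum>p\<in>A. if \<alpha> p = i then if matches A \<sigma> (\<alpha>(p := j)) \<beta> then c else 0 else 0)
      = (\<Sum>q\<in>B. if \<beta> q = j then if matches A \<sigma> \<alpha> (\<beta>(q := i)) then c else 0 else 0)" by simp
  }
qed

lemma inv_kernel_sum:
  assumes "\<And>x. x \<in> X \<Longrightarrow> inv_kernel n A B (D x)"
  shows "inv_kernel n A B (\<lambda>\<alpha> \<beta>. \<Sum>x\<in>X. D x \<alpha> \<beta>)"
  unfolding inv_kernel_def
proof (intro conjI allI impI)
  fix \<alpha> \<alpha>' :: "'b \<Rightarrow> nat" and \<beta> \<beta>' :: "'c \<Rightarrow> nat"
  assume "\<forall>p\<in>A. \<alpha> p = \<alpha>' p" "\<forall>q\<in>B. \<beta> q = \<beta>' q"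
  then show "(\<Sum>x\<in>X. D x \<alpha> \<beta>) = (\<Sum>x\<in>X. D x \<alpha>' \<beta>')"
    by (intro sum.cong refl inv_kernelD(1)[OF assms]) auto
next
  fix \<alpha> :: "'b \<Rightarrow> nat" and \<beta> :: "'c \<Rightarrow> nat" and i j :: nat
  assume ab: "\<alpha> ` A \<subseteq> {1..n}" "\<beta> ` B \<subseteq> {1..n}" "i \<in> {1..n}" "j \<in> {1..n}"
  have "(\<Sum>p\<in>A. if \<alpha> p = i then \<Sum>x\<in>X. D x (\<alpha>(p := j)) \<beta> else 0)
    = (\<Sum>p\<in>A. \<Sum>x\<in>X. if \<alpha> p = i then D x (\<alpha>(p := j)) \<beta> else 0)" by (intro sum.cong refl) auto
  also have "\<dots> = (\<Sum>x\<in>X. \<Sum>p\<in>A. if \<alpha> p = i then D x (\<alpha>(p := j)) \<beta> else 0)" by (rule sum.swap)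
  also have "\<dots> = (\<Sum>x\<in>X. \<Sum>q\<in>B. if \<beta> q = j then D x \<alpha> (\<beta>(q := i)) else 0)"
    by (rule sum.cong[OF refl], rule inv_kernelD(2)[OF assms ab])
  also have "\<dots> = (\<Sum>q\<in>B. \<Sum>x\<in>X. if \<beta> q = j then D x \<alpha> (\<beta>(q := i)) else 0)" by (rule sum.swap)
  also have "\<dots> = (\<Sum>q\<in>B. if \<beta> q = j then \<Sum>x\<in>X. D x \<alpha> (\<beta>(q := i)) else 0)"
    by (intro sum.cong refl) auto
  finally show "(\<Sum>p\<in>A. if \<alpha> p = i then \<Sum>x\<in>X. D x (\<alpha>(p := j)) \<beta> else 0)
    = (\<Sum>q\<in>B. if \<beta> q = j then \<Sum>x\<in>X. D x \<alpha> (\<beta>(q := i)) else 0)" .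
qed

lemma inv_kernel_diff:
  assumes "inv_kernel n A B D" "inv_kernel n A B D'"
  shows "inv_kernel n A B (\<lambda>\<alpha> \<beta>. D \<alpha> \<beta> - D' \<alpha> \<beta>)"
  unfolding inv_kernel_def
proof (intro conjI allI impI)
  fix \<alpha> \<alpha>' :: "'a \<Rightarrow> nat" and \<beta> \<beta>' :: "'b \<Rightarrow> nat"
  assume "\<forall>p\<in>A. \<alpha> p = \<alpha>' p" "\<forall>q\<in>B. \<beta> q = \<beta>' q"
  then show "D \<alpha> \<beta> - D' \<alpha> \<beta> = D \<alpha>' \<beta>' - D' \<alpha>' \<beta>'"
    using inv_kernelD(1)[OF assms(1), of \<alpha> \<alpha>' \<beta> \<beta>'] inv_kernelD(1)[OF assms(2), of \<alpha> \<alpha>' \<beta> \<beta>'] by simp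
next
  fix \<alpha> :: "'a \<Rightarrow> nat" and \<beta> :: "'b \<Rightarrow> nat" and i j :: nat
  assume ab: "\<alpha> ` A \<subseteq> {1..n}" "\<beta> ` B \<subseteq> {1..n}" "i \<in> {1..n}" "j \<in> {1..n}"
  have *: "(\<Sum>x\<in>X. if Q x then f x - g x else 0) = (\<Sum>x\<in>X. if Q x then f x else 0) - (\<Sum>x\<in>X. if Q x then g x else (0::complex))"
    for X :: "'x set" and Q f g
    unfolding sum_subtractf[symmetric] by (intro sum.cong refl) auto
  show "(\<Sum>p\<in>A. if \<alpha> p = i then D (\<alpha>(p := j)) \<beta> - D' (\<alpha>(p := j)) \<beta> else 0)
    = (\<Sum>q\<in>B. if \<beta> q = j then D \<alpha> (\<beta>(q := i)) - D' \<alpha> (\<beta>(q := i)) else 0)"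
    unfolding * inv_kernelD(2)[OF assms(1) ab] inv_kernelD(2)[OF assms(2) ab] ..
qed

text \<open>Moving letters
  of \<open>\<beta>\<close> to their value in \<open>\<iota>\<close> one at a time only produces words closer to \<open>\<iota>\<close>.\<close>

lemma inv_kernel_eq_0:
  assumes D: "inv_kernel n A B D" and finB: "finite B" and inj: "inj_on \<iota> B" and \<iota>n: "\<iota> ` B \<subseteq> {1..n}"
    and zero: "\<And>\<alpha>. \<alpha> ` A \<subseteq> {1..n} \<Longrightarrow> D \<alpha> \<iota> = 0"
    and ab: "\<alpha> ` A \<subseteq> {1..n}" "\<beta> ` B \<subseteq> {1..n}"
  shows "D \<alpha> \<beta> = 0"
proof -
  have "D \<alpha> \<beta> = 0" if "card {q \<in> B. \<beta> q \<noteq> \<iota> q} = w" "\<beta> ` B \<subseteq> {1..n}" "\<alpha> ` A \<subseteq> {1..n}" for w \<alpha> \<beta>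
    using that
  proof (induction w arbitrary: \<alpha> \<beta> rule: less_induct)
    case (less w)
    show ?case
    proof (cases "{q \<in> B. \<beta> q \<noteq> \<iota> q} = {}")
      case True
      have "D \<alpha> \<beta> = D \<alpha> \<iota>" by (rule inv_kernelD(1)[OF D]) (use True in auto)
      then show ?thesis using zero less.prems(3) by simp
    next
      case False
      then obtain q where q: "q \<in> B" "\<beta> q \<noteq> \<iota> q" by blast
      \<comment> \<open>A word that has the letter of \<open>\<iota>\<close> at \<open>q\<close> and
        introduces no new disagreement is strictly closer to \<open>\<iota>\<close>.\<close>
      have smaller: "D \<alpha>' \<beta>' = 0"
        if \<beta>': "\<beta>' ` B \<subseteq> {1..n}" "\<alpha>' ` A \<subseteq> {1..n}" "\<beta>' q = \<iota> q" "\<And>x. x \<in> B \<Longrightarrow> \<beta>' x \<noteq> \<iota> x \<Longrightarrow> \<beta> x \<noteq> \<iota> x" for \<alpha>' \<beta>'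
      proof (rule less.IH[OF _ refl that(1,2)])
        have "{x \<in> B. \<beta>' x \<noteq> \<iota> x} \<subseteq> {x \<in> B. \<beta> x \<noteq> \<iota> x} - {q}" using \<beta>'(3,4) by auto
        then have "card {x \<in> B. \<beta>' x \<noteq> \<iota> x} \<le> card ({x \<in> B. \<beta> x \<noteq> \<iota> x} - {q})"
          using finB by (intro card_mono) auto
        also have "\<dots> < card {x \<in> B. \<beta> x \<noteq> \<iota> x}" using finB q by (intro card_Diff1_less) auto
        finally show "card {x \<in> B. \<beta>' x \<noteq> \<iota> x} < w" using less.prems(1) by simp
      qed
      define \<gamma> where "\<gamma> = \<beta>(q := \<iota> q)"
      have ij: "\<beta> q \<in> {1..n}" "\<iota> q \<in> {1..n}" using q less.prems(2) \<iota>n by auto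
      have \<gamma>n: "\<gamma> ` B \<subseteq> {1..n}" using less.prems(2) ij by (auto simp: \<gamma>_def)
      have "(\<Sum>p\<in>A. if \<alpha> p = \<beta> q then D (\<alpha>(p := \<iota> q)) \<gamma> else 0)
        = (\<Sum>x\<in>B. if \<gamma> x = \<iota> q then D \<alpha> (\<gamma>(x := \<beta> q)) else 0)"
        by (rule inv_kernelD(2)[OF D less.prems(3) \<gamma>n ij])
      moreover have "(\<Sum>p\<in>A. if \<alpha> p = \<beta> q then D (\<alpha>(p := \<iota> q)) \<gamma> else 0) = 0"
      proof (rule sum.neutral, rule ballI)
        fix p assume "p \<in> A"
        have "D (\<alpha>(p := \<iota> q)) \<gamma> = 0"
          by (rule smaller[OF \<gamma>n]) (use less.prems(3) ij in \<open>auto simp: \<gamma>_def split: if_splits\<close>)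
        then show "(if \<alpha> p = \<beta> q then D (\<alpha>(p := \<iota> q)) \<gamma> else 0) = 0" by simp
      qed
      \<comment> \<open>Besides \<open>q\<close> itself only places where \<open>\<gamma>\<close>
        has the letter \<open>\<iota> q\<close> could contribute. By injectivity of
        \<open>\<iota>\<close> their letter is wrong already, so changing it creates no new
        disagreement.\<close>
      moreover have "(\<Sum>x\<in>B. if \<gamma> x = \<iota> q then D \<alpha> (\<gamma>(x := \<beta> q)) else 0) = (\<Sum>x\<in>B. if x = q then D \<alpha> \<beta> else 0)"
      proof (rule sum.cong[OF refl])
        fix x assume x: "x \<in> B"
        show "(if \<gamma> x = \<iota> q then D \<alpha> (\<gamma>(x := \<beta> q)) else 0) = (if x = q then D \<alpha> \<beta> else 0)"
        proof (cases "x = q")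
          case True
          have "\<gamma>(q := \<beta> q) = \<beta>" by (auto simp: \<gamma>_def)
          then show ?thesis using True by (simp add: \<gamma>_def)
        next
          case False
          have "\<gamma> x = \<iota> q \<Longrightarrow> D \<alpha> (\<gamma>(x := \<beta> q)) = 0"
          proof (rule smaller)
            assume "\<gamma> x = \<iota> q"
            then have bx: "\<beta> x = \<iota> q" using False by (simp add: \<gamma>_def)
            have "\<iota> x \<noteq> \<iota> q" using inj x q(1) False by (auto simp: inj_on_def)
            then show "\<And>y. y \<in> B \<Longrightarrow> (\<gamma>(x := \<beta> q)) y \<noteq> \<iota> y \<Longrightarrow> \<beta> y \<noteq> \<iota> y"
              using bx by (auto simp: \<gamma>_def split: if_splits)
            show "(\<gamma>(x := \<beta> q)) ` B \<subseteq> {1..n}" using \<gamma>n ij by auto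
            show "(\<gamma>(x := \<beta> q)) q = \<iota> q" using False by (simp add: \<gamma>_def)
          qed (rule less.prems(3))
          then show ?thesis using False by simp
        qed
      qed
      ultimately show ?thesis using q(1) finB by simp
    qed
  qed
  then show ?thesis using ab by blast
qed

text \<open>The coefficient of \<open>\<sigma>\<close> is the value of \<open>D\<close> at
  \<open>\<iota> \<circ> \<sigma>\<close> and \<open>\<iota>\<close>, for a word
  \<open>\<iota>\<close> with distinct letters; such a word exists because
  \<open>card B \<le> n\<close>. The difference then vanishes whenever the second word is
  \<open>\<iota>\<close>, and \<open>inv_kernel_eq_0\<close> extends this to all words.\<close>

theorem inv_kernel_permutations:
  assumes D: "inv_kernel n A B D" and fin: "finite A" "finite B" and card: "card A = card B" "card B \<le> n"
  shows "\<exists>c. \<forall>\<alpha> \<beta>. \<alpha> ` A \<subseteq> {1..n} \<longrightarrow> \<beta> ` B \<subseteq> {1..n} \<longrightarrow>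
    D \<alpha> \<beta> = (\<Sum>\<sigma>\<in>bijs A B. if matches A \<sigma> \<alpha> \<beta> then c \<sigma> else 0)"
proof -
  have "\<exists>\<iota>. inj_on \<iota> B \<and> \<iota> ` B \<subseteq> {1..n}"
    using card_le_inj[OF fin(2), of "{1..n}"] card(2) by auto
  then obtain \<iota> where inj: "inj_on \<iota> B" and \<iota>n: "\<iota> ` B \<subseteq> {1..n}" by (elim exE conjE)
  define c where "c \<sigma> = D (\<lambda>p. \<iota> (\<sigma> p)) \<iota>" for \<sigma>
  let ?S = "\<lambda>\<alpha> \<beta>. \<Sum>\<sigma>\<in>bijs A B. if matches A \<sigma> \<alpha> \<beta> then c \<sigma> else 0"
  have finbij: "finite (bijs A B)"
    by (rule finite_subset[of _ "PiE A (\<lambda>_. B)"]) (use fin in \<open>auto simp: bijs_def intro: finite_PiE\<close>)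
  have ex\<sigma>: "\<exists>\<sigma>\<in>bijs A B. matches A \<sigma> \<alpha> \<iota>" if nz: "D \<alpha> \<iota> \<noteq> 0" and \<alpha>: "\<alpha> ` A \<subseteq> {1..n}" for \<alpha>
  proof -
    \<comment> \<open>The invariance relation with equal letters compares contents, so
      \<open>\<alpha>\<close> must be a rearrangement of \<open>\<iota>\<close>.\<close>
    have cc: "card {p \<in> A. \<alpha> p = i} = card {q \<in> B. \<iota> q = i}" if i: "i \<in> {1..n}" for i
    proof -
      have "(\<Sum>p\<in>A. if \<alpha> p = i then D (\<alpha>(p := i)) \<iota> else 0) = (\<Sum>q\<in>B. if \<iota> q = i then D \<alpha> (\<iota>(q := i)) else 0)"
        by (rule inv_kernelD(2)[OF D \<alpha> \<iota>n i i])
      moreover have "(\<Sum>p\<in>A. if \<alpha> p = i then D (\<alpha>(p := i)) \<iota> else 0) = (\<Sum>p\<in>A. if \<alpha> p = i then D \<alpha> \<iota> else 0)"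
        by (intro sum.cong refl) auto
      moreover have "(\<Sum>q\<in>B. if \<iota> q = i then D \<alpha> (\<iota>(q := i)) else 0) = (\<Sum>q\<in>B. if \<iota> q = i then D \<alpha> \<iota> else 0)"
        by (intro sum.cong refl) auto
      ultimately have "of_nat (card {p \<in> A. \<alpha> p = i}) * D \<alpha> \<iota> = of_nat (card {q \<in> B. \<iota> q = i}) * D \<alpha> \<iota>"
        using fin by (simp flip: sum.inter_filter)
      then show ?thesis using nz by simp
    qed
    have sub: "\<alpha> p \<in> \<iota> ` B" if p: "p \<in> A" for p
    proof (rule ccontr)
      assume "\<alpha> p \<notin> \<iota> ` B"
      then have e: "{q \<in> B. \<iota> q = \<alpha> p} = {}" by force
      have "\<alpha> p \<in> {1..n}" using \<alpha> p by blast
      from cc[OF this, unfolded e] have "card {x \<in> A. \<alpha> x = \<alpha> p} = 0" by simp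
      then show False using p fin(1) by auto
    qed
    define \<sigma> where "\<sigma> = restrict (\<lambda>p. inv_into B \<iota> (\<alpha> p)) A"
    have \<sigma>: "\<sigma> p \<in> B" "\<iota> (\<sigma> p) = \<alpha> p" if "p \<in> A" for p
      using that sub[OF that] by (simp_all add: \<sigma>_def inv_into_into f_inv_into_f)
    have "inj_on \<sigma> A"
    proof (rule inj_onI)
      fix p p' assume p: "p \<in> A" "p' \<in> A" "\<sigma> p = \<sigma> p'"
      have e: "\<alpha> p = \<alpha> p'" using \<sigma>(2) p by metis
      have s: "{q \<in> B. \<iota> q = \<alpha> p} = {\<sigma> p}" using \<sigma>[OF p(1)] inj by (auto simp: inj_on_def)
      have "\<alpha> p \<in> {1..n}" using \<alpha> p(1) by blast
      from cc[OF this, unfolded s] have "card {x \<in> A. \<alpha> x = \<alpha> p} = 1" by simp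
      then obtain y where y: "{x \<in> A. \<alpha> x = \<alpha> p} = {y}" by (rule card_1_singletonE)
      have "p \<in> {x \<in> A. \<alpha> x = \<alpha> p}" "p' \<in> {x \<in> A. \<alpha> x = \<alpha> p}" using p e by auto
      then show "p = p'" unfolding y by simp
    qed
    moreover have "\<sigma> ` A = B"
      by (rule card_subset_eq[OF fin(2)]) (use \<sigma> calculation card in \<open>auto simp: card_image\<close>)
    ultimately have "\<sigma> \<in> bijs A B" by (auto simp: bijs_def bij_betw_def \<sigma>_def)
    moreover have "matches A \<sigma> \<alpha> \<iota>" using \<sigma>(2) by (simp add: matches_def)
    ultimately show ?thesis by (intro bexI[of _ \<sigma>])
  qed
  have K: "inv_kernel n A B (\<lambda>\<alpha> \<beta>. D \<alpha> \<beta> - ?S \<alpha> \<beta>)"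
    by (intro inv_kernel_diff D inv_kernel_sum matches_kernel)
  have "D \<alpha> \<iota> - ?S \<alpha> \<iota> = 0" if \<alpha>: "\<alpha> ` A \<subseteq> {1..n}" for \<alpha>
  proof (cases "\<exists>\<sigma>\<in>bijs A B. matches A \<sigma> \<alpha> \<iota>")
    case True
    then obtain \<sigma> where \<sigma>: "\<sigma> \<in> bijs A B" "matches A \<sigma> \<alpha> \<iota>" by (elim bexE)
    have uniq: "\<sigma>' = \<sigma>" if s: "\<sigma>' \<in> bijs A B" "matches A \<sigma>' \<alpha> \<iota>" for \<sigma>'
    proof (rule PiE_ext[of _ A "\<lambda>_. B"])
      show "\<sigma>' \<in> PiE A (\<lambda>_. B)" "\<sigma> \<in> PiE A (\<lambda>_. B)" using s \<sigma> by (auto simp: bijs_def)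
      fix p assume p: "p \<in> A"
      have "\<iota> (\<sigma>' p) = \<iota> (\<sigma> p)" using s(2) \<sigma>(2) p by (simp add: matches_def)
      moreover have "\<sigma>' p \<in> B" "\<sigma> p \<in> B" using s(1) \<sigma>(1) p by (auto simp: bijs_def)
      ultimately show "\<sigma>' p = \<sigma> p" using inj by (simp add: inj_on_def)
    qed
    have "?S \<alpha> \<iota> = (\<Sum>\<sigma>'\<in>bijs A B. if \<sigma>' = \<sigma> then c \<sigma> else 0)"
    proof (rule sum.cong[OF refl])
      fix \<sigma>' assume s: "\<sigma>' \<in> bijs A B"
      show "(if matches A \<sigma>' \<alpha> \<iota> then c \<sigma>' else 0) = (if \<sigma>' = \<sigma> then c \<sigma> else 0)"
        using uniq[OF s] \<sigma>(2) by (cases "matches A \<sigma>' \<alpha> \<iota>") auto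
    qed
    also have "\<dots> = c \<sigma>" using \<sigma>(1) finbij by simp
    also have "c \<sigma> = D \<alpha> \<iota>" unfolding c_def
      by (rule inv_kernelD(1)[OF D]) (use \<sigma>(2) in \<open>auto simp: matches_def\<close>)
    finally show ?thesis by simp
  next
    case False
    then have "D \<alpha> \<iota> = 0" using ex\<sigma> \<alpha> by blast
    moreover have "?S \<alpha> \<iota> = 0" by (rule sum.neutral) (use False in auto)
    ultimately show ?thesis by simp
  qed
  then have "D \<alpha> \<beta> - ?S \<alpha> \<beta> = 0" if "\<alpha> ` A \<subseteq> {1..n}" "\<beta> ` B \<subseteq> {1..n}" for \<alpha> \<beta>
    by (rule inv_kernel_eq_0[OF K fin(2) inj \<iota>n _ that])
  then show ?thesis by (intro exI[of _ c]) simp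
qed

section \<open>Partial contractions\<close>

definition mrg :: "nat set \<Rightarrow> (nat \<Rightarrow> nat) \<Rightarrow> (nat \<Rightarrow> nat) \<Rightarrow> nat \<Rightarrow> nat" where
  "mrg S \<alpha> c = (\<lambda>p. if p \<in> S then c p else \<alpha> p)"

text \<open>The contraction along the pairs \<open>\<tau> q\<close>, \<open>q\<close> without
  inserting the canonical tensors again: the letters on the paired places are summed out and only
  the remaining ones are arguments.\<close>

definition pc :: "nat \<Rightarrow> nat set \<Rightarrow> nat set \<Rightarrow> (nat \<Rightarrow> nat) \<Rightarrow> tens \<Rightarrow> (nat \<Rightarrow> nat) \<Rightarrow> (nat \<Rightarrow> nat) \<Rightarrow> complex" where
  "pc n S S' \<tau> u \<alpha> \<beta> = (\<Sum>c\<in>PiE S (\<lambda>_. {1..n}). u (mrg S \<alpha> c, mrg S' \<beta> (c \<circ> \<tau>)))"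

text \<open>An index pair that agrees along \<open>\<tau>\<close> amounts to its letters on the
  unpaired places together with the common letters on the pairs.\<close>

lemma matched_sum:
  assumes "S \<subseteq> K" "S' \<subseteq> K" "bij_betw \<tau> S' S"
  shows "(\<Sum>z\<in>{z\<in>tidx n K K. \<forall>q\<in>S'. fst z (\<tau> q) = snd z q}. \<phi> z)
    = (\<Sum>\<alpha>\<in>PiE (K - S) (\<lambda>_. {1..n}). \<Sum>\<beta>\<in>PiE (K - S') (\<lambda>_. {1..n}). \<Sum>c\<in>PiE S (\<lambda>_. {1..n}).
        \<phi> (mrg S \<alpha> c, mrg S' \<beta> (c \<circ> \<tau>)))"
    (is "sum \<phi> ?M = _")
proof -
  let ?W = "\<lambda>A. PiE A (\<lambda>_. {1..n})"
  have \<tau>S: "\<tau> q \<in> S" if "q \<in> S'" for q using assms(3) that by (auto simp: bij_betw_def)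
  have "sum \<phi> ?M = (\<Sum>(\<alpha>, \<beta>, c)\<in>?W (K - S) \<times> ?W (K - S') \<times> ?W S. \<phi> (mrg S \<alpha> c, mrg S' \<beta> (c \<circ> \<tau>)))"
  proof (rule sum.reindex_bij_witness[where
        j = "\<lambda>z. (restrict (fst z) (K - S), restrict (snd z) (K - S'), restrict (fst z) S)"
        and i = "\<lambda>(\<alpha>, \<beta>, c). (mrg S \<alpha> c, mrg S' \<beta> (c \<circ> \<tau>))"])
    fix z assume z: "z \<in> ?M"
    then have ab: "fst z \<in> ?W K" "snd z \<in> ?W K" "\<And>q. q \<in> S' \<Longrightarrow> fst z (\<tau> q) = snd z q"
      by (auto simp: tidx_def)
    have 1: "mrg S (restrict (fst z) (K - S)) (restrict (fst z) S) = fst z"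
      using ab(1) assms(1) by (auto simp: fun_eq_iff mrg_def PiE_iff extensional_def)
    have 2: "mrg S' (restrict (snd z) (K - S')) (restrict (fst z) S \<circ> \<tau>) = snd z"
      using ab(2,3) assms(2) \<tau>S by (auto simp: fun_eq_iff mrg_def PiE_iff extensional_def)
    show "(case (restrict (fst z) (K - S), restrict (snd z) (K - S'), restrict (fst z) S) of
        (\<alpha>, \<beta>, c) \<Rightarrow> (mrg S \<alpha> c, mrg S' \<beta> (c \<circ> \<tau>))) = z" using 1 2 by simp
    show "(restrict (fst z) (K - S), restrict (snd z) (K - S'), restrict (fst z) S) \<in> ?W (K - S) \<times> ?W (K - S') \<times> ?W S"
      using ab assms(1) by (auto simp: PiE_iff)
    show "(case (restrict (fst z) (K - S), restrict (snd z) (K - S'), restrict (fst z) S) of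
        (\<alpha>, \<beta>, c) \<Rightarrow> \<phi> (mrg S \<alpha> c, mrg S' \<beta> (c \<circ> \<tau>))) = \<phi> z" using 1 2 by simp
  next
    fix t assume "t \<in> ?W (K - S) \<times> ?W (K - S') \<times> ?W S"
    then obtain \<alpha> \<beta> c where t: "t = (\<alpha>, \<beta>, c)" "\<alpha> \<in> ?W (K - S)" "\<beta> \<in> ?W (K - S')" "c \<in> ?W S" by auto
    have m: "mrg S \<alpha> c \<in> ?W K" using t assms(1) by (auto simp: mrg_def PiE_iff extensional_def)
    have m': "mrg S' \<beta> (c \<circ> \<tau>) \<in> ?W K" using t assms(2) \<tau>S by (auto simp: mrg_def PiE_iff extensional_def)
    show "(case t of (\<alpha>, \<beta>, c) \<Rightarrow> (mrg S \<alpha> c, mrg S' \<beta> (c \<circ> \<tau>))) \<in> ?M"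
      using t m m' \<tau>S by (simp add: tidx_def) (simp add: mrg_def)
    have "restrict (mrg S \<alpha> c) (K - S) = \<alpha>" "restrict (mrg S' \<beta> (c \<circ> \<tau>)) (K - S') = \<beta>" "restrict (mrg S \<alpha> c) S = c"
      using t by (auto simp: fun_eq_iff mrg_def PiE_iff extensional_def)
    then show "(restrict (fst (case t of (\<alpha>, \<beta>, c) \<Rightarrow> (mrg S \<alpha> c, mrg S' \<beta> (c \<circ> \<tau>)))) (K - S),
      restrict (snd (case t of (\<alpha>, \<beta>, c) \<Rightarrow> (mrg S \<alpha> c, mrg S' \<beta> (c \<circ> \<tau>)))) (K - S'),
      restrict (fst (case t of (\<alpha>, \<beta>, c) \<Rightarrow> (mrg S \<alpha> c, mrg S' \<beta> (c \<circ> \<tau>)))) S) = t"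
      using t by simp
  qed
  then show ?thesis by (simp add: sum.cartesian_product split_def)
qed

section \<open>Invariant kernels\<close>

lemma site_bt_Inl: "site (Inl p) i j (bt a b) = (if a p = j then bt (a(p := i)) b else 0)"
  by (auto simp: fun_eq_iff bt_def zero_fun_apply)

lemma site_bt_Inr: "site (Inr q) i j (bt a b) = (if b q = i then smul (-1) (bt a (b(q := j))) else 0)"
  by (auto simp: fun_eq_iff bt_def zero_fun_apply smul_apply)

lemma bt_fsupp: "(a, b) \<in> Z \<Longrightarrow> bt a b \<in> fsupp Z"
  by (auto simp: fsupp_def bt_def)

lemma fsupp_expand:
  assumes "finite Z" "u \<in> fsupp Z"
  shows "u = (\<Sum>z\<in>Z. smul (u z) (bt (fst z) (snd z)))"
proof
  fix y
  have "(\<Sum>z\<in>Z. smul (u z) (bt (fst z) (snd z))) y = (\<Sum>z\<in>Z. if z = y then u y else 0)"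
    unfolding sum_fun_apply by (intro sum.cong refl) (auto simp: smul_apply bt_def)
  also have "\<dots> = u y" using assms by (simp add: fsupp_def sum.delta del: split_paired_All)
  finally show "u y = (\<Sum>z\<in>Z. smul (u z) (bt (fst z) (snd z))) y" by simp
qed

locale tensor_hom =
  fixes n :: nat and K R :: "nat set" and F :: "tens \<Rightarrow> tens"
  assumes finK: "finite K" and finR: "finite R"
    and F_add: "\<lbrakk>u \<in> fsupp (tidx n K K); v \<in> fsupp (tidx n K K)\<rbrakk> \<Longrightarrow> F (u + v) = F u + F v"
    and F_smul: "u \<in> fsupp (tidx n K K) \<Longrightarrow> F (smul c u) = smul c (F u)"
    and F_lact: "\<lbrakk>i \<in> {1..n}; j \<in> {1..n}; u \<in> fsupp (tidx n K K)\<rbrakk> \<Longrightarrow> F (lact K K i j u) = lact R R i j (F u)"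
    and F_in: "u \<in> fsupp (tidx n K K) \<Longrightarrow> F u \<in> fsupp (tidx n R R)"
begin

lemma F_zero: "F 0 = 0"
  using F_smul[of 0 0] fsupp_closed(1)[of "tidx n K K"] by simp

lemma F_sum: "(\<And>x. x \<in> X \<Longrightarrow> f x \<in> fsupp (tidx n K K)) \<Longrightarrow> F (sum f X) = (\<Sum>x\<in>X. F (f x))"
proof (induction X rule: infinite_finite_induct)
  case (insert x X)
  have "F (f x + sum f X) = F (f x) + F (sum f X)"
    by (intro F_add subspace_sum[OF fsupp_subspace]) (use insert.prems in auto)
  then show ?case using insert by simp
qed (simp_all add: F_zero)

lemma F_lact_bt:
  assumes "i \<in> {1..n}" "j \<in> {1..n}" "(a, b) \<in> tidx n K K"
  shows "F (lact K K i j (bt a b)) z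
    = (\<Sum>p\<in>K. if a p = j then F (bt (a(p := i)) b) z else 0) - (\<Sum>q\<in>K. if b q = i then F (bt a (b(q := j))) z else 0)"
proof -
  have site_in: "site s i j (bt a b) \<in> fsupp (tidx n K K)" if "s \<in> K <+> K" for s
    using that assms by (intro site_supp bt_fsupp)
  have upd: "bt a (b(q := j)) \<in> fsupp (tidx n K K)" if "q \<in> K" for q
    using assms that by (intro bt_fsupp) (auto simp: tidx_def intro: PiE_upd)
  have "F (lact K K i j (bt a b)) z = (\<Sum>s\<in>K <+> K. F (site s i j (bt a b)) z)"
    unfolding lact_def by (simp add: F_sum site_in sum_fun_apply del: site.simps)
  also have "\<dots> = (\<Sum>p\<in>K. F (site (Inl p) i j (bt a b)) z) + (\<Sum>q\<in>K. F (site (Inr q) i j (bt a b)) z)"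
    using finK by (simp add: sum.Plus comp_def del: site.simps)
  also have "(\<Sum>p\<in>K. F (site (Inl p) i j (bt a b)) z) = (\<Sum>p\<in>K. if a p = j then F (bt (a(p := i)) b) z else 0)"
    unfolding site_bt_Inl by (intro sum.cong refl) (simp add: F_zero zero_fun_apply)
  also have "(\<Sum>q\<in>K. F (site (Inr q) i j (bt a b)) z) = (\<Sum>q\<in>K. - (if b q = i then F (bt a (b(q := j))) z else 0))"
    unfolding site_bt_Inr by (intro sum.cong refl) (simp add: F_zero zero_fun_apply F_smul upd smul_apply)
  finally show ?thesis by (simp add: sum_negf)
qed

text \<open>Flipping the second tensor factors turns the matrix of an intertwiner into an invariant
  kernel between two powers of the natural module.\<close>

definition kern :: "(nat + nat \<Rightarrow> nat) \<Rightarrow> (nat + nat \<Rightarrow> nat) \<Rightarrow> complex" where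
  "kern \<alpha> \<beta> = F (bt (restrict (\<beta> \<circ> Inl) K) (restrict (\<alpha> \<circ> Inr) K)) (restrict (\<alpha> \<circ> Inl) R, restrict (\<beta> \<circ> Inr) R)"

lemma kern_inv: "inv_kernel n (R <+> K) (K <+> R) kern"
  unfolding inv_kernel_def
proof (intro conjI allI impI)
  fix \<alpha> \<alpha>' \<beta> \<beta>' :: "nat + nat \<Rightarrow> nat"
  assume eq: "\<forall>p\<in>R <+> K. \<alpha> p = \<alpha>' p" "\<forall>q\<in>K <+> R. \<beta> q = \<beta>' q"
  have "restrict (\<beta> \<circ> Inl) K = restrict (\<beta>' \<circ> Inl) K" "restrict (\<alpha> \<circ> Inr) K = restrict (\<alpha>' \<circ> Inr) K"
    "restrict (\<alpha> \<circ> Inl) R = restrict (\<alpha>' \<circ> Inl) R" "restrict (\<beta> \<circ> Inr) R = restrict (\<beta>' \<circ> Inr) R"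
    using eq by (auto intro!: restrict_ext)
  then show "kern \<alpha> \<beta> = kern \<alpha>' \<beta>'" by (simp add: kern_def)
next
  fix \<alpha> \<beta> :: "nat + nat \<Rightarrow> nat" and i j :: nat
  assume \<alpha>: "\<alpha> ` (R <+> K) \<subseteq> {1..n}" and \<beta>: "\<beta> ` (K <+> R) \<subseteq> {1..n}" and ij: "i \<in> {1..n}" "j \<in> {1..n}"
  \<comment> \<open>Output letters are \<open>a\<close> and \<open>b\<close>, input letters
    \<open>a'\<close> and \<open>b'\<close>. The sign at dual places moves their terms to the other
    side of the equation, which leaves the plain invariance relation.\<close>
  define a b a' b' where ab: "a = restrict (\<alpha> \<circ> Inl) R" "b = restrict (\<beta> \<circ> Inr) R"
    "a' = restrict (\<beta> \<circ> Inl) K" "b' = restrict (\<alpha> \<circ> Inr) K"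
  have Z: "(a', b') \<in> tidx n K K"
    using \<alpha> \<beta> by (auto simp: ab tidx_def PiE_iff image_subset_iff)
  have r1: "restrict (f(Inl p := x) \<circ> Inl) A = (restrict (f \<circ> Inl) A)(p := x)" if "p \<in> A"
    for f :: "nat + nat \<Rightarrow> nat" and p x A using that by (auto simp: fun_eq_iff)
  have r2: "restrict (f(Inr p := x) \<circ> Inr) A = (restrict (f \<circ> Inr) A)(p := x)" if "p \<in> A"
    for f :: "nat + nat \<Rightarrow> nat" and p x A using that by (auto simp: fun_eq_iff)
  have r3: "f(Inr p := x) \<circ> Inl = f \<circ> Inl" "f(Inl p := x) \<circ> Inr = f \<circ> Inr"
    for f :: "nat + nat \<Rightarrow> nat" and p x by (auto simp: fun_eq_iff)
  have k1: "kern (\<alpha>(Inl p := j)) \<beta> = F (bt a' b') (a(p := j), b)" if "p \<in> R" for p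
    using that by (simp only: kern_def r1 r3 ab)
  have k2: "kern (\<alpha>(Inr p := j)) \<beta> = F (bt a' (b'(p := j))) (a, b)" if "p \<in> K" for p
    using that by (simp only: kern_def r2 r3 ab)
  have k3: "kern \<alpha> (\<beta>(Inl p := i)) = F (bt (a'(p := i)) b') (a, b)" if "p \<in> K" for p
    using that by (simp only: kern_def r1 r3 ab)
  have k4: "kern \<alpha> (\<beta>(Inr p := i)) = F (bt a' b') (a, b(p := i))" if "p \<in> R" for p
    using that by (simp only: kern_def r2 r3 ab)
  have "F (lact K K i j (bt a' b')) (a, b) = lact R R i j (F (bt a' b')) (a, b)"
    using F_lact[OF ij bt_fsupp[OF Z]] by simp
  then have eq: "(\<Sum>p\<in>K. if a' p = j then F (bt (a'(p := i)) b') (a, b) else 0) - (\<Sum>q\<in>K. if b' q = i then F (bt a' (b'(q := j))) (a, b) else 0)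
    = (\<Sum>p\<in>R. if a p = i then F (bt a' b') (a(p := j), b) else 0) - (\<Sum>q\<in>R. if b q = j then F (bt a' b') (a, b(q := i)) else 0)"
    unfolding F_lact_bt[OF ij Z] lact_apply[OF finR finR] .
  have "(\<Sum>p\<in>R <+> K. if \<alpha> p = i then kern (\<alpha>(p := j)) \<beta> else 0)
    = (\<Sum>p\<in>R. if \<alpha> (Inl p) = i then kern (\<alpha>(Inl p := j)) \<beta> else 0) + (\<Sum>q\<in>K. if \<alpha> (Inr q) = i then kern (\<alpha>(Inr q := j)) \<beta> else 0)"
    using finK finR by (simp add: sum.Plus comp_def)
  also have "(\<Sum>p\<in>R. if \<alpha> (Inl p) = i then kern (\<alpha>(Inl p := j)) \<beta> else 0) = (\<Sum>p\<in>R. if a p = i then F (bt a' b') (a(p := j), b) else 0)"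
    by (intro sum.cong refl) (simp add: k1, simp add: ab)
  also have "(\<Sum>q\<in>K. if \<alpha> (Inr q) = i then kern (\<alpha>(Inr q := j)) \<beta> else 0) = (\<Sum>q\<in>K. if b' q = i then F (bt a' (b'(q := j))) (a, b) else 0)"
    by (intro sum.cong refl) (simp add: k2, simp add: ab)
  also have "(\<Sum>p\<in>R. if a p = i then F (bt a' b') (a(p := j), b) else 0) + (\<Sum>q\<in>K. if b' q = i then F (bt a' (b'(q := j))) (a, b) else 0)
    = (\<Sum>p\<in>K. if a' p = j then F (bt (a'(p := i)) b') (a, b) else 0) + (\<Sum>q\<in>R. if b q = j then F (bt a' b') (a, b(q := i)) else 0)"
    using eq by (simp add: algebra_simps)
  also have "(\<Sum>p\<in>K. if a' p = j then F (bt (a'(p := i)) b') (a, b) else 0) = (\<Sum>q\<in>K. if \<beta> (Inl q) = j then kern \<alpha> (\<beta>(Inl q := i)) else 0)"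
    by (intro sum.cong refl) (simp add: k3, simp add: ab)
  also have "(\<Sum>q\<in>R. if b q = j then F (bt a' b') (a, b(q := i)) else 0) = (\<Sum>q\<in>R. if \<beta> (Inr q) = j then kern \<alpha> (\<beta>(Inr q := i)) else 0)"
    by (intro sum.cong refl) (simp add: k4, simp add: ab)
  also have "(\<Sum>q\<in>K. if \<beta> (Inl q) = j then kern \<alpha> (\<beta>(Inl q := i)) else 0) + (\<Sum>q\<in>R. if \<beta> (Inr q) = j then kern \<alpha> (\<beta>(Inr q := i)) else 0)
    = (\<Sum>q\<in>K <+> R. if \<beta> q = j then kern \<alpha> (\<beta>(q := i)) else 0)"
    using finK finR by (simp add: sum.Plus comp_def)
  finally show "(\<Sum>p\<in>R <+> K. if \<alpha> p = i then kern (\<alpha>(p := j)) \<beta> else 0)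
    = (\<Sum>q\<in>K <+> R. if \<beta> q = j then kern \<alpha> (\<beta>(q := i)) else 0)" .
qed

text \<open>A bijection \<open>R <+> K \<rightarrow> K <+> R\<close> joins at least \<open>card K - card R\<close> pairs inside \<open>K\<close>, and each
  such family of pairs is a partial contraction of the argument.\<close>

lemma hom_vanish:
  assumes RK: "card R \<le> card K" "card K + card R \<le> n"
    and u: "u \<in> fsupp (tidx n K K)"
    and pc0: "\<And>S S' \<tau> \<alpha> \<beta>. S \<subseteq> K \<Longrightarrow> S' \<subseteq> K \<Longrightarrow> bij_betw \<tau> S' S \<Longrightarrow> card S' = card K - card R \<Longrightarrow>
      \<alpha> \<in> PiE (K - S) (\<lambda>_. {1..n}) \<Longrightarrow> \<beta> \<in> PiE (K - S') (\<lambda>_. {1..n}) \<Longrightarrow> pc n S S' \<tau> u \<alpha> \<beta> = 0"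
  shows "F u = 0"
proof -
  let ?A = "R <+> K" and ?B = "K <+> R" and ?Z = "tidx n K K"
  have finZ: "finite ?Z" using finK by (simp add: finite_tidx)
  have "\<exists>c. \<forall>\<alpha> \<beta>. \<alpha> ` ?A \<subseteq> {1..n} \<longrightarrow> \<beta> ` ?B \<subseteq> {1..n} \<longrightarrow>
      kern \<alpha> \<beta> = (\<Sum>\<sigma>\<in>bijs ?A ?B. if matches ?A \<sigma> \<alpha> \<beta> then c \<sigma> else 0)"
    by (rule inv_kernel_permutations[OF kern_inv]) (use finK finR RK in \<open>auto simp: card_Plus\<close>)
  then obtain c where c: "\<And>\<alpha> \<beta>. \<alpha> ` ?A \<subseteq> {1..n} \<Longrightarrow> \<beta> ` ?B \<subseteq> {1..n} \<Longrightarrow>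
      kern \<alpha> \<beta> = (\<Sum>\<sigma>\<in>bijs ?A ?B. if matches ?A \<sigma> \<alpha> \<beta> then c \<sigma> else 0)" by auto
  have vanish: "(\<Sum>z\<in>?Z. if matches ?A \<sigma> (case_sum a (snd z)) (case_sum (fst z) b) then u z else 0) = 0"
    if \<sigma>: "\<sigma> \<in> bijs ?A ?B" for \<sigma> and a b :: "nat \<Rightarrow> nat"
  proof -
    have bij: "bij_betw \<sigma> ?A ?B" using \<sigma> by (simp add: bijs_def)
    have inj: "inj_on \<sigma> ?A" using bij by (simp add: bij_betw_def)
    \<comment> \<open>The dual places that \<open>\<sigma>\<close> joins to a vector place of
      \<open>K\<close>. The other dual places of \<open>K\<close> go injectively into
      \<open>R\<close>, so at least \<open>card K - card R\<close> belong to
      \<open>Q\<close>.\<close>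
    define Q where "Q = {q \<in> K. \<sigma> (Inr q) \<in> Inl ` K}"
    have "card (K - Q) \<le> card R"
    proof -
      have "(\<lambda>q. \<sigma> (Inr q)) ` (K - Q) \<subseteq> Inr ` R"
      proof (rule image_subsetI)
        fix q assume q: "q \<in> K - Q"
        then have "\<sigma> (Inr q) \<in> ?B" using bij by (auto simp: bij_betw_def)
        moreover have "\<sigma> (Inr q) \<notin> Inl ` K" using q by (simp add: Q_def)
        ultimately show "\<sigma> (Inr q) \<in> Inr ` R" by (cases "\<sigma> (Inr q)") auto
      qed
      moreover have "inj_on (\<lambda>q. \<sigma> (Inr q)) (K - Q)"
        using inj by (auto simp: inj_on_def)
      ultimately have "card (K - Q) \<le> card (Inr ` R :: (nat + nat) set)"
        using finR by (intro card_inj_on_le) auto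
      also have "\<dots> = card R" by (rule card_image) simp
      finally show ?thesis .
    qed
    moreover have "card (K - Q) = card K - card Q"
      by (rule card_Diff_subset) (use finK in \<open>auto simp: Q_def\<close>)
    ultimately have "card K - card R \<le> card Q" by linarith
    then obtain S' where S': "S' \<subseteq> Q" "card S' = card K - card R"
      using obtain_subset_with_card_n by metis
    define \<tau> where "\<tau> q = projl (\<sigma> (Inr q))" for q
    have \<tau>: "\<sigma> (Inr q) = Inl (\<tau> q) \<and> \<tau> q \<in> K \<and> q \<in> K" if "q \<in> S'" for q
    proof -
      have "q \<in> K" "\<sigma> (Inr q) \<in> Inl ` K" using that S'(1) by (auto simp: Q_def)
      then show ?thesis by (auto simp: \<tau>_def)
    qed
    define S where "S = \<tau> ` S'"
    have inj\<tau>: "inj_on \<tau> S'"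
    proof (rule inj_onI)
      fix q q' assume q: "q \<in> S'" "q' \<in> S'" "\<tau> q = \<tau> q'"
      then have "\<sigma> (Inr q) = \<sigma> (Inr q')" using \<tau> by metis
      then have "(Inr q :: nat + nat) = Inr q'"
        by (rule inj_onD[OF inj]) (use \<tau>[OF q(1)] \<tau>[OF q(2)] in auto)
      then show "q = q'" by simp
    qed
    have bij\<tau>: "bij_betw \<tau> S' S" using inj\<tau> by (simp add: bij_betw_def S_def)
    have SK: "S \<subseteq> K" "S' \<subseteq> K" using \<tau> by (auto simp: S_def)
    \<comment> \<open>The matching conditions away from the selected pairs do not involve the
      contracted letters. They can be pulled out of the inner sum, which then is a partial
      contraction of \<open>u\<close>.\<close>
    define \<chi> where "\<chi> \<alpha> \<beta> \<longleftrightarrow> (\<forall>p\<in>?A - Inr ` S'. case_sum a \<beta> p = case_sum \<alpha> b (\<sigma> p))" for \<alpha> \<beta> :: "nat \<Rightarrow> nat"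
    have matched: "fst z (\<tau> q) = snd z q" if "matches ?A \<sigma> (case_sum a (snd z)) (case_sum (fst z) b)" "q \<in> S'" for z q
    proof -
      have "Inr q \<in> ?A" using \<tau>[OF that(2)] by (intro InrI) simp
      then have "case_sum a (snd z) (Inr q) = case_sum (fst z) b (\<sigma> (Inr q))"
        using that(1) unfolding matches_def by blast
      then show ?thesis using \<tau>[OF that(2)] by simp
    qed
    have indep: "matches ?A \<sigma> (case_sum a (mrg S' \<beta> (d \<circ> \<tau>))) (case_sum (mrg S \<alpha> d) b) \<longleftrightarrow> \<chi> \<alpha> \<beta>" for \<alpha> \<beta> d
    proof -
      have "case_sum a (mrg S' \<beta> (d \<circ> \<tau>)) (Inr q) = case_sum (mrg S \<alpha> d) b (\<sigma> (Inr q))" if "q \<in> S'" for q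
        using \<tau>[OF that] that by (simp add: mrg_def S_def)
      then have 1: "matches ?A \<sigma> (case_sum a (mrg S' \<beta> (d \<circ> \<tau>))) (case_sum (mrg S \<alpha> d) b) \<longleftrightarrow>
        (\<forall>p\<in>?A - Inr ` S'. case_sum a (mrg S' \<beta> (d \<circ> \<tau>)) p = case_sum (mrg S \<alpha> d) b (\<sigma> p))"
        unfolding matches_def by blast
      have "case_sum a (mrg S' \<beta> (d \<circ> \<tau>)) p = case_sum a \<beta> p" if "p \<in> ?A - Inr ` S'" for p
        using that by (auto simp: mrg_def)
      moreover have "case_sum (mrg S \<alpha> d) b (\<sigma> p) = case_sum \<alpha> b (\<sigma> p)" if p: "p \<in> ?A - Inr ` S'" for p
      proof -
        have "\<sigma> p \<noteq> Inl s" if s: "s \<in> S" for s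
        proof
          assume e: "\<sigma> p = Inl s"
          obtain q where q: "q \<in> S'" "s = \<tau> q" using s by (auto simp: S_def)
          have "\<sigma> p = \<sigma> (Inr q)" using e q \<tau> by simp
          moreover have "p \<in> ?A" "Inr q \<in> ?A" using p \<tau>[OF q(1)] by (blast, intro InrI, simp)
          ultimately have "p = Inr q" by (rule inj_onD[OF inj])
          then show False using p q(1) by simp
        qed
        then show ?thesis by (cases "\<sigma> p") (auto simp: mrg_def)
      qed
      ultimately show ?thesis unfolding 1 \<chi>_def by simp
    qed
    have "(\<Sum>z\<in>?Z. if matches ?A \<sigma> (case_sum a (snd z)) (case_sum (fst z) b) then u z else 0)
      = (\<Sum>z\<in>{z\<in>?Z. \<forall>q\<in>S'. fst z (\<tau> q) = snd z q}. if matches ?A \<sigma> (case_sum a (snd z)) (case_sum (fst z) b) then u z else 0)"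
      by (rule sum.mono_neutral_right[OF finZ]) (use matched in auto)
    also have "\<dots> = (\<Sum>\<alpha>\<in>PiE (K - S) (\<lambda>_. {1..n}). \<Sum>\<beta>\<in>PiE (K - S') (\<lambda>_. {1..n}). \<Sum>d\<in>PiE S (\<lambda>_. {1..n}).
        if \<chi> \<alpha> \<beta> then u (mrg S \<alpha> d, mrg S' \<beta> (d \<circ> \<tau>)) else 0)"
      unfolding matched_sum[OF SK bij\<tau>] fst_conv snd_conv indep ..
    also have "\<dots> = (\<Sum>\<alpha>\<in>PiE (K - S) (\<lambda>_. {1..n}). \<Sum>\<beta>\<in>PiE (K - S') (\<lambda>_. {1..n}). if \<chi> \<alpha> \<beta> then pc n S S' \<tau> u \<alpha> \<beta> else 0)"
      unfolding pc_def by (intro sum.cong refl) auto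
    also have "\<dots> = 0"
      by (intro sum.neutral ballI) (use pc0[OF SK bij\<tau> S'(2)] in auto)
    finally show ?thesis .
  qed
  have "F u (a, b) = 0" if ab: "(a, b) \<in> tidx n R R" for a b
  proof -
    have aR: "a \<in> PiE R (\<lambda>_. {1..n})" and bR: "b \<in> PiE R (\<lambda>_. {1..n})" using ab by (auto simp: tidx_def)
    have Fbt: "F (bt (fst z) (snd z)) (a, b)
        = (\<Sum>\<sigma>\<in>bijs ?A ?B. if matches ?A \<sigma> (case_sum a (snd z)) (case_sum (fst z) b) then c \<sigma> else 0)"
      if z: "z \<in> ?Z" for z
    proof -
      have zK: "fst z \<in> PiE K (\<lambda>_. {1..n})" "snd z \<in> PiE K (\<lambda>_. {1..n})" using z by (auto simp: tidx_def)
      have "restrict (case_sum f g \<circ> Inl) X = f" if "f \<in> PiE X (\<lambda>_. {1..n})" for f g :: "nat \<Rightarrow> nat" and X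
        using that by (auto simp: fun_eq_iff PiE_iff extensional_def)
      moreover have "restrict (case_sum f g \<circ> Inr) X = g" if "g \<in> PiE X (\<lambda>_. {1..n})" for f g :: "nat \<Rightarrow> nat" and X
        using that by (auto simp: fun_eq_iff PiE_iff extensional_def)
      ultimately have "F (bt (fst z) (snd z)) (a, b) = kern (case_sum a (snd z)) (case_sum (fst z) b)"
        using zK aR bR by (simp add: kern_def)
      also have "\<dots> = (\<Sum>\<sigma>\<in>bijs ?A ?B. if matches ?A \<sigma> (case_sum a (snd z)) (case_sum (fst z) b) then c \<sigma> else 0)"
        by (rule c) (use zK aR bR in auto)
      finally show ?thesis .
    qed
    have "F u (a, b) = (\<Sum>z\<in>?Z. u z * F (bt (fst z) (snd z)) (a, b))"
    proof -
      have "F u = F (\<Sum>z\<in>?Z. smul (u z) (bt (fst z) (snd z)))" using fsupp_expand[OF finZ u] by simp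
      also have "\<dots> = (\<Sum>z\<in>?Z. F (smul (u z) (bt (fst z) (snd z))))"
        by (intro F_sum fsupp_closed bt_fsupp) simp
      also have "\<dots> = (\<Sum>z\<in>?Z. smul (u z) (F (bt (fst z) (snd z))))"
        by (intro sum.cong refl F_smul bt_fsupp) simp
      finally show ?thesis by (simp add: sum_fun_apply smul_apply)
    qed
    also have "\<dots> = (\<Sum>z\<in>?Z. \<Sum>\<sigma>\<in>bijs ?A ?B. c \<sigma> * (if matches ?A \<sigma> (case_sum a (snd z)) (case_sum (fst z) b) then u z else 0))"
    proof (rule sum.cong[OF refl])
      fix z assume z: "z \<in> ?Z"
      show "u z * F (bt (fst z) (snd z)) (a, b)
        = (\<Sum>\<sigma>\<in>bijs ?A ?B. c \<sigma> * (if matches ?A \<sigma> (case_sum a (snd z)) (case_sum (fst z) b) then u z else 0))"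
        unfolding Fbt[OF z] sum_distrib_left by (intro sum.cong refl) simp
    qed
    also have "\<dots> = (\<Sum>\<sigma>\<in>bijs ?A ?B. c \<sigma> * (\<Sum>z\<in>?Z. if matches ?A \<sigma> (case_sum a (snd z)) (case_sum (fst z) b) then u z else 0))"
      unfolding sum_distrib_left by (rule sum.swap)
    also have "\<dots> = 0" by (rule sum.neutral, rule ballI) (simp only: vanish mult_zero_right)
    finally show ?thesis .
  qed
  moreover have "F u \<in> fsupp (tidx n R R)" using F_in u .
  ultimately show ?thesis by (auto simp: fsupp_def fun_eq_iff zero_fun_apply)
qed

end

section \<open>Intertwiners between mixed tensor spaces\<close>

text \<open>Reversing the alphabet makes raising on a dual factor into raising on a natural one. The
  truncated subtraction is an involution on letters in \<open>{1..n}\<close>.\<close>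

definition bar :: "nat \<Rightarrow> (nat \<Rightarrow> nat) \<Rightarrow> nat \<Rightarrow> nat" where
  "bar n y = (\<lambda>q. n + 1 - y q)"

text \<open>The highest weight of the rational module labelled by \<open>lam\<close> and
  \<open>mu\<close>: the second partition is negated and reversed.\<close>

definition wgt :: "nat \<Rightarrow> nat list \<Rightarrow> nat list \<Rightarrow> nat \<Rightarrow> int" where
  "wgt n lam mu i = int (part lam i) - int (part mu (n + 1 - i))"

text \<open>The common form of all generators: a function on the vector word, one on the reversed
  dual word, and the canonical invariant on each pair \<open>\<tau> q\<close>, \<open>q\<close>. The
  functions used for \<open>g\<close> and \<open>g'\<close> depend on the unpaired places only, so
  they may be applied to the full words.\<close>

definition capped :: "nat \<Rightarrow> nat set \<Rightarrow> nat set \<Rightarrow> (nat \<Rightarrow> nat) \<Rightarrow> ((nat \<Rightarrow> nat) \<Rightarrow> complex) \<Rightarrow> ((nat \<Rightarrow> nat) \<Rightarrow> complex) \<Rightarrow> tens" where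
  "capped n K S' \<tau> g g' = (\<lambda>(x, y). if (x, y) \<in> tidx n K K \<and> (\<forall>q\<in>S'. x (\<tau> q) = y q) then g x * g' (bar n y) else 0)"

lemma cnt_bar:
  assumes "\<And>q. q \<in> P \<Longrightarrow> y q \<in> {1..n}" "i \<in> {1..n}"
  shows "cnt P (bar n y) (n + 1 - i) = cnt P y i"
proof -
  have "n + 1 - y q = n + 1 - i \<longleftrightarrow> y q = i" if "q \<in> P" for q
    using assms(1)[OF that] assms(2) by auto
  then show ?thesis
    unfolding cnt_def bar_def by (intro arg_cong[where f = card] Collect_cong conj_cong refl)
qed

lemma cnt_split:
  assumes "finite K" "S \<subseteq> K"
  shows "cnt K x i = cnt (K - S) x i + cnt S x i"
proof -
  have "{p \<in> K. x p = i} = {p \<in> K - S. x p = i} \<union> {p \<in> S. x p = i}" using assms(2) by auto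
  then show ?thesis unfolding cnt_def using assms by (simp add: card_Un_disjoint finite_subset disjoint_iff)
qed

lemma cnt_reindex:
  assumes "bij_betw \<tau> S' S" "\<And>q. q \<in> S' \<Longrightarrow> x (\<tau> q) = y q"
  shows "cnt S x i = cnt S' y i"
proof -
  have "{p \<in> S. x p = i} = \<tau> ` {q \<in> S'. y q = i}"
    using assms by (force simp: bij_betw_def)
  moreover have "inj_on \<tau> {q \<in> S'. y q = i}" using assms(1) by (auto simp: bij_betw_def inj_on_def)
  ultimately show ?thesis by (simp add: cnt_def card_image)
qed

lemma wt_cnt: "wt K K (x, y) i = int (cnt K x i) - int (cnt K y i)"
  by (simp add: wt_def cnt_def)

lemma capped_fsupp: "capped n K S' \<tau> g g' \<in> fsupp (tidx n K K)"
  by (auto simp: fsupp_def capped_def)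

text \<open>The three ingredients are treated separately: the two functions are killed by their
  highest weight property, where reversal turns \<open>(i, j)\<close> into
  \<open>(n + 1 - j, n + 1 - i)\<close>, and on the pairs the vector and dual terms cancel. Paired
  letters cancel in the weight as well.\<close>

lemma capped_maxvec:
  assumes fin: "finite K" and S: "S \<subseteq> K" "S' \<subseteq> K" "bij_betw \<tau> S' S"
    and g: "hw_word lam (K - S) g" and g': "hw_word mu (K - S') g'"
  shows "gl_module.maxvec n (tidx n K K) (lact K K) (\<lambda>i. of_int (wgt n lam mu i)) (capped n K S' \<tau> g g')"
proof -
  interpret tensor_module n K K by unfold_locales (use fin in auto)
  let ?u = "capped n K S' \<tau> g g'"
  have \<tau>S: "\<tau> q \<in> S" if "q \<in> S'" for q using S(3) that by (auto simp: bij_betw_def)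
  have \<tau>i: "\<tau> q = \<tau> q' \<longleftrightarrow> q = q'" if "q \<in> S'" "q' \<in> S'" for q q'
    using S(3) that by (auto simp: bij_betw_def inj_on_def)
  have finS: "finite S" "finite S'" using fin S by (auto intro: finite_subset)
  have low: "lact K K i j ?u = 0" if ij: "i \<in> {1..n}" "j \<in> {1..n}" "i < j" for i j
  proof (rule ext, clarify)
    fix x y
    show "lact K K i j ?u (x, y) = 0 (x, y)"
    proof (cases "(x, y) \<in> tidx n K K")
      case False
      have "lact K K i j ?u \<in> fsupp (tidx n K K)" by (rule E_supp[OF ij(1,2) capped_fsupp])
      then show ?thesis using False by (simp add: fsupp_def zero_fun_apply)
    next
      case True
      have in1: "(x(p := j), y) \<in> tidx n K K" "(x, y(p := i)) \<in> tidx n K K" if "p \<in> K" for p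
        using True that ij by (auto simp: tidx_def intro: PiE_upd)
      have yn: "y q \<in> {1..n}" if "q \<in> K" for q using True that by (auto simp: tidx_def)
      let ?m = "\<forall>q\<in>S'. x (\<tau> q) = y q"
      have A: "(\<Sum>p\<in>K - S. if x p = i then ?u (x(p := j), y) else 0) = 0"
      proof -
        have "(\<Sum>p\<in>K - S. if x p = i then ?u (x(p := j), y) else 0)
          = (\<Sum>p\<in>K - S. (if ?m then g' (bar n y) else 0) * (if x p = i then g (x(p := j)) else 0))"
        proof (rule sum.cong[OF refl])
          fix p assume p: "p \<in> K - S"
          have "(\<forall>q\<in>S'. (x(p := j)) (\<tau> q) = y q) \<longleftrightarrow> ?m" using p \<tau>S by auto
          then show "(if x p = i then ?u (x(p := j), y) else 0)
            = (if ?m then g' (bar n y) else 0) * (if x p = i then g (x(p := j)) else 0)"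
            using p in1 by (simp add: capped_def)
        qed
        also have "\<dots> = 0"
          unfolding sum_distrib_left[symmetric] using hw_wordD(1)[OF g, of i j x] ij by simp
        finally show ?thesis .
      qed
      have B: "(\<Sum>q\<in>K - S'. if y q = j then ?u (x, y(q := i)) else 0) = 0"
      proof -
        have "(\<Sum>q\<in>K - S'. if y q = j then ?u (x, y(q := i)) else 0)
          = (\<Sum>q\<in>K - S'. (if ?m then g x else 0) * (if bar n y q = n + 1 - j then g' ((bar n y)(q := n + 1 - i)) else 0))"
        proof (rule sum.cong[OF refl])
          fix q assume q: "q \<in> K - S'"
          have 1: "(\<forall>r\<in>S'. x (\<tau> r) = (y(q := i)) r) \<longleftrightarrow> ?m" using q by auto
          have 2: "bar n (y(q := i)) = (bar n y)(q := n + 1 - i)" by (auto simp: bar_def fun_eq_iff)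
          have 3: "bar n y q = n + 1 - j \<longleftrightarrow> y q = j" using yn[of q] q ij by (auto simp: bar_def)
          show "(if y q = j then ?u (x, y(q := i)) else 0)
            = (if ?m then g x else 0) * (if bar n y q = n + 1 - j then g' ((bar n y)(q := n + 1 - i)) else 0)"
            unfolding 3 using q in1 1 2 by (simp add: capped_def)
        qed
        also have "\<dots> = 0"
          unfolding sum_distrib_left[symmetric]
          using hw_wordD(1)[OF g', of "n + 1 - j" "n + 1 - i" "bar n y"] ij by simp
        finally show ?thesis .
      qed
      have C: "(\<Sum>p\<in>S. if x p = i then ?u (x(p := j), y) else 0) = (\<Sum>q\<in>S'. if y q = j then ?u (x, y(q := i)) else 0)"
      proof -
        have "(\<Sum>p\<in>S. if x p = i then ?u (x(p := j), y) else 0) = (\<Sum>q\<in>S'. if x (\<tau> q) = i then ?u (x(\<tau> q := j), y) else 0)"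
          by (rule sum.reindex_bij_betw[OF S(3), symmetric])
        also have "\<dots> = (\<Sum>q\<in>S'. if y q = j then ?u (x, y(q := i)) else 0)"
        proof (rule sum.cong[OF refl])
          fix q assume q: "q \<in> S'"
          have qK: "q \<in> K" "\<tau> q \<in> K" using q S \<tau>S by auto
          define M1 M2 where "M1 \<longleftrightarrow> (\<forall>r\<in>S'. (x(\<tau> q := j)) (\<tau> r) = y r)"
            and "M2 \<longleftrightarrow> (\<forall>r\<in>S'. x (\<tau> r) = (y(q := i)) r)"
          have eq: "x (\<tau> q) = i \<and> M1 \<longleftrightarrow> y q = j \<and> M2"
            unfolding M1_def M2_def using q \<tau>i by auto
          have gx: "g (x(\<tau> q := j)) = g x" by (rule hw_wordD(3)[OF g]) (use q \<tau>S in auto)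
          have gy: "g' (bar n (y(q := i))) = g' (bar n y)"
            by (rule hw_wordD(3)[OF g']) (use q in \<open>auto simp: bar_def\<close>)
          have u1: "?u (x(\<tau> q := j), y) = (if M1 then g x * g' (bar n y) else 0)"
            by (simp only: capped_def split_conv in1(1)[OF qK(2)] M1_def gx simp_thms)
          have u2: "?u (x, y(q := i)) = (if M2 then g x * g' (bar n y) else 0)"
            by (simp only: capped_def split_conv in1(2)[OF qK(1)] M2_def gy simp_thms)
          show "(if x (\<tau> q) = i then ?u (x(\<tau> q := j), y) else 0) = (if y q = j then ?u (x, y(q := i)) else 0)"
            unfolding u1 u2 using eq by (cases "x (\<tau> q) = i"; cases "y q = j"; cases M1; cases M2) simp_all
        qed
        finally show ?thesis .
      qed
      have sp: "sum f K = sum f (K - X) + sum f X" if "X \<subseteq> K" for f :: "nat \<Rightarrow> complex" and X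
        using sum.subset_diff[OF that fin] .
      have X: "(\<Sum>p\<in>K. if x p = i then ?u (x(p := j), y) else 0) = (\<Sum>p\<in>S. if x p = i then ?u (x(p := j), y) else 0)"
        by (subst sp[OF S(1)]) (simp only: A add_0)
      have Y: "(\<Sum>q\<in>K. if y q = j then ?u (x, y(q := i)) else 0) = (\<Sum>q\<in>S'. if y q = j then ?u (x, y(q := i)) else 0)"
        by (subst sp[OF S(2)]) (simp only: B add_0)
      show ?thesis by (simp only: lact_apply[OF fin fin] X Y C diff_self zero_fun_apply)
    qed
  qed
  have "\<forall>i\<in>{1..n}. lact K K i i ?u = smul (of_int (wgt n lam mu i)) ?u"
    unfolding weight_vector_iff
  proof (intro allI impI ballI)
    fix z i assume z: "?u z \<noteq> 0" and i: "i \<in> {1..n}"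
    obtain x y where xy: "z = (x, y)" by (cases z)
    have if_nz: "(if c then d else 0) \<noteq> 0 \<longleftrightarrow> c \<and> d \<noteq> 0" for c and d :: complex by simp
    have "((x, y) \<in> tidx n K K \<and> (\<forall>q\<in>S'. x (\<tau> q) = y q)) \<and> g x * g' (bar n y) \<noteq> 0"
      using z unfolding xy capped_def split_conv if_nz .
    then have m: "(x, y) \<in> tidx n K K" "\<forall>q\<in>S'. x (\<tau> q) = y q" and nz: "g x \<noteq> 0" "g' (bar n y) \<noteq> 0"
      by auto
    have "cnt (K - S) x i = part lam i" using nz(1) by (rule hw_wordD(2)[OF g])
    moreover have "cnt (K - S') (bar n y) (n + 1 - i) = part mu (n + 1 - i)"
      using nz(2) by (rule hw_wordD(2)[OF g'])
    moreover have "cnt (K - S') (bar n y) (n + 1 - i) = cnt (K - S') y i"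
    proof (rule cnt_bar[OF _ i])
      fix q assume "q \<in> K - S'"
      then have qK: "q \<in> K" by (rule DiffD1)
      have "y \<in> PiE K (\<lambda>_. {1..n})" using m(1) unfolding tidx_def by (rule SigmaD2)
      from PiE_mem[OF this qK] show "y q \<in> {1..n}" .
    qed
    moreover have "cnt S x i = cnt S' y i"
    proof (rule cnt_reindex[OF S(3)])
      fix q assume "q \<in> S'"
      then show "x (\<tau> q) = y q" using m(2) by blast
    qed
    ultimately have "wt K K z i = wgt n lam mu i"
      using cnt_split[OF fin S(1), of x i] cnt_split[OF fin S(2), of y i]
      unfolding xy wt_cnt wgt_def by linarith
    then show "complex_of_int (wt K K z i) = complex_of_int (wgt n lam mu i)" by (simp only:)
  qed
  then show ?thesis using low capped_fsupp[of n K S' \<tau> g g'] unfolding maxvec_def by (intro conjI ballI impI) auto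
qed

text \<open>A contraction of two places with equal letters replaces these letters by the sum over
  all equal letters. The pairs are disjoint, so the steps do not interfere and the coefficients form
  an indicator function.\<close>

lemma cst_bt:
  assumes "(a, b) \<in> Idx n k" "distinct (map fst L)" "distinct (map snd L)"
    "\<And>i j. (i, j) \<in> set L \<Longrightarrow> i \<in> {1..k} \<and> j \<in> {1..k} \<and> a i = b j"
  shows "foldr (\<lambda>(i, j) f. contr n k i j \<circ> f) L id (bt a b) (x, y) =
    (if (x, y) \<in> Idx n k \<and> (\<forall>(i, j)\<in>set L. x i = y j) \<and> (\<forall>p\<in>{1..k} - fst ` set L. x p = a p)
      \<and> (\<forall>q\<in>{1..k} - snd ` set L. y q = b q) then 1 else 0)"
  using assms(2-4)
proof (induction L arbitrary: x y)
  case Nil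
  have "(x, y) = (a, b) \<longleftrightarrow> (x, y) \<in> Idx n k \<and> (\<forall>p\<in>{1..k}. x p = a p) \<and> (\<forall>q\<in>{1..k}. y q = b q)"
  proof
    assume "(x, y) \<in> Idx n k \<and> (\<forall>p\<in>{1..k}. x p = a p) \<and> (\<forall>q\<in>{1..k}. y q = b q)"
    then have "x = a" "y = b"
      using assms(1) PiE_ext[of x "{1..k}" "\<lambda>_. {1..n}" a] PiE_ext[of y "{1..k}" "\<lambda>_. {1..n}" b]
      unfolding Idx_def by blast+
    then show "(x, y) = (a, b)" by simp
  qed (use assms(1) in auto)
  then show ?case by (simp add: bt_def)
next
  case (Cons ij L)
  obtain i j where ij: "ij = (i, j)" by (cases ij)
  have iK: "i \<in> {1..k}" "j \<in> {1..k}" "a i = b j" using Cons.prems(3)[of i j] by (auto simp: ij)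
  have nin: "i \<notin> fst ` set L" "j \<notin> snd ` set L" using Cons.prems(1,2) by (auto simp: ij)
  let ?v = "foldr (\<lambda>(i, j) f. contr n k i j \<circ> f) L id (bt a b)"
  let ?rest = "\<lambda>x y. (\<forall>(i, j)\<in>set L. x i = y j) \<and> (\<forall>p\<in>{1..k} - insert i (fst ` set L). x p = a p)
      \<and> (\<forall>q\<in>{1..k} - insert j (snd ` set L). y q = b q)"
  have ai: "a i \<in> {1..n}" using assms(1) iK(1) by (auto simp: Idx_def)
  have v: "?v (x(i := m), y(j := m)) = (if m = a i \<and> ?rest x y then 1 else 0)"
    if "(x, y) \<in> Idx n k" "m \<in> {1..n}" for m
  proof -
    have Z: "(x(i := m), y(j := m)) \<in> Idx n k" using that iK by (auto simp: Idx_def intro: PiE_upd)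
    have 1: "(\<forall>(i', j')\<in>set L. (x(i := m)) i' = (y(j := m)) j') \<longleftrightarrow> (\<forall>(i', j')\<in>set L. x i' = y j')"
      using nin by (intro ball_cong refl) force
    have 2: "(\<forall>p\<in>{1..k} - fst ` set L. (x(i := m)) p = a p) \<longleftrightarrow>
        m = a i \<and> (\<forall>p\<in>{1..k} - insert i (fst ` set L). x p = a p)"
      using nin iK by auto
    have 3: "(\<forall>q\<in>{1..k} - snd ` set L. (y(j := m)) q = b q) \<longleftrightarrow>
        m = b j \<and> (\<forall>q\<in>{1..k} - insert j (snd ` set L). y q = b q)"
      using nin iK by auto
    have "?v (x(i := m), y(j := m)) = (if (x(i := m), y(j := m)) \<in> Idx n k \<and> (\<forall>(i', j')\<in>set L. (x(i := m)) i' = (y(j := m)) j')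
      \<and> (\<forall>p\<in>{1..k} - fst ` set L. (x(i := m)) p = a p) \<and> (\<forall>q\<in>{1..k} - snd ` set L. (y(j := m)) q = b q) then 1 else 0)"
      by (rule Cons.IH) (use Cons.prems in auto)
    then show ?thesis unfolding 1 2 3 using Z iK(3) by auto
  qed
  have "foldr (\<lambda>(i, j) f. contr n k i j \<circ> f) (ij # L) id (bt a b) (x, y)
    = (if (x, y) \<in> Idx n k \<and> x i = y j then \<Sum>m\<in>{1..n}. ?v (x(i := m), y(j := m)) else 0)"
    by (simp add: ij contr_def)
  also have "\<dots> = (if (x, y) \<in> Idx n k \<and> x i = y j then \<Sum>m\<in>{1..n}. (if m = a i then if ?rest x y then 1 else 0 else 0) else 0)"
    using v by (intro if_cong refl sum.cong) auto
  also have "\<dots> = (if (x, y) \<in> Idx n k \<and> x i = y j \<and> ?rest x y then 1 else 0)"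
    using ai by (simp add: sum.delta)
  also have "\<dots> = (if (x, y) \<in> Idx n k \<and> (\<forall>(i, j)\<in>set (ij # L). x i = y j) \<and> (\<forall>p\<in>{1..k} - fst ` set (ij # L). x p = a p)
      \<and> (\<forall>q\<in>{1..k} - snd ` set (ij # L). y q = b q) then 1 else 0)"
    by (simp add: ij)
  finally show ?case .
qed

lemma PiE_permute_iff:
  assumes "\<sigma> permutes P" "P \<subseteq> K"
  shows "x \<circ> \<sigma> \<in> PiE K (\<lambda>_. W) \<longleftrightarrow> x \<in> PiE K (\<lambda>_. W)"
proof -
  have s: "\<sigma> permutes K" using permutes_subset[OF assms] .
  have dir: "x \<circ> \<sigma> \<in> PiE K (\<lambda>_. W)" if "x \<in> PiE K (\<lambda>_. W)" "\<sigma> permutes K" for x and \<sigma> :: "'a \<Rightarrow> 'a"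
    using that permutes_in_image[OF that(2)] permutes_not_in[OF that(2)] by (auto simp: PiE_iff extensional_def)
  have "(x \<circ> \<sigma>) \<circ> inv \<sigma> = x" using permutes_inverses(1)[OF s] by (auto simp: fun_eq_iff)
  then show ?thesis using dir[OF _ s] dir[OF _ permutes_inv[OF s]] by metis
qed

lemma yV_apply: "yV lam T u (a, b) = (\<Sum>\<rho>\<in>row_perms lam T. \<Sum>\<gamma>\<in>col_perms lam T. of_int (sign \<gamma>) * u (a \<circ> \<rho> \<circ> \<gamma>, b))"
  by (simp add: yV_def sum_fun_apply placeV_def smul_apply)

lemma yW_apply: "yW lam T u (a, b) = (\<Sum>\<rho>\<in>row_perms lam T. \<Sum>\<gamma>\<in>col_perms lam T. of_int (sign \<gamma>) * u (a, b \<circ> \<rho> \<circ> \<gamma>))"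
  by (simp add: yW_def sum_fun_apply placeW_def smul_apply)

lemma (in tableau) fT_expand:
  "complex_of_int (fT x) = (\<Sum>\<rho>\<in>RT. \<Sum>\<gamma>\<in>CT. of_int (sign \<gamma>) * (if \<forall>p\<in>P. (x \<circ> \<rho> \<circ> \<gamma>) p = row p then 1 else 0))"
  unfolding fT_def eT_def of_int_sum by (intro sum.cong refl) simp

text \<open>The auxiliary letters beyond \<open>sum_list lam\<close> in \<open>xprime\<close> make
  paired letters equal and disappear in the contraction. The symmetrizers move unpaired places only,
  so they respect the matching condition and turn the two row words into the functions
  \<open>fT\<close>.\<close>

lemma generator_formula:
  assumes T: "tableau lam P T" and Ts: "tableau mu P' Ts"
    and len: "length mu \<le> n" "2 * k \<le> n"
    and s: "distinct s" "set s \<subseteq> {1..k}" "P = {1..k} - set s"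
    and t: "distinct t" "set t \<subseteq> {1..k}" "P' = {1..k} - set t" "length s = length t"
    and r: "sum_list lam + length s \<le> k" "length lam \<le> n"
    and \<tau>: "\<And>i. i < length t \<Longrightarrow> \<tau> (t ! i) = s ! i"
  shows "yV lam T (yW mu Ts (cst n k s t (xprime n k lam T mu Ts s t)))
    = capped n {1..k} (set t) \<tau> (\<lambda>x. of_int (tableau.fT lam P T x)) (\<lambda>y. of_int (tableau.fT mu P' Ts y))"
proof (rule ext, clarify)
  fix x y
  interpret A: tableau lam P T by fact
  interpret B: tableau mu P' Ts by fact
  let ?K = "{1..k}"
  define a where "a = (\<lambda>p. if p \<in> ?K then if p \<in> set s then sum_list lam + pos s p else A.row p else undefined)"
  define b where "b = (\<lambda>p. if p \<in> ?K then if p \<in> set t then sum_list lam + pos t p else n + 1 - B.row p else undefined)"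
  have xp: "xprime n k lam T mu Ts s t = bt a b"
    unfolding xprime_def Let_def a_def b_def ..
  have posn: "pos l (l ! i) = Suc i" if "distinct l" "i < length l" for l :: "nat list" and i
    using that unfolding pos_def by (auto intro!: arg_cong[where f = Suc] the_equality simp: nth_eq_iff_index_eq)
  have Arow: "A.row p \<in> {1..n}" if "p \<in> P" for p
    using tab_pos(1)[OF A.bij that] r(2) by (auto simp: cells_def)
  have Brow: "B.row p \<in> {1..n}" if "p \<in> P'" for p
    using tab_pos(1)[OF B.bij that] len(1) by (auto simp: cells_def)
  \<comment> \<open>The auxiliary letters stay in the alphabet because
    \<open>sum_list lam + length s \<le> k\<close> and \<open>2 * k \<le> n\<close>.\<close>
  have a_in: "a p \<in> {1..n}" if "p \<in> ?K" for p
  proof (cases "p \<in> set s")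
    case True
    then obtain i where "i < length s" "p = s ! i" by (auto simp: in_set_conv_nth)
    then show ?thesis using that True posn[OF s(1)] r len(2) by (simp add: a_def)
  next
    case False
    then show ?thesis using that Arow[of p] s(3) by (simp add: a_def)
  qed
  have b_in: "b p \<in> {1..n}" if "p \<in> ?K" for p
  proof (cases "p \<in> set t")
    case True
    then obtain i where "i < length t" "p = t ! i" by (auto simp: in_set_conv_nth)
    then show ?thesis using that True posn[OF t(1)] r len(2) t(4) by (simp add: b_def)
  next
    case False
    then show ?thesis using that Brow[of p] t(3) by (auto simp: b_def)
  qed
  have aP: "a p = A.row p" if "p \<in> P" for p using that by (simp add: a_def s(3))
  have bP: "b p = n + 1 - B.row p" if "p \<in> P'" for p using that by (simp add: b_def t(3))
  have abI: "(a, b) \<in> Idx n k"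
    unfolding Idx_def using a_in b_in by (auto simp: PiE_iff extensional_def a_def b_def)
  have zipL: "fst ` set (zip s t) = set s" "snd ` set (zip s t) = set t" "map fst (zip s t) = s" "map snd (zip s t) = t"
    using t(4) by (metis map_fst_zip list.set_map, metis map_snd_zip list.set_map, simp_all)
  have cst: "cst n k s t (bt a b) (x, y) = (if (x, y) \<in> Idx n k \<and> (\<forall>(i, j)\<in>set (zip s t). x i = y j)
      \<and> (\<forall>p\<in>P. x p = A.row p) \<and> (\<forall>q\<in>P'. y q = n + 1 - B.row q) then 1 else 0)" for x y
  proof -
    have "cst n k s t (bt a b) (x, y) = (if (x, y) \<in> Idx n k \<and> (\<forall>(i, j)\<in>set (zip s t). x i = y j)
      \<and> (\<forall>p\<in>?K - fst ` set (zip s t). x p = a p) \<and> (\<forall>q\<in>?K - snd ` set (zip s t). y q = b q) then 1 else 0)"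
      unfolding cst_def
    proof (rule cst_bt[OF abI])
      show "distinct (map fst (zip s t))" "distinct (map snd (zip s t))" using zipL s t by simp_all
      fix i j assume "(i, j) \<in> set (zip s t)"
      then obtain l where l: "l < length s" "i = s ! l" "j = t ! l" using t(4) by (auto simp: set_zip)
      then have ij: "i \<in> set s" "j \<in> set t" using t(4) by auto
      then have K: "i \<in> ?K" "j \<in> ?K" using s(2) t(2) by blast+
      have "pos s i = pos t j" using posn[OF s(1) l(1)] posn[OF t(1), of l] l t(4) by simp
      then have "a i = b j" using ij K by (simp add: a_def b_def)
      then show "i \<in> ?K \<and> j \<in> ?K \<and> a i = b j" using K by blast
    qed
    moreover have "(\<forall>p\<in>?K - fst ` set (zip s t). x p = a p) \<longleftrightarrow> (\<forall>p\<in>P. x p = A.row p)"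
      unfolding zipL s(3)[symmetric] by (intro ball_cong refl) (simp only: aP)
    moreover have "(\<forall>q\<in>?K - snd ` set (zip s t). y q = b q) \<longleftrightarrow> (\<forall>q\<in>P'. y q = n + 1 - B.row q)"
      unfolding zipL t(3)[symmetric] by (intro ball_cong refl) (simp only: bP)
    ultimately show ?thesis by simp
  qed
  have match: "(\<forall>(i, j)\<in>set (zip s t). x i = y j) \<longleftrightarrow> (\<forall>q\<in>set t. x (\<tau> q) = y q)" for x y :: "nat \<Rightarrow> nat"
    unfolding set_zip all_set_conv_all_nth using \<tau> t(4) by auto
  have \<tau>s: "\<tau> q \<in> set s" if "q \<in> set t" for q using that \<tau> t(4) by (auto simp: in_set_conv_nth)
  let ?C = "(x, y) \<in> Idx n k \<and> (\<forall>q\<in>set t. x (\<tau> q) = y q)"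
  \<comment> \<open>The permutations fix the paired places, so membership and matching are unchanged
    and the conditions on the two words separate into a product.\<close>
  have term_eq: "cst n k s t (bt a b) (x \<circ> \<rho> \<circ> \<gamma>, y \<circ> \<rho>' \<circ> \<gamma>') =
     (if ?C then (if \<forall>p\<in>P. (x \<circ> \<rho> \<circ> \<gamma>) p = A.row p then 1 else 0) * (if \<forall>q\<in>P'. (bar n y \<circ> \<rho>' \<circ> \<gamma>') q = B.row q then 1 else 0) else 0)"
    if p: "\<rho> \<in> A.RT" "\<gamma> \<in> A.CT" "\<rho>' \<in> B.RT" "\<gamma>' \<in> B.CT" for \<rho> \<gamma> \<rho>' \<gamma>'
  proof -
    have perm: "\<rho> permutes P" "\<gamma> permutes P" "\<rho>' permutes P'" "\<gamma>' permutes P'"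
      using p by (auto simp: A.RT_iff A.CT_iff B.RT_iff B.CT_iff)
    have PK: "P \<subseteq> ?K" "P' \<subseteq> ?K" using s(3) t(3) by auto
    have I: "(x \<circ> \<rho> \<circ> \<gamma>, y \<circ> \<rho>' \<circ> \<gamma>') \<in> Idx n k \<longleftrightarrow> (x, y) \<in> Idx n k"
      unfolding Idx_def mem_Times_iff fst_conv snd_conv
      by (simp only: PiE_permute_iff[OF perm(1) PK(1)] PiE_permute_iff[OF perm(2) PK(1)]
        PiE_permute_iff[OF perm(3) PK(2)] PiE_permute_iff[OF perm(4) PK(2)])
    have fx: "(x \<circ> \<rho> \<circ> \<gamma>) i = x i" if "i \<in> set s" for i
      using that perm s(3) by (simp add: permutes_def)
    have fy: "(y \<circ> \<rho>' \<circ> \<gamma>') i = y i" if "i \<in> set t" for i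
      using that perm t(3) by (simp add: permutes_def)
    have M: "(\<forall>q\<in>set t. (x \<circ> \<rho> \<circ> \<gamma>) (\<tau> q) = (y \<circ> \<rho>' \<circ> \<gamma>') q) \<longleftrightarrow> (\<forall>q\<in>set t. x (\<tau> q) = y q)"
      by (intro ball_cong refl) (simp only: fx[OF \<tau>s] fy)
    have Y: "(\<forall>q\<in>P'. (y \<circ> \<rho>' \<circ> \<gamma>') q = n + 1 - B.row q) \<longleftrightarrow> (\<forall>q\<in>P'. (bar n y \<circ> \<rho>' \<circ> \<gamma>') q = B.row q)"
      if "(x, y) \<in> Idx n k"
    proof (rule ball_cong[OF refl])
      fix q assume q: "q \<in> P'"
      have "\<rho>' (\<gamma>' q) \<in> P'" using q perm(3,4) by (simp add: permutes_in_image)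
      then have "y (\<rho>' (\<gamma>' q)) \<in> {1..n}" using that PK(2) by (auto simp: Idx_def)
      then show "(y \<circ> \<rho>' \<circ> \<gamma>') q = n + 1 - B.row q \<longleftrightarrow> (bar n y \<circ> \<rho>' \<circ> \<gamma>') q = B.row q"
        using Brow[OF q] by (auto simp: bar_def)
    qed
    show ?thesis unfolding cst match I M using Y by auto
  qed
  have "yV lam T (yW mu Ts (cst n k s t (bt a b))) (x, y)
    = (\<Sum>\<rho>\<in>A.RT. \<Sum>\<gamma>\<in>A.CT. of_int (sign \<gamma>) * (\<Sum>\<rho>'\<in>B.RT. \<Sum>\<gamma>'\<in>B.CT. of_int (sign \<gamma>') * cst n k s t (bt a b) (x \<circ> \<rho> \<circ> \<gamma>, y \<circ> \<rho>' \<circ> \<gamma>')))"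
    unfolding yV_apply yW_apply ..
  also have "\<dots> = (\<Sum>\<rho>\<in>A.RT. \<Sum>\<gamma>\<in>A.CT. of_int (sign \<gamma>) * (\<Sum>\<rho>'\<in>B.RT. \<Sum>\<gamma>'\<in>B.CT. of_int (sign \<gamma>') *
      (if ?C then (if \<forall>p\<in>P. (x \<circ> \<rho> \<circ> \<gamma>) p = A.row p then 1 else 0) * (if \<forall>q\<in>P'. (bar n y \<circ> \<rho>' \<circ> \<gamma>') q = B.row q then 1 else 0) else 0)))"
    by (intro sum.cong refl arg_cong2[where f = "(*)"] term_eq)
  also have "\<dots> = (if ?C then (\<Sum>\<rho>\<in>A.RT. \<Sum>\<gamma>\<in>A.CT. of_int (sign \<gamma>) * (if \<forall>p\<in>P. (x \<circ> \<rho> \<circ> \<gamma>) p = A.row p then 1 else 0))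
      * (\<Sum>\<rho>'\<in>B.RT. \<Sum>\<gamma>'\<in>B.CT. of_int (sign \<gamma>') * (if \<forall>q\<in>P'. (bar n y \<circ> \<rho>' \<circ> \<gamma>') q = B.row q then 1 else 0)) else 0)"
  proof (cases ?C)
    case True
    show ?thesis
      unfolding if_P[OF True] sum_distrib_right unfolding sum_distrib_left
      by (intro sum.cong refl) (simp only: mult_ac)
  next
    case False
    show ?thesis unfolding if_not_P[OF False] by simp
  qed
  also have "\<dots> = capped n ?K (set t) \<tau> (\<lambda>x. of_int (A.fT x)) (\<lambda>y. of_int (B.fT y)) (x, y)"
    unfolding A.fT_expand[symmetric] B.fT_expand[symmetric] capped_def split_conv tidx_Idx ..
  finally show "yV lam T (yW mu Ts (cst n k s t (xprime n k lam T mu Ts s t))) (x, y) = \<dots>"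
    unfolding xp .
qed

section \<open>Generators and pairings\<close>

lemma cnt_neq_0: "finite X \<Longrightarrow> p \<in> X \<Longrightarrow> \<alpha> p = i \<Longrightarrow> cnt X \<alpha> i \<noteq> 0"
  by (auto simp: cnt_def)

lemma part_eq_0: "length lam < i \<Longrightarrow> part lam i = 0"
  by (simp add: part_def)

lemma sum_part: "length lam \<le> n \<Longrightarrow> (\<Sum>i\<in>{1..n}. part lam i) = sum_list lam"
proof -
  assume len: "length lam \<le> n"
  have "(\<Sum>i\<in>{1..n}. part lam i) = (\<Sum>i\<in>{1..length lam}. lam ! (i - 1))"
    by (rule sum.mono_neutral_cong_right) (use len in \<open>auto simp: part_def\<close>)
  also have "\<dots> = (\<Sum>i\<in>{0..<length lam}. lam ! i)"
    by (rule sum.reindex_bij_witness[of _ Suc "\<lambda>i. i - 1"]) auto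
  finally show ?thesis by (simp add: sum_list_sum_nth)
qed

lemma sum_cnt:
  assumes "finite P" "\<And>p. p \<in> P \<Longrightarrow> \<alpha> p \<in> {1..n}"
  shows "(\<Sum>i\<in>{1..n}. cnt P \<alpha> i) = card P"
proof -
  have "(\<Sum>i\<in>{1..n}. cnt P \<alpha> i) = (\<Sum>i\<in>{1..n}. \<Sum>p\<in>P. if i = \<alpha> p then 1 else 0)"
    unfolding cnt_def card_eq_sum sum.inter_filter[OF assms(1)] by (intro sum.cong refl) auto
  also have "\<dots> = (\<Sum>p\<in>P. \<Sum>i\<in>{1..n}. if i = \<alpha> p then 1 else 0)" by (rule sum.swap)
  also have "\<dots> = (\<Sum>p\<in>P. 1)" by (intro sum.cong refl, subst sum.delta) (use assms(2) in auto)
  finally show ?thesis by simp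
qed

text \<open>The letters belonging to \<open>lam\<close> lie in 1..r and those belonging to
  \<open>mu\<close> in n - r + 1..n, two disjoint ranges. So \<open>f\<close> is at least
  \<open>part lam\<close> everywhere, and having the same total it is equal to it.\<close>

lemma content_split:
  fixes f f' :: "nat \<Rightarrow> nat"
  assumes eq: "\<And>i. i \<in> {1..n} \<Longrightarrow> int (f i) - int (f' i) = wgt n lam mu i"
    and len: "length lam \<le> r" "length mu \<le> r" "2 * r \<le> n" and sum: "sum_list lam = r" "(\<Sum>i\<in>{1..n}. f i) = r"
    and i: "i \<in> {1..n}"
  shows "f i = part lam i" "f' i = part mu (n + 1 - i)"
proof -
  have le: "part lam j \<le> f j" if j: "j \<in> {1..n}" for j
  proof (cases "j \<le> r")
    case True
    then have "part mu (n + 1 - j) = 0" using len by (intro part_eq_0) linarith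
    then show ?thesis using eq[OF j] by (simp add: wgt_def)
  next
    case False
    then show ?thesis using len by (simp add: part_def)
  qed
  have tot: "(\<Sum>i\<in>{1..n}. part lam i) = r" using sum_part[of lam n] len sum by simp
  have f: "f i = part lam i"
  proof (rule ccontr)
    assume "f i \<noteq> part lam i"
    then have "part lam i < f i" using le[OF i] by simp
    then have "(\<Sum>i\<in>{1..n}. part lam i) < (\<Sum>i\<in>{1..n}. f i)"
      by (intro sum_strict_mono_ex1) (use le i in auto)
    then show False using tot sum by simp
  qed
  then show "f i = part lam i" .
  show "f' i = part mu (n + 1 - i)" using eq[OF i] f by (simp add: wgt_def)
qed

section \<open>Pairing a maximal vector with the generators\<close>

locale pairing = tensor_module n K K for n :: nat and K :: "nat set" +
  fixes S S' :: "nat set" and \<tau> :: "nat \<Rightarrow> nat"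
  assumes SK: "S \<subseteq> K" "S' \<subseteq> K" and bij\<tau>: "bij_betw \<tau> S' S"
begin

abbreviation "P \<equiv> K - S"
abbreviation "P' \<equiv> K - S'"
abbreviation "W A \<equiv> PiE A (\<lambda>_. {1..n})"

lemma fin: "finite S" "finite S'" "finite P" "finite P'"
  using finP SK by (auto intro: finite_subset)

lemma \<tau>S: "q \<in> S' \<Longrightarrow> \<tau> q \<in> S"
  using bij\<tau> by (auto simp: bij_betw_def)

lemma \<tau>_eq: "q \<in> S' \<Longrightarrow> q' \<in> S' \<Longrightarrow> \<tau> q = \<tau> q' \<longleftrightarrow> q = q'"
  using bij\<tau> by (auto simp: bij_betw_def inj_on_def)

text \<open>Partial contraction commutes with the action: the terms at contracted vector places
  cancel those at the paired dual places.\<close>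

lemma pc_raise:
  assumes ij: "i \<in> {1..n}" "j \<in> {1..n}"
  shows "(\<Sum>c\<in>W S. lact K K i j u (mrg S \<alpha> c, mrg S' \<beta> (c \<circ> \<tau>)))
    = (\<Sum>p\<in>P. if \<alpha> p = i then pc n S S' \<tau> u (\<alpha>(p := j)) \<beta> else 0)
      - (\<Sum>q\<in>P'. if \<beta> q = j then pc n S S' \<tau> u \<alpha> (\<beta>(q := i)) else 0)"
proof -
  let ?x = "\<lambda>c. mrg S \<alpha> c" and ?y = "\<lambda>c. mrg S' \<beta> (c \<circ> \<tau>)"
  have sp: "sum f K = sum f (K - X) + sum f X" if "X \<subseteq> K" for f :: "nat \<Rightarrow> complex" and X
    using sum.subset_diff[OF that finP] .
  have A: "(\<Sum>p\<in>P. if ?x c p = i then u ((?x c)(p := j), ?y c) else 0)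
      = (\<Sum>p\<in>P. if \<alpha> p = i then u (mrg S (\<alpha>(p := j)) c, ?y c) else 0)" for c
  proof (rule sum.cong[OF refl])
    fix p assume p: "p \<in> P"
    have "(?x c)(p := j) = mrg S (\<alpha>(p := j)) c" using p by (auto simp: mrg_def fun_eq_iff)
    then show "(if ?x c p = i then u ((?x c)(p := j), ?y c) else 0) = (if \<alpha> p = i then u (mrg S (\<alpha>(p := j)) c, ?y c) else 0)"
      using p by (simp add: mrg_def)
  qed
  have B: "(\<Sum>q\<in>P'. if ?y c q = j then u (?x c, (?y c)(q := i)) else 0)
      = (\<Sum>q\<in>P'. if \<beta> q = j then u (?x c, mrg S' (\<beta>(q := i)) (c \<circ> \<tau>)) else 0)" for c
  proof (rule sum.cong[OF refl])
    fix q assume q: "q \<in> P'"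
    have "(?y c)(q := i) = mrg S' (\<beta>(q := i)) (c \<circ> \<tau>)" using q by (auto simp: mrg_def fun_eq_iff)
    then show "(if ?y c q = j then u (?x c, (?y c)(q := i)) else 0) = (if \<beta> q = j then u (?x c, mrg S' (\<beta>(q := i)) (c \<circ> \<tau>)) else 0)"
      using q by (simp add: mrg_def)
  qed
  \<comment> \<open>Replacing the summed letter at \<open>\<tau> q\<close> between \<open>i\<close>
    and \<open>j\<close> carries the vector terms over to the dual terms.\<close>
  have C: "(\<Sum>c\<in>W S. \<Sum>p\<in>S. if ?x c p = i then u ((?x c)(p := j), ?y c) else 0)
      = (\<Sum>c\<in>W S. \<Sum>q\<in>S'. if ?y c q = j then u (?x c, (?y c)(q := i)) else 0)"
  proof -
    have fW: "finite (W S)" using fin by (intro finite_PiE) auto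
    have "(\<Sum>c\<in>W S. \<Sum>p\<in>S. if ?x c p = i then u ((?x c)(p := j), ?y c) else 0)
        = (\<Sum>c\<in>W S. \<Sum>q\<in>S'. if ?x c (\<tau> q) = i then u ((?x c)(\<tau> q := j), ?y c) else 0)"
      by (intro sum.cong refl sum.reindex_bij_betw[OF bij\<tau>, symmetric])
    also have "\<dots> = (\<Sum>q\<in>S'. \<Sum>c\<in>W S. if ?x c (\<tau> q) = i then u ((?x c)(\<tau> q := j), ?y c) else 0)"
      by (rule sum.swap)
    also have "\<dots> = (\<Sum>q\<in>S'. \<Sum>c\<in>W S. if ?y c q = j then u (?x c, (?y c)(q := i)) else 0)"
    proof (rule sum.cong[OF refl])
      fix q assume q: "q \<in> S'"
      note s = \<tau>S[OF q]
      have e1: "(?x c)(\<tau> q := j) = ?x (c(\<tau> q := j))" for c using s by (auto simp: mrg_def fun_eq_iff)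
      have e2: "(?y c)(q := i) = ?y (c(\<tau> q := i))" for c
        using q \<tau>_eq by (auto simp: mrg_def fun_eq_iff)
      have "(\<Sum>c\<in>W S. if ?x c (\<tau> q) = i then u ((?x c)(\<tau> q := j), ?y c) else 0)
        = (\<Sum>c\<in>{c\<in>W S. c (\<tau> q) = i}. u (?x (c(\<tau> q := j)), ?y c))"
        unfolding e1 sum.inter_filter[OF fW] by (intro sum.cong refl) (use s in \<open>simp add: mrg_def\<close>)
      also have "\<dots> = (\<Sum>c\<in>{c\<in>W S. c (\<tau> q) = j}. u (?x c, ?y (c(\<tau> q := i))))"
        by (rule sum.reindex_bij_witness[where i = "\<lambda>c. c(\<tau> q := i)" and j = "\<lambda>c. c(\<tau> q := j)"])
          (use s ij in \<open>auto intro: PiE_upd\<close>)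
      also have "\<dots> = (\<Sum>c\<in>W S. if ?y c q = j then u (?x c, (?y c)(q := i)) else 0)"
        unfolding e2 sum.inter_filter[OF fW] by (intro sum.cong refl) (use q in \<open>simp add: mrg_def\<close>)
      finally show "(\<Sum>c\<in>W S. if ?x c (\<tau> q) = i then u ((?x c)(\<tau> q := j), ?y c) else 0)
        = (\<Sum>c\<in>W S. if ?y c q = j then u (?x c, (?y c)(q := i)) else 0)" .
    qed
    also have "\<dots> = (\<Sum>c\<in>W S. \<Sum>q\<in>S'. if ?y c q = j then u (?x c, (?y c)(q := i)) else 0)"
      by (rule sum.swap)
    finally show ?thesis .
  qed
  have X: "(\<Sum>p\<in>K. if ?x c p = i then u ((?x c)(p := j), ?y c) else 0)
      = (\<Sum>p\<in>P. if \<alpha> p = i then u (mrg S (\<alpha>(p := j)) c, ?y c) else 0)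
        + (\<Sum>p\<in>S. if ?x c p = i then u ((?x c)(p := j), ?y c) else 0)" for c
    by (subst sp[OF SK(1)]) (simp only: A)
  have Y: "(\<Sum>q\<in>K. if ?y c q = j then u (?x c, (?y c)(q := i)) else 0)
      = (\<Sum>q\<in>P'. if \<beta> q = j then u (?x c, mrg S' (\<beta>(q := i)) (c \<circ> \<tau>)) else 0)
        + (\<Sum>q\<in>S'. if ?y c q = j then u (?x c, (?y c)(q := i)) else 0)" for c
    by (subst sp[OF SK(2)]) (simp only: B)
  have "(\<Sum>c\<in>W S. lact K K i j u (?x c, ?y c))
    = (\<Sum>c\<in>W S. \<Sum>p\<in>P. if \<alpha> p = i then u (mrg S (\<alpha>(p := j)) c, ?y c) else 0)
      - (\<Sum>c\<in>W S. \<Sum>q\<in>P'. if \<beta> q = j then u (?x c, mrg S' (\<beta>(q := i)) (c \<circ> \<tau>)) else 0)"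
    unfolding lact_apply[OF finP finP] X Y sum_subtractf sum.distrib C by simp
  also have "(\<Sum>c\<in>W S. \<Sum>p\<in>P. if \<alpha> p = i then u (mrg S (\<alpha>(p := j)) c, ?y c) else 0)
      = (\<Sum>p\<in>P. if \<alpha> p = i then pc n S S' \<tau> u (\<alpha>(p := j)) \<beta> else 0)"
    unfolding pc_def by (subst sum.swap) (intro sum.cong refl, simp)
  also have "(\<Sum>c\<in>W S. \<Sum>q\<in>P'. if \<beta> q = j then u (?x c, mrg S' (\<beta>(q := i)) (c \<circ> \<tau>)) else 0)
      = (\<Sum>q\<in>P'. if \<beta> q = j then pc n S S' \<tau> u \<alpha> (\<beta>(q := i)) else 0)"
    unfolding pc_def by (subst sum.swap) (intro sum.cong refl, simp)
  finally show ?thesis .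
qed

end

locale pairing_max = pairing +
  fixes lam mu :: "nat list" and r :: nat and u :: tens
  assumes card_P: "card P = r" "card P' = r" and len: "length lam \<le> r" "length mu \<le> r" "2 * r \<le> n"
    and sums: "sum_list lam = r" "sum_list mu = r"
    and max: "maxvec (\<lambda>i. of_int (wgt n lam mu i)) u"
begin

abbreviation "g \<equiv> pc n S S' \<tau> u"

lemma g_letters:
  assumes "g (restrict \<alpha> P) (restrict \<beta> P') \<noteq> 0"
  shows "p \<in> P \<Longrightarrow> \<alpha> p \<in> {1..n}" "q \<in> P' \<Longrightarrow> \<beta> q \<in> {1..n}"
proof -
  obtain c where "u (mrg S (restrict \<alpha> P) c, mrg S' (restrict \<beta> P') (c \<circ> \<tau>)) \<noteq> 0"
    using assms unfolding pc_def by (blast dest: sum_nz)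
  then have "(mrg S (restrict \<alpha> P) c, mrg S' (restrict \<beta> P') (c \<circ> \<tau>)) \<in> tidx n K K"
    using max by (auto simp: maxvec_def fsupp_def)
  then have m: "mrg S (restrict \<alpha> P) c \<in> W K" "mrg S' (restrict \<beta> P') (c \<circ> \<tau>) \<in> W K"
    by (auto simp: tidx_def)
  show "\<alpha> p \<in> {1..n}" if "p \<in> P"
    using PiE_mem[OF m(1), of p] that by (simp add: mrg_def)
  show "\<beta> q \<in> {1..n}" if "q \<in> P'"
    using PiE_mem[OF m(2), of q] that by (simp add: mrg_def)
qed

text \<open>Contracted letters cancel in the weight, so \<open>content_split\<close> recovers the
  contents of both remaining words from it.\<close>

lemma g_content:
  assumes nz: "g (restrict \<alpha> P) (restrict \<beta> P') \<noteq> 0" and i: "i \<in> {1..n}"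
  shows "cnt P \<alpha> i = part lam i" "cnt P' \<beta> i = part mu (n + 1 - i)"
proof -
  obtain c where c: "u (mrg S (restrict \<alpha> P) c, mrg S' (restrict \<beta> P') (c \<circ> \<tau>)) \<noteq> 0"
    using nz unfolding pc_def by (blast dest: sum_nz)
  let ?x = "mrg S (restrict \<alpha> P) c" and ?y = "mrg S' (restrict \<beta> P') (c \<circ> \<tau>)"
  have 1: "cnt P ?x j = cnt P \<alpha> j" "cnt P' ?y j = cnt P' \<beta> j" for j
    by (auto simp: cnt_def mrg_def intro!: arg_cong[where f = card])
  have 2: "cnt S ?x j = cnt S' ?y j" for j
    by (rule cnt_reindex[OF bij\<tau>]) (use \<tau>S in \<open>auto simp: mrg_def\<close>)
  have eq: "int (cnt P \<alpha> j) - int (cnt P' \<beta> j) = wgt n lam mu j" if j: "j \<in> {1..n}" for j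
  proof -
    have "complex_of_int (wgt n lam mu j) = of_int (wt K K (?x, ?y) j)"
      by (rule maxvec_wt[OF max c j])
    then have "wgt n lam mu j = wt K K (?x, ?y) j" by (simp only: of_int_eq_iff)
    then show ?thesis
      using cnt_split[OF finP SK(1), of ?x j] cnt_split[OF finP SK(2), of ?y j] 1[of j] 2[of j]
      unfolding wt_cnt by linarith
  qed
  have tot: "(\<Sum>i\<in>{1..n}. cnt P \<alpha> i) = r"
    using sum_cnt[OF fin(3), of \<alpha> n] g_letters(1)[OF nz] card_P by simp
  show "cnt P \<alpha> i = part lam i"
    by (rule content_split(1)[where f' = "cnt P' \<beta>", OF _ len sums(1) tot i]) (rule eq)
  show "cnt P' \<beta> i = part mu (n + 1 - i)"
    by (rule content_split(2)[where f = "cnt P \<alpha>", OF _ len sums(1) tot i]) (rule eq)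
qed

lemma restrict_upd: "p \<in> A \<Longrightarrow> (restrict \<alpha> A)(p := x) = restrict (\<alpha>(p := x)) A"
  by (auto simp: fun_eq_iff)

text \<open>Since \<open>2 r \<le> n\<close>, the letters \<open>1..r\<close> of the first factor and \<open>n - r + 1..n\<close> of the second
  never interact, so a raising operator kills the two factors separately.\<close>

lemma g_raise:
  assumes \<alpha>: "\<And>p. p \<in> P \<Longrightarrow> \<alpha> p \<in> {1..n}" and \<beta>: "\<And>q. q \<in> P' \<Longrightarrow> \<beta> q \<in> {1..n}"
    and ij: "1 \<le> i" "i < j" "j \<le> n"
  shows "(\<Sum>p\<in>P. if \<alpha> p = i then g (restrict (\<alpha>(p := j)) P) (restrict \<beta> P') else 0) = 0" (is "?A = 0")
    "(\<Sum>q\<in>P'. if \<beta> q = j then g (restrict \<alpha> P) (restrict (\<beta>(q := i)) P') else 0) = 0" (is "?B = 0")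
proof -
  have ij': "i \<in> {1..n}" "j \<in> {1..n}" using ij by auto
  have "lact K K i j u = 0" using max ij ij' by (simp add: maxvec_def)
  then have "0 = (\<Sum>p\<in>P. if restrict \<alpha> P p = i then g ((restrict \<alpha> P)(p := j)) (restrict \<beta> P') else 0)
      - (\<Sum>q\<in>P'. if restrict \<beta> P' q = j then g (restrict \<alpha> P) ((restrict \<beta> P')(q := i)) else 0)"
    using pc_raise[OF ij', of u "restrict \<alpha> P" "restrict \<beta> P'"] by (simp add: zero_fun_apply)
  also have "(\<Sum>p\<in>P. if restrict \<alpha> P p = i then g ((restrict \<alpha> P)(p := j)) (restrict \<beta> P') else 0) = ?A"
    by (intro sum.cong refl) (simp add: restrict_upd del: restrict_upd[symmetric])
  also have "(\<Sum>q\<in>P'. if restrict \<beta> P' q = j then g (restrict \<alpha> P) ((restrict \<beta> P')(q := i)) else 0) = ?B"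
    by (intro sum.cong refl) (simp add: restrict_upd)
  finally have AB: "?A = ?B" by simp
  have "?A = 0 \<or> ?B = 0"
  proof (cases "j \<le> r")
    case True
    have "?B = 0"
    proof (rule sum.neutral, rule ballI)
      fix q assume q: "q \<in> P'"
      have "g (restrict \<alpha> P) (restrict (\<beta>(q := i)) P') = 0"
      proof (rule ccontr)
        assume nz: "g (restrict \<alpha> P) (restrict (\<beta>(q := i)) P') \<noteq> 0"
        have "cnt P' (\<beta>(q := i)) i = part mu (n + 1 - i)" by (rule g_content(2)[OF nz ij'(1)])
        moreover have "part mu (n + 1 - i) = 0" using len True ij by (intro part_eq_0) linarith
        moreover have "cnt P' (\<beta>(q := i)) i \<noteq> 0" by (rule cnt_neq_0[OF fin(4) q]) simp
        ultimately show False by simp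
      qed
      then show "(if \<beta> q = j then g (restrict \<alpha> P) (restrict (\<beta>(q := i)) P') else 0) = 0" by simp
    qed
    then show ?thesis ..
  next
    case False
    have "?A = 0"
    proof (rule sum.neutral, rule ballI)
      fix p assume p: "p \<in> P"
      have "g (restrict (\<alpha>(p := j)) P) (restrict \<beta> P') = 0"
      proof (rule ccontr)
        assume nz: "g (restrict (\<alpha>(p := j)) P) (restrict \<beta> P') \<noteq> 0"
        have "cnt P (\<alpha>(p := j)) j = part lam j" by (rule g_content(1)[OF nz ij'(2)])
        moreover have "part lam j = 0" using len False by (simp add: part_def)
        moreover have "cnt P (\<alpha>(p := j)) j \<noteq> 0" by (rule cnt_neq_0[OF fin(3) p]) simp
        ultimately show False by simp
      qed
      then show "(if \<alpha> p = i then g (restrict (\<alpha>(p := j)) P) (restrict \<beta> P') else 0) = 0" by simp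
    qed
    then show ?thesis ..
  qed
  then show "?A = 0" "?B = 0" using AB by auto
qed

text \<open>\<open>restrict\<close> makes the value depend on the letters in \<open>P\<close> and
  \<open>P'\<close> only, and \<open>bar\<close> reverses the second word; so \<open>h\<close>
  becomes a highest weight function in either argument.\<close>

definition h :: "(nat \<Rightarrow> nat) \<Rightarrow> (nat \<Rightarrow> nat) \<Rightarrow> complex" where
  "h \<alpha> \<beta> = g (restrict \<alpha> P) (restrict (bar n \<beta>) P')"

lemma h_letters:
  assumes "h \<alpha> \<beta> \<noteq> 0"
  shows "p \<in> P \<Longrightarrow> \<alpha> p \<in> {1..n}" "q \<in> P' \<Longrightarrow> bar n \<beta> q \<in> {1..n}" "q \<in> P' \<Longrightarrow> \<beta> q \<in> {1..n}"
proof -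
  show "p \<in> P \<Longrightarrow> \<alpha> p \<in> {1..n}" "q \<in> P' \<Longrightarrow> bar n \<beta> q \<in> {1..n}"
    using g_letters[OF assms[unfolded h_def]] by blast+
  then show "q \<in> P' \<Longrightarrow> \<beta> q \<in> {1..n}" by (auto simp: bar_def)
qed

lemma h_hw_left: "hw_word lam P (\<lambda>\<alpha>. h \<alpha> \<beta>)"
  unfolding hw_word_def raised_def
proof (intro conjI allI impI)
  fix \<alpha> :: "nat \<Rightarrow> nat" and i j :: nat assume ij: "1 \<le> i \<and> i < j"
  show "(\<Sum>p\<in>P. if \<alpha> p = i then h (\<alpha>(p := j)) \<beta> else 0) = 0"
  proof (rule ccontr)
    assume nz: "(\<Sum>p\<in>P. if \<alpha> p = i then h (\<alpha>(p := j)) \<beta> else 0) \<noteq> 0"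
    from sum_nz[OF this] obtain p where p: "p \<in> P" "\<alpha> p = i" "h (\<alpha>(p := j)) \<beta> \<noteq> 0"
      by (auto split: if_splits)
    \<comment> \<open>A nonzero term bounds the raised letter by \<open>n\<close>, which leads from
      the unbounded alphabet of \<open>hw_word\<close> to the range of
      \<open>g_raise\<close>.\<close>
    have j: "j \<le> n" using h_letters(1)[OF p(3) p(1)] by simp
    have "\<alpha> x \<in> {1..n}" if "x \<in> P" for x
      using h_letters(1)[OF p(3) that] p(2) ij j by (cases "x = p") auto
    moreover have "bar n \<beta> q \<in> {1..n}" if "q \<in> P'" for q using h_letters(2)[OF p(3) that] .
    ultimately have "(\<Sum>p\<in>P. if \<alpha> p = i then h (\<alpha>(p := j)) \<beta> else 0) = 0"
      unfolding h_def using ij j by (intro g_raise(1)) auto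
    then show False using nz by simp
  qed
next
  fix \<alpha> i assume nz: "h \<alpha> \<beta> \<noteq> 0"
  show "cnt P \<alpha> i = part lam i"
  proof (cases "i \<in> {1..n}")
    case True
    then show ?thesis using g_content(1)[OF nz[unfolded h_def]] by simp
  next
    case False
    then have "{p \<in> P. \<alpha> p = i} = {}" using h_letters(1)[OF nz] by auto
    then have "cnt P \<alpha> i = 0" by (simp only: cnt_def card.empty)
    moreover have "part lam i = 0" using False len by (auto simp: part_def)
    ultimately show ?thesis by simp
  qed
next
  fix \<alpha> \<alpha>' :: "nat \<Rightarrow> nat" assume "\<forall>p\<in>P. \<alpha> p = \<alpha>' p"
  then have "restrict \<alpha> P = restrict \<alpha>' P" by (intro restrict_ext) auto
  then show "h \<alpha> \<beta> = h \<alpha>' \<beta>" by (simp only: h_def)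
qed

lemma h_hw_right: "hw_word mu P' (h \<alpha>)"
  unfolding hw_word_def raised_def
proof (intro conjI allI impI)
  fix \<beta> :: "nat \<Rightarrow> nat" and i j :: nat assume ij: "1 \<le> i \<and> i < j"
  show "(\<Sum>q\<in>P'. if \<beta> q = i then h \<alpha> (\<beta>(q := j)) else 0) = 0"
  proof (rule ccontr)
    assume nz: "(\<Sum>q\<in>P'. if \<beta> q = i then h \<alpha> (\<beta>(q := j)) else 0) \<noteq> 0"
    from sum_nz[OF this] obtain q where q: "q \<in> P'" "\<beta> q = i" "h \<alpha> (\<beta>(q := j)) \<noteq> 0"
      by (auto split: if_splits)
    have j: "j \<le> n" using h_letters(3)[OF q(3) q(1)] by simp
    have \<beta>n: "\<beta> x \<in> {1..n}" if "x \<in> P'" for x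
      using h_letters(3)[OF q(3) that] q(2) ij j by (cases "x = q") auto
    have \<alpha>n: "\<alpha> p \<in> {1..n}" if "p \<in> P" for p using h_letters(1)[OF q(3) that] .
    have upd: "bar n (\<beta>(q := j)) = (bar n \<beta>)(q := n + 1 - j)" for q by (auto simp: bar_def fun_eq_iff)
    have barn: "bar n \<beta> q \<in> {1..n}" if "q \<in> P'" for q using \<beta>n[OF that] by (auto simp: bar_def)
    have eqv: "bar n \<beta> q = n + 1 - i \<longleftrightarrow> \<beta> q = i" if "q \<in> P'" for q
      using \<beta>n[OF that] ij j by (auto simp: bar_def)
    have "(\<Sum>q\<in>P'. if \<beta> q = i then h \<alpha> (\<beta>(q := j)) else 0)
      = (\<Sum>q\<in>P'. if bar n \<beta> q = n + 1 - i then g (restrict \<alpha> P) (restrict ((bar n \<beta>)(q := n + 1 - j)) P') else 0)"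
      by (intro sum.cong refl) (simp only: h_def upd eqv)
    also have "\<dots> = 0"
    proof (rule g_raise(2))
      show "1 \<le> n + 1 - j" "n + 1 - j < n + 1 - i" "n + 1 - i \<le> n" using ij j by auto
    qed (rule \<alpha>n, simp, rule barn, simp)
    finally show False using nz by simp
  qed
next
  fix \<beta> i assume nz: "h \<alpha> \<beta> \<noteq> 0"
  show "cnt P' \<beta> i = part mu i"
  proof (cases "i \<in> {1..n}")
    case True
    then have i': "n + 1 - i \<in> {1..n}" "n + 1 - (n + 1 - i) = i" by auto
    have "cnt P' (bar n \<beta>) (n + 1 - i) = cnt P' \<beta> i"
      by (rule cnt_bar[OF h_letters(3)[OF nz] True])
    moreover have "cnt P' (bar n \<beta>) (n + 1 - i) = part mu (n + 1 - (n + 1 - i))"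
      by (rule g_content(2)[OF nz[unfolded h_def] i'(1)])
    ultimately show ?thesis by (simp only: i'(2))
  next
    case False
    then have "{p \<in> P'. \<beta> p = i} = {}" using h_letters(3)[OF nz] by auto
    then have "cnt P' \<beta> i = 0" by (simp only: cnt_def card.empty)
    moreover have "part mu i = 0" using False len by (auto simp: part_def)
    ultimately show ?thesis by simp
  qed
next
  fix \<beta> \<beta>' :: "nat \<Rightarrow> nat" assume "\<forall>p\<in>P'. \<beta> p = \<beta>' p"
  then have "restrict (bar n \<beta>) P' = restrict (bar n \<beta>') P'" by (intro restrict_ext) (auto simp: bar_def)
  then show "h \<alpha> \<beta> = h \<alpha> \<beta>'" by (simp only: h_def)
qed

text \<open>The generator vanishes off the indices that agree along \<open>\<tau>\<close>, and there
  its value does not depend on the paired letters. Summing these letters out leaves the partial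
  contraction of \<open>u\<close>.\<close>

lemma ip_capped:
  assumes "tableau lam P T" "tableau mu P' Ts"
  shows "ip (tidx n K K) u (capped n K S' \<tau> (\<lambda>x. of_int (tableau.fT lam P T x)) (\<lambda>y. of_int (tableau.fT mu P' Ts y)))
    = (\<Sum>\<alpha>\<in>W P. (\<Sum>\<beta>\<in>W P'. h \<alpha> \<beta> * of_int (tableau.fT mu P' Ts \<beta>)) * of_int (tableau.fT lam P T \<alpha>))"
proof -
  interpret A: tableau lam P T by fact
  interpret B: tableau mu P' Ts by fact
  let ?f = "\<lambda>x. complex_of_int (A.fT x)" and ?f' = "\<lambda>y. complex_of_int (B.fT y)"
  have fZ: "finite (tidx n K K)" using finP by (simp add: finite_tidx)
  have "ip (tidx n K K) u (capped n K S' \<tau> ?f ?f')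
    = (\<Sum>z\<in>{z\<in>tidx n K K. \<forall>q\<in>S'. fst z (\<tau> q) = snd z q}. u z * (?f (fst z) * ?f' (bar n (snd z))))"
    unfolding ip_def by (rule sum.mono_neutral_cong_right[OF fZ]) (auto simp: capped_def split: if_splits)
  also have "\<dots> = (\<Sum>\<alpha>\<in>W P. \<Sum>\<beta>\<in>W P'. \<Sum>c\<in>W S. u (mrg S \<alpha> c, mrg S' \<beta> (c \<circ> \<tau>)) *
      (?f (mrg S \<alpha> c) * ?f' (bar n (mrg S' \<beta> (c \<circ> \<tau>)))))"
    unfolding matched_sum[OF SK bij\<tau>] fst_conv snd_conv ..
  also have "\<dots> = (\<Sum>\<alpha>\<in>W P. \<Sum>\<beta>\<in>W P'. g \<alpha> \<beta> * (?f \<alpha> * ?f' (bar n \<beta>)))"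
  proof (intro sum.cong refl)
    fix \<alpha> \<beta> assume "\<alpha> \<in> W P" "\<beta> \<in> W P'"
    have 1: "?f (mrg S \<alpha> c) = ?f \<alpha>" for c by (rule hw_wordD(3)[OF A.fT_hw]) (simp add: mrg_def)
    have 2: "?f' (bar n (mrg S' \<beta> (c \<circ> \<tau>))) = ?f' (bar n \<beta>)" for c
      by (rule hw_wordD(3)[OF B.fT_hw]) (simp add: mrg_def bar_def)
    show "(\<Sum>c\<in>W S. u (mrg S \<alpha> c, mrg S' \<beta> (c \<circ> \<tau>)) * (?f (mrg S \<alpha> c) * ?f' (bar n (mrg S' \<beta> (c \<circ> \<tau>)))))
      = g \<alpha> \<beta> * (?f \<alpha> * ?f' (bar n \<beta>))"
      unfolding 1 2 pc_def sum_distrib_right ..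
  qed
  also have "\<dots> = (\<Sum>\<alpha>\<in>W P. \<Sum>\<beta>\<in>W P'. h \<alpha> \<beta> * (?f \<alpha> * ?f' \<beta>))"
  proof (rule sum.cong[OF refl])
    fix \<alpha> assume \<alpha>: "\<alpha> \<in> W P"
    define b where "b \<beta> = restrict (bar n \<beta>) P'" for \<beta>
    have bW: "b \<beta> \<in> W P'" if "\<beta> \<in> W P'" for \<beta> unfolding b_def
    proof (rule restrict_PiE_iff[THEN iffD2], rule ballI)
      fix q assume "q \<in> P'"
      from PiE_mem[OF that this] show "bar n \<beta> q \<in> {1..n}" by (auto simp: bar_def)
    qed
    have bb: "b (b \<beta>) = \<beta>" if "\<beta> \<in> W P'" for \<beta>
    proof (rule PiE_ext[OF bW[OF bW[OF that]] that])
      fix q assume q: "q \<in> P'"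
      from PiE_mem[OF that q] show "b (b \<beta>) q = \<beta> q" using q by (simp add: b_def bar_def)
    qed
    have f'b: "?f' (bar n (b \<beta>)) = ?f' \<beta>" if "\<beta> \<in> W P'" for \<beta>
    proof (rule hw_wordD(3)[OF B.fT_hw])
      fix q assume q: "q \<in> P'"
      from PiE_mem[OF that q] show "bar n (b \<beta>) q = \<beta> q" using q by (simp add: b_def bar_def)
    qed
    have r\<alpha>: "restrict \<alpha> P = \<alpha>" using \<alpha> by (rule PiE_restrict)
    have "(\<Sum>\<beta>\<in>W P'. h \<alpha> \<beta> * (?f \<alpha> * ?f' \<beta>)) = (\<Sum>\<beta>\<in>W P'. g \<alpha> (b \<beta>) * (?f \<alpha> * ?f' (bar n (b \<beta>))))"
      by (intro sum.cong refl) (simp only: h_def r\<alpha> f'b b_def[symmetric])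
    also have "\<dots> = (\<Sum>\<beta>\<in>W P'. g \<alpha> \<beta> * (?f \<alpha> * ?f' (bar n \<beta>)))"
      by (rule sum.reindex_bij_betw, rule bij_betw_byWitness[where f' = b]) (use bW bb in auto)
    finally show "(\<Sum>\<beta>\<in>W P'. g \<alpha> \<beta> * (?f \<alpha> * ?f' (bar n \<beta>))) = (\<Sum>\<beta>\<in>W P'. h \<alpha> \<beta> * (?f \<alpha> * ?f' \<beta>))" ..
  qed
  also have "\<dots> = (\<Sum>\<alpha>\<in>W P. (\<Sum>\<beta>\<in>W P'. h \<alpha> \<beta> * ?f' \<beta>) * ?f \<alpha>)"
    unfolding sum_distrib_right by (intro sum.cong refl) simp
  finally show ?thesis .
qed

text \<open>\<open>hw_word_orthogonal_0\<close> is applied once in each variable. Pairing the second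
  variable with a fixed \<open>Ts\<close> leaves a highest weight function of the first that is
  orthogonal to all standard tableaux, hence zero; then the second variable is treated in the same
  way.\<close>

lemma g_eq_0:
  assumes sorted: "sorted_wrt (\<ge>) lam" "sorted_wrt (\<ge>) mu"
    and orth: "\<And>T Ts. std_tableau lam P T \<Longrightarrow> std_tableau mu P' Ts \<Longrightarrow>
      ip (tidx n K K) u (capped n K S' \<tau> (\<lambda>x. of_int (tableau.fT lam P T x)) (\<lambda>y. of_int (tableau.fT mu P' Ts y))) = 0"
    and \<alpha>\<beta>: "\<alpha> \<in> W P" "\<beta> \<in> W P'"
  shows "g \<alpha> \<beta> = 0"
proof -
  have tab: "tableau l X T" if "std_tableau l X T" "sorted_wrt (\<ge>) l" for l X T
    using that by unfold_locales (auto simp: std_tableau_def)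
  have h1: "(\<Sum>\<beta>\<in>W P'. h \<alpha> \<beta> * of_int (tableau.fT mu P' Ts \<beta>)) = 0" if Ts: "std_tableau mu P' Ts" for Ts \<alpha>
  proof (rule hw_word_orthogonal_0[OF fin(3) _ sorted(1), where g = "\<lambda>\<alpha>. \<Sum>\<beta>\<in>W P'. h \<alpha> \<beta> * of_int (tableau.fT mu P' Ts \<beta>)" and n = n])
    show "card P = sum_list lam" "length lam \<le> n" using card_P sums len by simp_all
    have "hw_word lam P (\<lambda>\<alpha>. \<Sum>\<beta>\<in>W P'. of_int (tableau.fT mu P' Ts \<beta>) * h \<alpha> \<beta>)"
      by (intro hw_word_sum hw_word_scale h_hw_left)
    then show "hw_word lam P (\<lambda>\<alpha>. \<Sum>\<beta>\<in>W P'. h \<alpha> \<beta> * of_int (tableau.fT mu P' Ts \<beta>))"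
      by (simp only: mult.commute)
    fix T assume T: "std_tableau lam P T"
    show "(\<Sum>\<alpha>\<in>W P. (\<Sum>\<beta>\<in>W P'. h \<alpha> \<beta> * of_int (tableau.fT mu P' Ts \<beta>)) * of_int (tableau.fT lam P T \<alpha>)) = 0"
      using ip_capped[OF tab[OF T sorted(1)] tab[OF Ts sorted(2)]] orth[OF T Ts] by simp
  qed
  have h0: "h \<alpha> \<beta> = 0" for \<alpha> \<beta>
    by (rule hw_word_orthogonal_0[OF fin(4) _ sorted(2) _ h_hw_right h1]) (use card_P sums len in simp_all)
  have "restrict (bar n (bar n \<beta>)) P' = \<beta>"
  proof (rule PiE_ext[of _ P' "\<lambda>_. {1..n}"])
    show "restrict (bar n (bar n \<beta>)) P' \<in> W P'"
    proof (rule restrict_PiE_iff[THEN iffD2], rule ballI)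
      fix q assume "q \<in> P'"
      from PiE_mem[OF \<alpha>\<beta>(2) this] show "bar n (bar n \<beta>) q \<in> {1..n}" by (auto simp: bar_def)
    qed
    fix q assume q: "q \<in> P'"
    from PiE_mem[OF \<alpha>\<beta>(2) q] show "restrict (bar n (bar n \<beta>)) P' q = \<beta> q" using q by (simp add: bar_def)
  qed (rule \<alpha>\<beta>(2))
  then show ?thesis using h0[of \<alpha> "bar n \<beta>"] PiE_restrict[OF \<alpha>\<beta>(1)] by (simp add: h_def)
qed

end

text \<open>The vector has the form of a generator without contracted pairs. Its value at the row
  words of two arbitrary fillings is a product of nonzero values of \<open>fT\<close>.\<close>

lemma exists_maxvec_weight:
  assumes fin: "finite R" "card R = sum_list lam" "card R = sum_list mu"
    and sorted: "sorted_wrt (\<ge>) lam" "sorted_wrt (\<ge>) mu" and len: "length lam \<le> n" "length mu \<le> n"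
  shows "\<exists>z. z \<noteq> 0 \<and> gl_module.maxvec n (tidx n R R) (lact R R) (\<lambda>i. of_int (wgt n lam mu i)) z"
proof -
  obtain T where T: "bij_betw T (cells lam) R"
    using finite_same_card_bij[OF finite_cells fin(1), of lam] by (auto simp: card_cells fin(2))
  obtain T' where T': "bij_betw T' (cells mu) R"
    using finite_same_card_bij[OF finite_cells fin(1), of mu] by (auto simp: card_cells fin(3)[symmetric])
  interpret A: tableau lam R T by unfold_locales (use sorted T in auto)
  interpret B: tableau mu R T' by unfold_locales (use sorted T' in auto)
  let ?f = "\<lambda>x. complex_of_int (A.fT x)" and ?f' = "\<lambda>y. complex_of_int (B.fT y)"
  let ?z = "capped n R {} id ?f ?f'"
  have "gl_module.maxvec n (tidx n R R) (lact R R) (\<lambda>i. of_int (wgt n lam mu i)) ?z"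
    by (rule capped_maxvec[where S = "{}"]) (use fin A.fT_hw B.fT_hw in \<open>auto simp: bij_betw_def\<close>)
  moreover have "?z \<noteq> 0"
  proof -
    have rn: "A.row p \<in> {1..n}" "B.row p \<in> {1..n}" if "p \<in> R" for p
      using tab_pos(1)[OF T that] tab_pos(1)[OF T' that] len by (auto simp: cells_def)
    have Z: "(restrict A.row R, restrict (bar n B.row) R) \<in> tidx n R R"
      unfolding tidx_def mem_Times_iff fst_conv snd_conv restrict_PiE_iff
      using rn by (force simp: bar_def)
    have "?f (restrict A.row R) = ?f A.row" by (rule hw_wordD(3)[OF A.fT_hw]) simp
    moreover have "?f' (bar n (restrict (bar n B.row) R)) = ?f' B.row"
    proof (rule hw_wordD(3)[OF B.fT_hw])
      fix p assume p: "p \<in> R"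
      show "bar n (restrict (bar n B.row) R) p = B.row p" using rn(2)[OF p] p by (simp add: bar_def)
    qed
    ultimately have "?z (restrict A.row R, restrict (bar n B.row) R) = ?f A.row * ?f' B.row"
      using Z by (simp add: capped_def)
    moreover have "?f A.row * ?f' B.row \<noteq> 0" using A.fT_row_nz B.fT_row_nz by simp
    ultimately show ?thesis by (metis zero_fun_apply)
  qed
  ultimately show ?thesis by blast
qed

section \<open>Identification with maximal vectors\<close>

lemma cspanI: "finite F \<Longrightarrow> F \<subseteq> A \<Longrightarrow> u = (\<Sum>v\<in>F. smul (c v) v) \<Longrightarrow> u \<in> cspan A"
  unfolding cspan_def mem_Collect_eq by (intro exI conjI)

lemma cspanE:
  assumes "u \<in> cspan A"
  obtains F c where "finite F" "F \<subseteq> A" "u = (\<Sum>v\<in>F. smul (c v) v)"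
  using assms unfolding cspan_def mem_Collect_eq by (elim exE conjE)

lemma cspan_subspace: "is_subspace (cspan A)"
  unfolding is_subspace_def
proof (intro conjI ballI allI)
  show "0 \<in> cspan A" by (rule cspanI[of "{}" _ _ "\<lambda>_. 0"]) simp_all
  fix u assume "u \<in> cspan A"
  then obtain F c where F: "finite F" "F \<subseteq> A" "u = (\<Sum>v\<in>F. smul (c v) v)" by (rule cspanE)
  have "smul d u = (\<Sum>v\<in>F. smul (d * c v) v)" for d
    by (simp add: F(3) fun_eq_iff smul_apply sum_fun_apply sum_distrib_left mult.assoc)
  then show "smul d u \<in> cspan A" for d by (rule cspanI[OF F(1,2)])
  fix v assume "v \<in> cspan A"
  then obtain F' c' where F': "finite F'" "F' \<subseteq> A" "v = (\<Sum>v\<in>F'. smul (c' v) v)" by (rule cspanE)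
  have fin: "finite (F \<union> F')" "F \<union> F' \<subseteq> A" using F(1,2) F'(1,2) by simp_all
  have ext: "(\<Sum>v\<in>X. smul (c v) v) = (\<Sum>v\<in>F \<union> F'. smul (if v \<in> X then c v else 0) v)"
    if X: "X \<subseteq> F \<union> F'" for X c
  proof (rule sum.mono_neutral_cong_left[OF fin(1) X])
    show "\<forall>v\<in>F \<union> F' - X. smul (if v \<in> X then c v else 0) v = 0" by (simp add: fun_eq_iff smul_apply fun_simps)
  qed simp
  have "u + v = (\<Sum>v\<in>F \<union> F'. smul ((if v \<in> F then c v else 0) + (if v \<in> F' then c' v else 0)) v)"
    unfolding F(3) F'(3) ext[of F c, OF Un_upper1] ext[of F' c', OF Un_upper2] add_smul sum.distrib ..
  then show "u + v \<in> cspan A" by (rule cspanI[OF fin])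
qed

lemma cspan_base: "v \<in> A \<Longrightarrow> v \<in> cspan A"
  by (rule cspanI[of "{v}" _ _ "\<lambda>_. 1"]) simp_all

lemma cspan_least: "is_subspace N \<Longrightarrow> A \<subseteq> N \<Longrightarrow> cspan A \<subseteq> N"
  by (auto elim!: cspanE intro!: subspace_sum is_subspaceD)

lemma length_le_sum_list: "0 \<notin> set l \<Longrightarrow> length l \<le> sum_list (l :: nat list)"
  by (induction l) auto

lemma is_partitionD:
  assumes "is_partition r lam"
  shows "sorted_wrt (\<ge>) lam" "0 \<notin> set lam" "sum_list lam = r" "length lam \<le> r"
  using assms length_le_sum_list[of lam] by (auto simp: is_partition_def)

lemma list_pairing:
  assumes "distinct s" "distinct t" "length s = length t"
  obtains \<tau> where "\<And>i. i < length t \<Longrightarrow> \<tau> (t ! i) = s ! i" "bij_betw \<tau> (set t) (set s)"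
proof -
  define \<tau> where "\<tau> q = s ! (THE i. i < length t \<and> t ! i = q)" for q
  have \<tau>: "\<tau> (t ! i) = s ! i" if "i < length t" for i
  proof -
    have "(THE j. j < length t \<and> t ! j = t ! i) = i"
      using that assms(2) by (intro the_equality) (auto simp: nth_eq_iff_index_eq)
    then show ?thesis by (simp add: \<tau>_def)
  qed
  have img: "\<tau> ` set t = set s"
    using \<tau> assms(3) by (force simp: set_conv_nth)
  have "inj_on \<tau> (set t)"
    by (rule eq_card_imp_inj_on) (use img assms in \<open>auto simp: distinct_card\<close>)
  then show ?thesis using that[of \<tau>] \<tau> img by (simp add: bij_betw_def)
qed

context mixed_tensors
begin

text \<open>The idempotent is built from contractions, and these commute with the action.\<close>

lemma eop_maxvec:
  assumes "maxvec \<chi> u"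
  shows "maxvec \<chi> (eop n k u)"
proof -
  have "eop n k u \<in> {u. maxvec \<chi> u}"
  proof (rule eop_closed[OF maxvec_subspace])
    fix i v assume i: "i \<in> {1..k}" and v: "v \<in> {u. maxvec \<chi> u}"
    have "L c d (contr n k i i v) = contr n k i i (L c d v)" if "c \<in> {1..n}" "d \<in> {1..n}" for c d
      using contr_lact[OF i that] by simp
    then show "contr n k i i v \<in> {u. maxvec \<chi> u}"
      using v contr_in[of n k i i v] by (auto simp: maxvec_def contr_zero contr_smul Mset_eq)
  qed (use assms in simp)
  then show ?thesis by simp
qed

context
  fixes r :: nat and lam mu :: "nat list"
  assumes n2k: "2 * k \<le> n" and rk: "r \<le> k" and lam: "is_partition r lam" and mu: "is_partition r mu"
begin

lemmas lamD = is_partitionD[OF lam]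
lemmas muD = is_partitionD[OF mu]

lemma tableauI: "std_tableau lam X T \<Longrightarrow> tableau lam X T" "std_tableau mu X T \<Longrightarrow> tableau mu X T"
  using lamD(1) muD(1) by (auto simp: std_tableau_def intro: tableau.intro)

lemma generator_capped:
  assumes "distinct s" "set s \<subseteq> {1..k}" "length s = k - r" "distinct t" "set t \<subseteq> {1..k}" "length t = k - r"
    "std_tableau lam ({1..k} - set s) T" "std_tableau mu ({1..k} - set t) Ts"
    "\<And>i. i < length t \<Longrightarrow> \<tau> (t ! i) = s ! i"
  shows "yV lam T (yW mu Ts (cst n k s t (xprime n k lam T mu Ts s t)))
    = capped n {1..k} (set t) \<tau> (\<lambda>x. of_int (tableau.fT lam ({1..k} - set s) T x))
        (\<lambda>y. of_int (tableau.fT mu ({1..k} - set t) Ts y))"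
  by (rule generator_formula) (use assms tableauI lamD muD n2k rk in auto)

text \<open>Otherwise \<open>u\<close> would be
  mapped to a maximal vector of the same weight in the tensor power of order \<open>r\<close>, by an intertwiner
  that factors through these contractions.\<close>

lemma maxvec_pc_0:
  assumes u: "maxvec (\<lambda>i. of_int (wgt n lam mu i)) u"
    and pc0: "\<And>S S' \<tau> \<alpha> \<beta>. S \<subseteq> {1..k} \<Longrightarrow> S' \<subseteq> {1..k} \<Longrightarrow> bij_betw \<tau> S' S \<Longrightarrow> card S' = k - r \<Longrightarrow>
      \<alpha> \<in> PiE ({1..k} - S) (\<lambda>_. {1..n}) \<Longrightarrow> \<beta> \<in> PiE ({1..k} - S') (\<lambda>_. {1..n}) \<Longrightarrow> pc n S S' \<tau> u \<alpha> \<beta> = 0"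
  shows "u = 0"
proof (rule ccontr)
  assume u0: "u \<noteq> 0"
  have "\<exists>z. z \<noteq> 0 \<and> gl_module.maxvec n (tidx n {1..r} {1..r}) (lact {1..r} {1..r}) (\<lambda>i. of_int (wgt n lam mu i)) z"
    by (rule exists_maxvec_weight) (use lamD muD n2k rk in auto)
  then obtain z where z: "z \<noteq> 0"
    "gl_module.maxvec n (tidx n {1..r} {1..r}) (lact {1..r} {1..r}) (\<lambda>i. of_int (wgt n lam mu i)) z"
    by (elim exE conjE)
  interpret R: tensor_module n "{1..r}" "{1..r}" by unfold_locales auto
  interpret X: hw_pair n "tidx n {1..k} {1..k}" L "tidx n {1..r} {1..r}" "lact {1..r} {1..r}" u z "\<lambda>i. of_int (wgt n lam mu i)"
    by unfold_locales (use u z in auto)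
  show False
  proof (rule X.hw_hom_exists[OF u0])
    fix F assume F:
      "\<And>u v. u \<in> fsupp (tidx n {1..k} {1..k}) \<Longrightarrow> v \<in> fsupp (tidx n {1..k} {1..k}) \<Longrightarrow> F (u + v) = F u + F v"
      "\<And>c u. u \<in> fsupp (tidx n {1..k} {1..k}) \<Longrightarrow> F (smul c u) = smul c (F u)"
      "\<And>i j u. i \<in> {1..n} \<Longrightarrow> j \<in> {1..n} \<Longrightarrow> u \<in> fsupp (tidx n {1..k} {1..k}) \<Longrightarrow> F (L i j u) = lact {1..r} {1..r} i j (F u)"
      "F u = z"
      "\<And>u. u \<in> fsupp (tidx n {1..k} {1..k}) \<Longrightarrow> F u \<in> R.cyc z"
    have "R.cyc z \<subseteq> fsupp (tidx n {1..r} {1..r})"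
      using R.cyc_stable[OF z(2)] by (simp add: R.stable_def)
    then interpret F: tensor_hom n "{1..k}" "{1..r}" F
      by unfold_locales (use F in auto)
    have "F u = 0"
    proof (rule F.hom_vanish)
      show "card {1..r} \<le> card {1..k}" "card {1..k} + card {1..r} \<le> n" using rk n2k by simp_all
      show "u \<in> fsupp (tidx n {1..k} {1..k})" using u by (simp add: maxvec_def)
    qed (rule pc0; simp)
    then show False using F(4) z(1) by simp
  qed
qed

theorem Mlm_maxvec: "Mlm n k lam mu = {u. maxvec (\<lambda>i. of_int (wgt n lam mu i)) u}" (is "_ = ?H")
proof
  let ?G = "{yV lam T (yW mu Ts (cst n k s t (xprime n k lam T mu Ts s t))) | s t T Ts.
        sorted_wrt (<) s \<and> set s \<subseteq> {1..k} \<and> length s = k - r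
      \<and> distinct t \<and> set t \<subseteq> {1..k} \<and> length t = k - r
      \<and> std_tableau lam ({1..k} - set s) T \<and> std_tableau mu ({1..k} - set t) Ts}"
  have M: "Mlm n k lam mu = cspan ?G" by (simp add: Mlm_def lamD(3))
  have "?G \<subseteq> ?H"
  proof clarify
    fix s t T Ts assume s: "sorted_wrt (<) s" "set s \<subseteq> {1..k}" "length s = k - r"
      and t: "distinct t" "set t \<subseteq> {1..k}" "length t = k - r"
      and T: "std_tableau lam ({1..k} - set s) T" "std_tableau mu ({1..k} - set t) Ts"
    have ds: "distinct s" using s(1) by (simp add: strict_sorted_iff)
    have "length s = length t" using s t by simp
    from list_pairing[OF ds t(1) this] obtain \<tau> where
      \<tau>: "\<And>i. i < length t \<Longrightarrow> \<tau> (t ! i) = s ! i" "bij_betw \<tau> (set t) (set s)" by blast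
    show "maxvec (\<lambda>i. of_int (wgt n lam mu i)) (yV lam T (yW mu Ts (cst n k s t (xprime n k lam T mu Ts s t))))"
    proof -
      have eq: "yV lam T (yW mu Ts (cst n k s t (xprime n k lam T mu Ts s t)))
        = capped n {1..k} (set t) \<tau> (\<lambda>x. of_int (tableau.fT lam ({1..k} - set s) T x))
            (\<lambda>y. of_int (tableau.fT mu ({1..k} - set t) Ts y))"
        by (rule generator_capped[OF ds s(2,3) t T]) (rule \<tau>(1))
      show ?thesis unfolding eq
        by (rule capped_maxvec[OF _ s(2) t(2) \<tau>(2)])
          (auto intro: tableau.fT_hw tableauI T)
    qed
  qed
  then show "Mlm n k lam mu \<subseteq> ?H" unfolding M by (intro cspan_least maxvec_subspace)
  show "?H \<subseteq> Mlm n k lam mu"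
  proof
    fix u assume u: "u \<in> ?H"
    have sub: "is_subspace (Mlm n k lam mu)" unfolding M by (rule cspan_subspace)
    have MZ: "Mlm n k lam mu \<subseteq> fsupp (tidx n {1..k} {1..k})"
      using \<open>Mlm n k lam mu \<subseteq> ?H\<close> by (auto simp: maxvec_def)
    obtain w where w: "w \<in> Mlm n k lam mu" "\<forall>x\<in>Mlm n k lam mu. ip (tidx n {1..k} {1..k}) (u - w) x = 0"
      using orth_projection[OF finZ sub MZ, of u] by blast
    have "w \<in> ?H" using w(1) \<open>Mlm n k lam mu \<subseteq> ?H\<close> by blast
    then have uw: "maxvec (\<lambda>i. of_int (wgt n lam mu i)) (u - w)"
      using is_subspaceD(4)[OF maxvec_subspace u] by simp
    have "u - w = 0"
    proof (rule maxvec_pc_0[OF uw])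
      fix S S' \<tau> \<alpha> \<beta>
      assume S: "S \<subseteq> {1..k}" "S' \<subseteq> {1..k}" "bij_betw \<tau> S' S" "card S' = k - r"
        and \<alpha>\<beta>: "\<alpha> \<in> PiE ({1..k} - S) (\<lambda>_. {1..n})" "\<beta> \<in> PiE ({1..k} - S') (\<lambda>_. {1..n})"
      have finS: "finite S" "finite S'" using S by (auto intro: finite_subset)
      have cS: "card S = k - r" using bij_betw_same_card[OF S(3)] S(4) by simp
      interpret Q: pairing_max n "{1..k}" S S' \<tau> lam mu r "u - w"
      proof unfold_locales
        show "card ({1..k} - S) = r" "card ({1..k} - S') = r"
          using S cS finS rk by (simp_all add: card_Diff_subset)
      qed (use S uw lamD muD n2k rk in auto)
      show "pc n S S' \<tau> (u - w) \<alpha> \<beta> = 0"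
      proof (rule Q.g_eq_0[OF lamD(1) muD(1) _ \<alpha>\<beta>])
        fix T Ts assume T: "std_tableau lam ({1..k} - S) T" "std_tableau mu ({1..k} - S') Ts"
        \<comment> \<open>Every bijection \<open>\<tau>\<close> comes from admissible lists:
          \<open>s\<close> lists \<open>S\<close> in increasing order, as the generators demand, and
          the order of \<open>t\<close> is then dictated by \<open>\<tau>\<close>.\<close>
        define s where "s = sorted_list_of_set S"
        define t where "t = map (inv_into S' \<tau>) s"
        have s: "sorted_wrt (<) s" "set s = S" "length s = k - r" "distinct s"
          using finS cS by (simp_all add: s_def)
        have img: "\<tau> ` S' = S" using S(3) by (simp add: bij_betw_def)
        have t: "distinct t" "set t = S'" "length t = k - r"
        proof -
          have "inj_on (inv_into S' \<tau>) (set s)" unfolding s(2) by (rule inj_on_inv_into) (simp add: img)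
          then show "distinct t" using s(4) by (simp add: t_def distinct_map)
          show "set t = S'" using bij_betw_inv_into[OF S(3)] by (simp add: t_def s(2) bij_betw_def)
          show "length t = k - r" by (simp add: t_def s(3))
        qed
        have ts: "\<tau> (t ! i) = s ! i" if "i < length t" for i
        proof -
          have "s ! i \<in> \<tau> ` S'" using that s(2) by (simp add: img t_def) (metis nth_mem)
          then show ?thesis using that by (simp add: t_def f_inv_into_f)
        qed
        have "yV lam T (yW mu Ts (cst n k s t (xprime n k lam T mu Ts s t))) \<in> ?G"
          using s t S T by blast
        then have in_M: "yV lam T (yW mu Ts (cst n k s t (xprime n k lam T mu Ts s t))) \<in> Mlm n k lam mu"
          unfolding M by (rule cspan_base)
        have "yV lam T (yW mu Ts (cst n k s t (xprime n k lam T mu Ts s t)))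
          = capped n {1..k} (set t) \<tau> (\<lambda>x. of_int (tableau.fT lam ({1..k} - set s) T x))
              (\<lambda>y. of_int (tableau.fT mu ({1..k} - set t) Ts y))"
          by (rule generator_capped) (use s t S T ts in auto)
        with in_M show "ip (tidx n {1..k} {1..k}) (u - w) (capped n {1..k} S' \<tau>
            (\<lambda>x. of_int (tableau.fT lam ({1..k} - S) T x)) (\<lambda>y. of_int (tableau.fT mu ({1..k} - S') Ts y))) = 0"
          using w(2) unfolding s(2) t(2) by simp
      qed
    qed
    then show "u \<in> Mlm n k lam mu" using w(1) by simp
  qed
qed

text \<open>The idempotent maps maximal vectors into \<open>eM n k\<close> and fixes those that
  already lie there.\<close>

lemma eMlm_H: "eMlm n k lam mu = H (wgt n lam mu)"
proof
  show "eMlm n k lam mu \<subseteq> H (wgt n lam mu)"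
    unfolding eMlm_def Mlm_maxvec H_def eM_def
    by (auto intro: eop_maxvec) (auto simp: maxvec_def Mset_eq)
  show "H (wgt n lam mu) \<subseteq> eMlm n k lam mu"
  proof
    fix u assume u: "u \<in> H (wgt n lam mu)"
    have "eop n k u = u" using H_eM[OF u] unfolding eM_iff[OF k_le_n] by (intro eop_id) auto
    then show "u \<in> eMlm n k lam mu"
      using H_maxvec[OF u] unfolding eMlm_def Mlm_maxvec by (metis image_eqI mem_Collect_eq)
  qed
qed

end

end

section \<open>Weights and their labels by pairs of partitions\<close>

lemma antitone_partition:
  fixes f :: "nat \<Rightarrow> nat"
  assumes "\<And>i. 1 \<le> i \<Longrightarrow> i < n \<Longrightarrow> f (Suc i) \<le> f i"
  shows "\<exists>lam. sorted_wrt (\<ge>) lam \<and> 0 \<notin> set lam \<and> length lam \<le> n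
    \<and> (\<forall>i\<in>{1..n}. part lam i = f i) \<and> sum_list lam = (\<Sum>i\<in>{1..n}. f i)"
  using assms
proof (induction n)
  case 0
  then show ?case by (intro exI[of _ "[]"]) simp
next
  case (Suc n)
  have "\<exists>lam. sorted_wrt (\<ge>) lam \<and> 0 \<notin> set lam \<and> length lam \<le> n
    \<and> (\<forall>i\<in>{1..n}. part lam i = f i) \<and> sum_list lam = (\<Sum>i\<in>{1..n}. f i)"
    by (rule Suc.IH) (use Suc.prems in auto)
  then obtain lam where lam: "sorted_wrt (\<ge>) lam" "0 \<notin> set lam" "length lam \<le> n"
    "\<And>i. i \<in> {1..n} \<Longrightarrow> part lam i = f i" "sum_list lam = (\<Sum>i\<in>{1..n}. f i)" by blast
  have sumS: "(\<Sum>i\<in>{1..Suc n}. f i) = (\<Sum>i\<in>{1..n}. f i) + f (Suc n)" by simp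
  show ?case
  proof (cases "f (Suc n) = 0")
    case True
    have "part lam i = f i" if "i \<in> {1..Suc n}" for i
      using lam(3) lam(4)[of i] True that part_eq_0[of lam i] by (cases "i = Suc n") auto
    then show ?thesis using lam True sumS by (intro exI[of _ lam]) auto
  next
    case False
    \<comment> \<open>A nonzero new value forces the preceding one to be nonzero, so no trailing
      zero has been dropped before and the new part can be appended.\<close>
    have len: "length lam = n"
    proof (cases "n = 0")
      case n: False
      then have "f (Suc n) \<le> f n" using Suc.prems[of n] by simp
      then have "part lam n \<noteq> 0" using False lam(4)[of n] n by simp
      then have "n \<le> length lam" using part_eq_0[of lam n] by (metis not_le)
      then show ?thesis using lam(3) by simp
    qed (use lam(3) in simp)
    have "x \<ge> f (Suc n)" if x: "x \<in> set lam" for x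
    proof -
      obtain j where j: "j < n" "x = lam ! j" using x unfolding in_set_conv_nth len by auto
      have anti: "f (Suc n) \<le> f i" if "i \<le> Suc n" "1 \<le> i" for i
        using that
      proof (induction i rule: inc_induct)
        case (step i)
        then show ?case using Suc.prems[of i] by simp
      qed simp
      have "x = f (Suc j)" using lam(4)[of "Suc j"] j len by (simp add: part_def)
      then show ?thesis using anti[of "Suc j"] j by simp
    qed
    then have "sorted_wrt (\<ge>) (lam @ [f (Suc n)])" using lam(1) by (simp add: sorted_wrt_append)
    moreover have "part (lam @ [f (Suc n)]) i = f i" if "i \<in> {1..Suc n}" for i
    proof (cases "i = Suc n")
      case True
      then show ?thesis using len by (simp add: part_def nth_append)
    next
      case F: False
      then show ?thesis using lam(4)[of i] that len by (auto simp: part_def nth_append)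
    qed
    ultimately show ?thesis using lam len False sumS
      by (intro exI[of _ "lam @ [f (Suc n)]"]) auto
  qed
qed

lemma part_inject:
  assumes "0 \<notin> set l" "0 \<notin> set m" "\<And>i. part l i = part m i"
  shows "l = m"
proof -
  have nz: "part l i \<noteq> 0 \<longleftrightarrow> 1 \<le> i \<and> i \<le> length l" if "0 \<notin> set l" for l :: "nat list" and i
  proof (cases "1 \<le> i \<and> i \<le> length l")
    case True
    then have "l ! (i - 1) \<in> set l" by (intro nth_mem) auto
    then have "l ! (i - 1) \<noteq> 0" using that by metis
    then show ?thesis using True by (simp add: part_def)
  qed (auto simp: part_def)
  have "length l = length m"
  proof (rule antisym)
    show "length l \<le> length m" using nz[OF assms(1), of "length l"] nz[OF assms(2), of "length l"] assms(3)
      by (cases "length l = 0") auto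
    show "length m \<le> length l" using nz[OF assms(1), of "length m"] nz[OF assms(2), of "length m"] assms(3)
      by (cases "length m = 0") auto
  qed
  then show ?thesis
  proof (rule nth_equalityI)
    fix i assume "i < length l"
    then show "l ! i = m ! i" using assms(3)[of "Suc i"] \<open>length l = length m\<close> by (simp add: part_def)
  qed
qed

text \<open>By the bounds at most one of the two parts is nonzero at each letter, so
  \<open>l\<close> and \<open>m\<close> are the positive and the reversed negative part of the
  weight.\<close>

lemma wgt_inject:
  assumes "is_partition r l" "is_partition r m" "is_partition q l'" "is_partition q m'"
    "2 * r \<le> n" "2 * q \<le> n" "\<And>i. i \<in> {1..n} \<Longrightarrow> wgt n l m i = wgt n l' m' i"
  shows "l = l' \<and> m = m'"
proof -
  have parts: "part l i = nat (wgt n l m i)" "part m (n + 1 - i) = nat (- wgt n l m i)"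
    if "is_partition r l" "is_partition r m" "2 * r \<le> n" "i \<in> {1..n}" for r l m i
  proof -
    have "part l i = 0 \<or> part m (n + 1 - i) = 0"
    proof (cases "i \<le> r")
      case True
      then have "part m (n + 1 - i) = 0"
        using that is_partitionD(4)[OF that(2)] by (intro part_eq_0) auto
      then show ?thesis ..
    next
      case False
      then have "part l i = 0" using is_partitionD(4)[OF that(1)] by (intro part_eq_0) auto
      then show ?thesis ..
    qed
    then show "part l i = nat (wgt n l m i)" "part m (n + 1 - i) = nat (- wgt n l m i)"
      by (auto simp: wgt_def)
  qed
  have ends: "part x i = 0" if "is_partition r x" "2 * r \<le> n" "i \<notin> {1..n}" for r x i
    using that is_partitionD(4)[OF that(1)] by (auto simp: part_def)
  have "part l i = part l' i" for i
  proof (cases "i \<in> {1..n}")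
    case True
    then show ?thesis using parts(1)[OF assms(1,2,5)] parts(1)[OF assms(3,4,6)] assms(7) by simp
  next
    case False
    then show ?thesis using ends[OF assms(1,5)] ends[OF assms(3,6)] by simp
  qed
  moreover have "part m i = part m' i" for i
  proof (cases "i \<in> {1..n}")
    case True
    then have j: "n + 1 - i \<in> {1..n}" "n + 1 - (n + 1 - i) = i" by auto
    show ?thesis
      using parts(2)[OF assms(1,2,5) j(1)] parts(2)[OF assms(3,4,6) j(1)] assms(7)[OF j(1)]
      unfolding j(2) by simp
  next
    case False
    then show ?thesis using ends[OF assms(2,5)] ends[OF assms(4,6)] by simp
  qed
  ultimately show ?thesis
    using part_inject is_partitionD(2)[OF assms(1)] is_partitionD(2)[OF assms(2)]
      is_partitionD(2)[OF assms(3)] is_partitionD(2)[OF assms(4)] by blast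
qed

context mixed_tensors
begin

lemma H_cong:
  assumes "\<And>i. i \<in> {1..n} \<Longrightarrow> \<omega> i = \<psi> i"
  shows "H \<omega> = H \<psi>"
  using assms unfolding H_def maxvec_def by auto

text \<open>The positive and the reversed negative part of a dominant weight are partitions. They
  have the same size because there are as many vector places as dual ones, and the size is at most
  \<open>k\<close> because positive entries are bounded by the letter counts of the vector
  places.\<close>

lemma maxvec_label:
  assumes max: "maxvec (\<lambda>i. of_int (\<omega> i)) u" and "u \<noteq> 0"
  shows "\<exists>r lam mu. r \<le> k \<and> is_partition r lam \<and> is_partition r mu \<and> (\<forall>i\<in>{1..n}. \<omega> i = wgt n lam mu i)"
proof -
  obtain z where z: "u z \<noteq> 0" using assms(2) by (metis ext zero_fun_apply)
  obtain a b where ab: "z = (a, b)" by (cases z)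
  have "z \<in> tidx n {1..k} {1..k}" using max z unfolding maxvec_def fsupp_def by blast
  then have abW: "a \<in> PiE {1..k} (\<lambda>_. {1..n})" "b \<in> PiE {1..k} (\<lambda>_. {1..n})" by (auto simp: tidx_def ab)
  have \<omega>: "\<omega> i = int (cnt {1..k} a i) - int (cnt {1..k} b i)" if i: "i \<in> {1..n}" for i
  proof -
    have "complex_of_int (\<omega> i) = of_int (wt {1..k} {1..k} z i)" by (rule maxvec_wt[OF max z i])
    then have "\<omega> i = wt {1..k} {1..k} z i" by (simp only: of_int_eq_iff)
    then show ?thesis by (simp add: ab wt_cnt)
  qed
  have ca: "(\<Sum>i\<in>{1..n}. cnt {1..k} a i) = k" and cb: "(\<Sum>i\<in>{1..n}. cnt {1..k} b i) = k"
    using sum_cnt[of "{1..k}" a n] sum_cnt[of "{1..k}" b n] PiE_mem[OF abW(1)] PiE_mem[OF abW(2)] by simp_all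
  have dom: "\<omega> (Suc i) \<le> \<omega> i" if "1 \<le> i" "i < n" for i
    using maxvec_dominant[OF max assms(2) that] .
  define f f' where "f i = nat (\<omega> i)" and "f' i = nat (- \<omega> (n + 1 - i))" for i
  have "\<exists>lam. sorted_wrt (\<ge>) lam \<and> 0 \<notin> set lam \<and> length lam \<le> n
    \<and> (\<forall>i\<in>{1..n}. part lam i = f i) \<and> sum_list lam = (\<Sum>i\<in>{1..n}. f i)"
    by (rule antitone_partition) (use dom in \<open>auto simp: f_def nat_mono\<close>)
  then obtain lam where lam: "sorted_wrt (\<ge>) lam" "0 \<notin> set lam" "\<forall>i\<in>{1..n}. part lam i = f i"
    "sum_list lam = (\<Sum>i\<in>{1..n}. f i)" by blast
  have "\<exists>mu. sorted_wrt (\<ge>) mu \<and> 0 \<notin> set mu \<and> length mu \<le> n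
    \<and> (\<forall>i\<in>{1..n}. part mu i = f' i) \<and> sum_list mu = (\<Sum>i\<in>{1..n}. f' i)"
  proof (rule antitone_partition)
    fix i assume i: "1 \<le> i" "i < n"
    then have "Suc (n + 1 - Suc i) = n + 1 - i" by simp
    then show "f' (Suc i) \<le> f' i" using dom[of "n + 1 - Suc i"] i unfolding f'_def by (simp add: nat_mono)
  qed
  then obtain mu where mu: "sorted_wrt (\<ge>) mu" "0 \<notin> set mu" "\<forall>i\<in>{1..n}. part mu i = f' i"
    "sum_list mu = (\<Sum>i\<in>{1..n}. f' i)" by blast
  have rev: "(\<Sum>i\<in>{1..n}. f' i) = (\<Sum>i\<in>{1..n}. nat (- \<omega> i))"
    unfolding f'_def by (rule sum.reindex_bij_witness[of _ "\<lambda>i. n + 1 - i" "\<lambda>i. n + 1 - i"]) auto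
  have "int (\<Sum>i\<in>{1..n}. f i) - int (\<Sum>i\<in>{1..n}. nat (- \<omega> i)) = (\<Sum>i\<in>{1..n}. \<omega> i)"
    unfolding int_sum sum_subtractf[symmetric] by (intro sum.cong refl) (simp add: f_def)
  also have "\<dots> = (\<Sum>i\<in>{1..n}. int (cnt {1..k} a i) - int (cnt {1..k} b i))"
    by (intro sum.cong refl \<omega>)
  also have "\<dots> = 0" using ca cb by (simp add: sum_subtractf flip: int_sum)
  finally have eq: "sum_list mu = sum_list lam" unfolding lam(4) mu(4) rev by linarith
  have "sum_list lam \<le> (\<Sum>i\<in>{1..n}. cnt {1..k} a i)"
    unfolding lam(4) by (intro sum_mono) (simp add: f_def \<omega>)
  then have "sum_list lam \<le> k" using ca by simp
  moreover have "is_partition (sum_list lam) lam" "is_partition (sum_list lam) mu"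
    using lam mu eq by (simp_all add: is_partition_def)
  moreover have "\<omega> i = wgt n lam mu i" if i: "i \<in> {1..n}" for i
  proof -
    have "n + 1 - i \<in> {1..n}" "n + 1 - (n + 1 - i) = i" using i by auto
    then have "part mu (n + 1 - i) = nat (- \<omega> i)" using mu(3) by (simp add: f'_def)
    then show ?thesis using lam(3) i by (simp add: wgt_def f_def)
  qed
  ultimately show ?thesis by blast
qed

end

theorem theorem3p5:
  fixes n k :: nat
  assumes "2 * k \<le> n"
  shows "(\<forall>(lam, mu)\<in>nonzero_labels n k.
            irreducible_Cmod n k (eMlm n k lam mu) (\<lambda>f u. f u))
       \<and> (\<forall>(l1, m1)\<in>nonzero_labels n k. \<forall>(l2, m2)\<in>nonzero_labels n k.
            (l1, m1) \<noteq> (l2, m2) \<longrightarrow>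
            \<not> Cmod_iso n k (eMlm n k l1 m1) (\<lambda>f u. f u) (eMlm n k l2 m2) (\<lambda>f u. f u))
       \<and> (\<forall>(N :: ('b \<Rightarrow> complex) set) \<rho>. irreducible_Cmod n k N \<rho> \<longrightarrow>
            (\<exists>(lam, mu)\<in>nonzero_labels n k. Cmod_iso n k N \<rho> (eMlm n k lam mu) (\<lambda>f u. f u)))"
proof -
  interpret mixed_tensors n k by unfold_locales (use assms in simp)
  have label: "\<exists>r\<le>k. is_partition r lam \<and> is_partition r mu \<and> eMlm n k lam mu = H (wgt n lam mu) \<and> H (wgt n lam mu) \<noteq> {0}"
    if "(lam, mu) \<in> nonzero_labels n k" for lam mu
  proof -
    have "\<exists>r\<le>k. is_partition r lam \<and> is_partition r mu \<and> eMlm n k lam mu \<noteq> {0}"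
      using that by (simp add: nonzero_labels_def)
    then obtain r where r: "r \<le> k" "is_partition r lam" "is_partition r mu" and nz: "eMlm n k lam mu \<noteq> {0}"
      by (elim exE conjE)
    have eq: "eMlm n k lam mu = H (wgt n lam mu)" by (rule eMlm_H[OF assms r])
    then show ?thesis using r nz unfolding eq by (intro exI[of _ r] conjI)
  qed
  have "irreducible_Cmod n k (eMlm n k lam mu) (\<lambda>f u. f u)" if l: "(lam, mu) \<in> nonzero_labels n k" for lam mu
  proof -
    obtain r where eq: "eMlm n k lam mu = H (wgt n lam mu)" and nz: "H (wgt n lam mu) \<noteq> {0}"
      using label[OF l] by (elim exE conjE)
    show ?thesis unfolding eq by (rule H_irreducible[OF nz])
  qed
  moreover have "\<not> Cmod_iso n k (eMlm n k l1 m1) (\<lambda>f u. f u) (eMlm n k l2 m2) (\<lambda>f u. f u)"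
    if l: "(l1, m1) \<in> nonzero_labels n k" "(l2, m2) \<in> nonzero_labels n k" "(l1, m1) \<noteq> (l2, m2)" for l1 m1 l2 m2
  proof -
    obtain r where r: "r \<le> k" "is_partition r l1" "is_partition r m1" "eMlm n k l1 m1 = H (wgt n l1 m1)" "H (wgt n l1 m1) \<noteq> {0}"
      using label[OF l(1)] by (elim exE conjE)
    obtain q where q: "q \<le> k" "is_partition q l2" "is_partition q m2" "eMlm n k l2 m2 = H (wgt n l2 m2)"
      using label[OF l(2)] by (elim exE conjE)
    have "\<exists>i\<in>{1..n}. wgt n l1 m1 i \<noteq> wgt n l2 m2 i"
    proof (rule ccontr)
      assume "\<not> (\<exists>i\<in>{1..n}. wgt n l1 m1 i \<noteq> wgt n l2 m2 i)"
      then have "l1 = l2 \<and> m1 = m2"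
        using r(1) q(1) assms by (intro wgt_inject[OF r(2,3) q(2,3), of n]) simp_all
      then show False using l(3) by simp
    qed
    then obtain i where "i \<in> {1..n}" "wgt n l1 m1 i \<noteq> wgt n l2 m2 i" by (elim bexE)
    then show ?thesis unfolding r(4) q(4) by (rule H_not_iso[OF r(5)])
  qed
  moreover have "\<exists>(lam, mu)\<in>nonzero_labels n k. Cmod_iso n k N \<rho> (eMlm n k lam mu) (\<lambda>f u. f u)"
    if irr: "irreducible_Cmod n k N \<rho>" for N :: "('b \<Rightarrow> complex) set" and \<rho>
  proof -
    obtain \<omega> where \<omega>: "H \<omega> \<noteq> {0}" "Cmod_iso n k N \<rho> (H \<omega>) (\<lambda>f u. f u)"
      using irreducible_iso_H[OF irr] by (elim exE conjE)
    have "\<exists>u\<in>H \<omega>. u \<noteq> 0" using \<omega>(1) H_closed(1)[of \<omega>] by auto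
    then obtain u where u: "u \<in> H \<omega>" "u \<noteq> 0" by (elim bexE)
    obtain r lam mu where r: "r \<le> k" "is_partition r lam" "is_partition r mu" "\<forall>i\<in>{1..n}. \<omega> i = wgt n lam mu i"
      using maxvec_label[OF H_maxvec[OF u(1)] u(2)] by (elim exE conjE)
    \<comment> \<open>The weight and its label are known to agree on \<open>{1..n}\<close>, which is
      all that \<open>H\<close> depends on.\<close>
    have eq: "eMlm n k lam mu = H \<omega>"
      using eMlm_H[OF assms r(1-3)] H_cong[of \<omega> "wgt n lam mu"] r(4) by simp
    have "(lam, mu) \<in> nonzero_labels n k"
      unfolding nonzero_labels_def mem_Collect_eq prod.case eq using r(1-3) \<omega>(1) by (intro exI[of _ r] conjI)
    then show ?thesis using \<omega>(2) eq by (intro bexI[of _ "(lam, mu)"]) simp_all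
  qed
  ultimately show ?thesis by (intro conjI ballI allI impI) (simp_all add: split_def)
qed

end
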